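(* Let the standing assumptions listed in the context hold. Let $(\bar{\mathbf u},\bar{\mathbf e})\in\mathbf L^2(\Omega)\times\mathbf E$, and assume there exists $\varrho>0$ such that $\mathcal U_{ad}(\mathbf e)\neq\emptyset$ for all $\mathbf e$ in the closed ball $\bar B_\varrho(\bar{\mathbf e})\subset\mathbf E$. Define the quadratic form $\mathcal Q:\mathbf L^2(\Omega)\to\mathbb R$ by $$\mathcal Q(\mathbf h)=\langle F'_{\mathbf u}(\bar{\mathbf u},\bar{\mathbf e})\mathbf h,\mathbf h\rangle,\qquad\mathbf h\in\mathbf L^2(\Omega).$$ Then $\mathcal Q$ is a Legendre form on $\mathbf L^2(\Omega)$.
   Context: Data. Let $m\ge 1$ be an integer and $N\in\{1,2,3\}$. Let $\Omega\subset\mathbb R^N$ be an open bounded domain with Lipschitz boundary $\Gamma$, and let $\mathcal A y=-\sum_{i,j=1}^N\partial_{x_j}(a_{ij}(x)\partial_{x_i}y)$ with $a_{ij}\in L^\infty(\Omega)$ and, for some $\lambda_{\mathcal A}>0$, $\lambda_{\mathcal A}\|\xi\|^2\le\sum_{i,j}a_{ij}(x)\xi_i\xi_j$ for all $\xi\in\mathbb R^N$ and a.a. $x\in\Omega$. Let $\zeta_k,B_k\in L^\infty(\Omega)$ for $k=1,\ldots,m$, with $\zeta_k(x)\ge\zeta_{0k}>0$ for a.a. $x\in\Omega$ ($\zeta_{0k}$ a constant). Let $f,L_1,\ldots,L_m:\Omega\times\mathbb R\to\mathbb R$ be Carathéodory functions of class $C^2$ with respect to the second variable $y$. Assumptions on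 $f$: $f(\cdot,0)\in L^2(\Omega)$, $\frac{\partial f}{\partial y}(x,y)\ge0$ for a.a. $x\in\Omega$ (and all $y$), and for every $M>0$ there is $C_{f,M}>0$ with $|\frac{\partial f}{\partial y}(x,y)|+|\frac{\partial^2f}{\partial y^2}(x,y)|\le C_{f,M}$ and $|\frac{\partial^2f}{\partial y^2}(x,y_2)-\frac{\partial^2f}{\partial y^2}(x,y_1)|\le C_{f,M}|y_2-y_1|$ for a.a. $x\in\Omega$ and all $|y|,|y_1|,|y_2|\le M$. Assumptions on $L_k$ (each $k$): $L_k(\cdot,0)\in L^1(\Omega)$, and for every $M>0$ there are $C_{L_k,M}>0$ and $\psi_{k,M}\in L^2(\Omega)$ with $|\frac{\partial L_k}{\partial y}(x,y)|\le\psi_{k,M}(x)$, $|\frac{\partial^2L_k}{\partial y^2}(x,y)|\le C_{L_k,M}$ and $|\frac{\partial^2L_k}{\partial y^2}(x,y_2)-\frac{\partial^2L_k}{\partial y^2}(x,y_1)|\le C_{L_k,M}|y_2-y_1|$ for a.a. $x\in\Omega$ and all $|y|,|y_1|,|y_2|\le M$. State and costs. For $w\in L^2(\Omega)$, $y_w\in H^1_0(\Omega)\cap C(\bar\Omega)$ denotes the unique weak solution of $\mathcal A y+f(x,y)=w$ in $\Omega$, $y=0$ on $\Gamma$. For $(u_1,\ldots,u_m)\in L^2(\Omega)^m$ put $u=\sum_{i=1}^mB_iu_i$ and $J_k(u_1,\ldots,u_m)=\int_\Omega L_k(x,y_u)\,dx+\frac12\int_\Omega\zeta_ku_k^2\,dx$;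 $J_k$ is of class $C^2$ on $L^2(\Omega)^m$. One writes $(u_k,u_{-k})$ for $(u_1,\ldots,u_m)$, where $u_{-k}$ collects the components other than $u_k$. Parameters. $E_Y\subset L^2(\Omega)$, $E_{k,J}\subset L^2(\Omega)$ and $E_{k,\bullet}$ are metric spaces of parameters, $E_k=E_{k,J}\times E_{k,\bullet}$ with elements $e_k=(e_{k,J},e_{k,\bullet})$, and $\mathbf E=E_Y\times E_1\times\cdots\times E_m$ with the sum metric; $\mathbf e=(e_Y,e_1,\ldots,e_m)$. The perturbed cost is $\mathcal J_k(u_k,u_{-k},e_Y,e_k)=J_k(u_k+e_Y,u_{-k})+(e_{k,J},y_{u+e_Y})_{L^2(\Omega)}$ with $u=\sum_iB_iu_i$. For each $k$ and $e_k\in E_k$, $\mathcal U^k_{ad}(e_k)\subset L^2(\Omega)$ is convex, closed and bounded, and $\mathcal U_{ad}(\mathbf e)=\prod_{k=1}^m\mathcal U^k_{ad}(e_k)$. $\mathbf L^2(\Omega)=L^2(\Omega)^m$ with inner product $\langle\mathbf u,\mathbf v\rangle=\sum_k(u_k,v_k)_{L^2(\Omega)}$. $F(\mathbf u,\mathbf e)=(\nabla_{u_1}\mathcal J_1(\mathbf u,e_Y,e_1),\ldots,\nabla_{u_m}\mathcal J_m(\mathbf u,e_Y,e_m))\in\mathbf L^2(\Omega)$ and $F'_{\mathbf u}$ is its partial derivative in $\mathbf u$; thus $\langle F'_{\mathbf u}(\mathbf u,\mathbf e)\mathbf h,\mathbf h\rangle=\sum_{k=1}^m\sum_{j=1}^m\nabla^2_{u_ku_j}\mathcal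 J_k(\mathbf u,e_Y,e_k)(h_k,h_j)$. A quadratic form $Q$ on a Hilbert space $H$ is a Legendre form if it is sequentially weakly lower semicontinuous and $h_n\rightharpoonup h$ weakly together with $Q(h_n)\to Q(h)$ implies $h_n\to h$ strongly. *)

theory Defs
  imports "HOL-Analysis.Analysis"
begin

section \<open>Lebesgue and Sobolev spaces on a domain\<close>

text \<open>Elements of the Lebesgue and Sobolev spaces over \<open>\<Omega>\<close> are represented by functions on the whole
  space; only their values on \<open>\<Omega>\<close> matter, and functions that agree almost everywhere on \<open>\<Omega>\<close> represent
  the same element.\<close>

definition L1_space :: "(real^'n) set \<Rightarrow> (real^'n \<Rightarrow> real) set" where
  "L1_space \<Omega> = {u. integrable (lebesgue_on \<Omega>) u}"

definition L2_space :: "(real^'n) set \<Rightarrow> (real^'n \<Rightarrow> real) set" where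
  "L2_space \<Omega> = {u \<in> borel_measurable (lebesgue_on \<Omega>). integrable (lebesgue_on \<Omega>) (\<lambda>x. (u x)\<^sup>2)}"

definition Linf_space :: "(real^'n) set \<Rightarrow> (real^'n \<Rightarrow> real) set" where
  "Linf_space \<Omega> = {u \<in> borel_measurable (lebesgue_on \<Omega>). \<exists>C. AE x in lebesgue_on \<Omega>. \<bar>u x\<bar> \<le> C}"

definition L2_inner :: "(real^'n) set \<Rightarrow> (real^'n \<Rightarrow> real) \<Rightarrow> (real^'n \<Rightarrow> real) \<Rightarrow> real" where
  "L2_inner \<Omega> u v = (LINT x|lebesgue_on \<Omega>. u x * v x)"

definition L2_norm :: "(real^'n) set \<Rightarrow> (real^'n \<Rightarrow> real) \<Rightarrow> real" where
  "L2_norm \<Omega> u = sqrt (L2_inner \<Omega> u u)"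

definition classical_partial :: "'n::finite \<Rightarrow> (real^'n \<Rightarrow> real) \<Rightarrow> real^'n \<Rightarrow> real" where
  "classical_partial i \<phi> x = frechet_derivative \<phi> (at x) (axis i 1)"

text \<open>A function is smooth iff all its iterated partial derivatives (of every order, including
  order zero) are differentiable everywhere.\<close>

definition smooth :: "(real^'n::finite \<Rightarrow> real) \<Rightarrow> bool" where
  "smooth \<phi> \<longleftrightarrow> (\<forall>is x. foldr classical_partial is \<phi> differentiable (at x))"

definition test_functions :: "(real^'n::finite) set \<Rightarrow> (real^'n \<Rightarrow> real) set" where
  "test_functions \<Omega> =
     {\<phi>. smooth \<phi> \<and> compact (closure {x. \<phi> x \<noteq> 0}) \<and> closure {x. \<phi> x \<noteq> 0} \<subseteq> \<Omega>}"

definition has_weak_partial ::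
    "(real^'n::finite) set \<Rightarrow> 'n \<Rightarrow> (real^'n \<Rightarrow> real) \<Rightarrow> (real^'n \<Rightarrow> real) \<Rightarrow> bool" where
  "has_weak_partial \<Omega> i u g \<longleftrightarrow>
     (\<forall>\<phi>\<in>test_functions \<Omega>. L2_inner \<Omega> u (classical_partial i \<phi>) = - L2_inner \<Omega> g \<phi>)"

definition H1_space :: "(real^'n::finite) set \<Rightarrow> (real^'n \<Rightarrow> real) set" where
  "H1_space \<Omega> = {u \<in> L2_space \<Omega>. \<forall>i. \<exists>g\<in>L2_space \<Omega>. has_weak_partial \<Omega> i u g}"

text \<open>For \<open>u \<in> H1_space \<Omega>\<close> this is well defined up to equality almost everywhere on \<open>\<Omega>\<close>.\<close>

definition weak_partial ::
    "(real^'n::finite) set \<Rightarrow> 'n \<Rightarrow> (real^'n \<Rightarrow> real) \<Rightarrow> (real^'n \<Rightarrow> real)" where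
  "weak_partial \<Omega> i u = (SOME g. g \<in> L2_space \<Omega> \<and> has_weak_partial \<Omega> i u g)"

definition H1_norm :: "(real^'n::finite) set \<Rightarrow> (real^'n \<Rightarrow> real) \<Rightarrow> real" where
  "H1_norm \<Omega> u = sqrt ((L2_norm \<Omega> u)\<^sup>2 + (\<Sum>i\<in>UNIV. (L2_norm \<Omega> (weak_partial \<Omega> i u))\<^sup>2))"

definition H10_space :: "(real^'n::finite) set \<Rightarrow> (real^'n \<Rightarrow> real) set" where
  "H10_space \<Omega> = {u \<in> H1_space \<Omega>. \<exists>\<phi>. (\<forall>n. \<phi> n \<in> test_functions \<Omega>) \<and>
       (\<lambda>n::nat. H1_norm \<Omega> (\<lambda>x. \<phi> n x - u x)) \<longlonglongrightarrow> 0}"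


section \<open>Domain, operator and nonlinearities\<close>

text \<open>Near each boundary point, \<open>\<Omega>\<close> is the strict epigraph, in the direction of a unit vector \<open>e\<close>, of a
  Lipschitz function \<open>g\<close> on the hyperplane orthogonal to \<open>e\<close>.\<close>

definition lipschitz_boundary :: "(real^'n::finite) set \<Rightarrow> bool" where
  "lipschitz_boundary \<Omega> \<longleftrightarrow>
     (\<forall>p\<in>frontier \<Omega>. \<exists>V e g C. open V \<and> p \<in> V \<and> norm e = 1 \<and>
        C-lipschitz_on {z. e \<bullet> z = 0} (g :: real^'n \<Rightarrow> real) \<and>
        \<Omega> \<inter> V = {x \<in> V. g (x - (x \<bullet> e) *\<^sub>R e) < x \<bullet> e})"

definition lipschitz_domain :: "(real^'n::finite) set \<Rightarrow> bool" where
  "lipschitz_domain \<Omega> \<longleftrightarrow>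
     open \<Omega> \<and> connected \<Omega> \<and> \<Omega> \<noteq> {} \<and> bounded \<Omega> \<and> lipschitz_boundary \<Omega>"

definition elliptic_coefficients ::
    "(real^'n::finite) set \<Rightarrow> ('n \<Rightarrow> 'n \<Rightarrow> real^'n \<Rightarrow> real) \<Rightarrow> bool" where
  "elliptic_coefficients \<Omega> a \<longleftrightarrow>
     (\<forall>i j. a i j \<in> Linf_space \<Omega>) \<and>
     (\<exists>c>0. AE x in lebesgue_on \<Omega>. \<forall>\<xi>::real^'n.
        c * (norm \<xi>)\<^sup>2 \<le> (\<Sum>i\<in>UNIV. \<Sum>j\<in>UNIV. a i j x * \<xi> $ i * \<xi> $ j))"

definition caratheodory :: "(real^'n) set \<Rightarrow> (real^'n \<Rightarrow> real \<Rightarrow> real) \<Rightarrow> bool" where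
  "caratheodory \<Omega> g \<longleftrightarrow>
     (\<forall>t. (\<lambda>x. g x t) \<in> borel_measurable (lebesgue_on \<Omega>)) \<and>
     (AE x in lebesgue_on \<Omega>. continuous_on UNIV (g x))"

definition C2_real :: "(real \<Rightarrow> real) \<Rightarrow> bool" where
  "C2_real g \<longleftrightarrow> (\<forall>t. g field_differentiable (at t)) \<and> (\<forall>t. deriv g field_differentiable (at t)) \<and>
     continuous_on UNIV (deriv (deriv g))"

definition caratheodory_C2 :: "(real^'n) set \<Rightarrow> (real^'n \<Rightarrow> real \<Rightarrow> real) \<Rightarrow> bool" where
  "caratheodory_C2 \<Omega> g \<longleftrightarrow> caratheodory \<Omega> g \<and> (AE x in lebesgue_on \<Omega>. C2_real (g x))"

definition state_nonlinearity :: "(real^'n) set \<Rightarrow> (real^'n \<Rightarrow> real \<Rightarrow> real) \<Rightarrow> bool" where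
  "state_nonlinearity \<Omega> f \<longleftrightarrow>
     caratheodory_C2 \<Omega> f \<and>
     (\<lambda>x. f x 0) \<in> L2_space \<Omega> \<and>
     (AE x in lebesgue_on \<Omega>. \<forall>t. deriv (f x) t \<ge> 0) \<and>
     (\<forall>M>0. \<exists>C>0. AE x in lebesgue_on \<Omega>.
        (\<forall>t. \<bar>t\<bar> \<le> M \<longrightarrow> \<bar>deriv (f x) t\<bar> + \<bar>deriv (deriv (f x)) t\<bar> \<le> C) \<and>
        (\<forall>t1 t2. \<bar>t1\<bar> \<le> M \<and> \<bar>t2\<bar> \<le> M \<longrightarrow>
           \<bar>deriv (deriv (f x)) t2 - deriv (deriv (f x)) t1\<bar> \<le> C * \<bar>t2 - t1\<bar>))"

definition cost_integrand :: "(real^'n) set \<Rightarrow> (real^'n \<Rightarrow> real \<Rightarrow> real) \<Rightarrow> bool" where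
  "cost_integrand \<Omega> l \<longleftrightarrow>
     caratheodory_C2 \<Omega> l \<and>
     (\<lambda>x. l x 0) \<in> L1_space \<Omega> \<and>
     (\<forall>M>0. \<exists>C>0. \<exists>\<psi>\<in>L2_space \<Omega>. AE x in lebesgue_on \<Omega>.
        (\<forall>t. \<bar>t\<bar> \<le> M \<longrightarrow> \<bar>deriv (l x) t\<bar> \<le> \<psi> x \<and> \<bar>deriv (deriv (l x)) t\<bar> \<le> C) \<and>
        (\<forall>t1 t2. \<bar>t1\<bar> \<le> M \<and> \<bar>t2\<bar> \<le> M \<longrightarrow>
           \<bar>deriv (deriv (l x)) t2 - deriv (deriv (l x)) t1\<bar> \<le> C * \<bar>t2 - t1\<bar>))"

text \<open>\<open>y\<close> belongs to \<open>H10_space \<Omega>\<close>, is continuous on the closure of \<open>\<Omega>\<close>, and is a weak solution of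
  \<open>- (\<Sum>i j. \<partial>\<^sub>j (a i j \<partial>\<^sub>i y)) + f(x, y) = w\<close> in \<open>\<Omega>\<close>, \<open>y = 0\<close> on the boundary. There is at most one such
  \<open>y\<close> (as a function on the closure of \<open>\<Omega>\<close>), by ellipticity and monotonicity of \<open>f\<close>.\<close>

definition weak_solution ::
    "(real^'n::finite) set \<Rightarrow> ('n \<Rightarrow> 'n \<Rightarrow> real^'n \<Rightarrow> real) \<Rightarrow> (real^'n \<Rightarrow> real \<Rightarrow> real) \<Rightarrow>
     (real^'n \<Rightarrow> real) \<Rightarrow> (real^'n \<Rightarrow> real) \<Rightarrow> bool" where
  "weak_solution \<Omega> a f w y \<longleftrightarrow>
     y \<in> H10_space \<Omega> \<and> continuous_on (closure \<Omega>) y \<and> (\<forall>x\<in>frontier \<Omega>. y x = 0) \<and>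
     (\<forall>v\<in>H10_space \<Omega>.
        (LINT x|lebesgue_on \<Omega>.
           (\<Sum>i\<in>UNIV. \<Sum>j\<in>UNIV. a i j x * weak_partial \<Omega> i y x * weak_partial \<Omega> j v x))
        + (LINT x|lebesgue_on \<Omega>. f x (y x) * v x)
        = (LINT x|lebesgue_on \<Omega>. w x * v x))"


section \<open>Costs\<close>

text \<open>The control-to-state map \<open>w \<mapsto> y\<^sub>w\<close> is passed as the argument \<open>y\<close>.\<close>

definition total_control :: "('m::finite \<Rightarrow> real^'n \<Rightarrow> real) \<Rightarrow> ('m \<Rightarrow> real^'n \<Rightarrow> real) \<Rightarrow> real^'n \<Rightarrow> real" where
  "total_control B u x = (\<Sum>i\<in>UNIV. B i x * u i x)"

definition cost ::
    "(real^'n) set \<Rightarrow> ('m::finite \<Rightarrow> real^'n \<Rightarrow> real \<Rightarrow> real) \<Rightarrow> ('m \<Rightarrow> real^'n \<Rightarrow> real) \<Rightarrow>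
     ('m \<Rightarrow> real^'n \<Rightarrow> real) \<Rightarrow> ((real^'n \<Rightarrow> real) \<Rightarrow> (real^'n \<Rightarrow> real)) \<Rightarrow>
     'm \<Rightarrow> ('m \<Rightarrow> real^'n \<Rightarrow> real) \<Rightarrow> real" where
  "cost \<Omega> L \<zeta> B y k u =
     (LINT x|lebesgue_on \<Omega>. L k x (y (total_control B u) x))
     + 1/2 * (LINT x|lebesgue_on \<Omega>. \<zeta> k x * (u k x)\<^sup>2)"

text \<open>\<open>e\<^sub>Y\<close> perturbs the \<open>k\<close>-th control in the first term (so the state there belongs to
  \<open>u + B\<^sub>k e\<^sub>Y\<close>), but the right-hand side of the state equation in the second (the state \<open>y\<close> of
  \<open>u + e\<^sub>Y\<close>), where \<open>u = \<Sum>i. B\<^sub>i u\<^sub>i\<close>.\<close>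

definition perturbed_cost ::
    "(real^'n) set \<Rightarrow> ('m::finite \<Rightarrow> real^'n \<Rightarrow> real \<Rightarrow> real) \<Rightarrow> ('m \<Rightarrow> real^'n \<Rightarrow> real) \<Rightarrow>
     ('m \<Rightarrow> real^'n \<Rightarrow> real) \<Rightarrow> ((real^'n \<Rightarrow> real) \<Rightarrow> (real^'n \<Rightarrow> real)) \<Rightarrow>
     'm \<Rightarrow> ('m \<Rightarrow> real^'n \<Rightarrow> real) \<Rightarrow> (real^'n \<Rightarrow> real) \<Rightarrow> (real^'n \<Rightarrow> real) \<times> 'p \<Rightarrow> real" where
  "perturbed_cost \<Omega> L \<zeta> B y k u e\<^sub>Y e\<^sub>k =
     cost \<Omega> L \<zeta> B y k (u(k := (\<lambda>x. u k x + e\<^sub>Y x)))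
     + L2_inner \<Omega> (fst e\<^sub>k) (y (\<lambda>x. total_control B u x + e\<^sub>Y x))"


section \<open>Parameters and admissible sets\<close>

text \<open>A parameter is \<open>(e\<^sub>Y, \<lambda>k. (e\<^sub>k\<^sub>,\<^sub>J, e\<^sub>k\<^sub>,\<^sub>\<bullet>))\<close>. The spaces \<open>E\<^sub>k\<^sub>,\<^sub>\<bullet>\<close> are arbitrary metric spaces with
  carriers in a common type \<open>'p\<close>; all metrics are arbitrary, not necessarily induced by the
  norm of \<open>L\<^sup>2\<close>.\<close>

type_synonym ('n, 'm, 'p) param = "(real^'n \<Rightarrow> real) \<times> ('m \<Rightarrow> (real^'n \<Rightarrow> real) \<times> 'p)"

definition param_space ::
    "(real^'n \<Rightarrow> real) metric \<Rightarrow> ('m \<Rightarrow> (real^'n \<Rightarrow> real) metric) \<Rightarrow> ('m \<Rightarrow> 'p metric) \<Rightarrow>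
     ('n, 'm, 'p) param set" where
  "param_space EY EJ EB =
     {e. fst e \<in> mspace EY \<and> (\<forall>k. snd e k \<in> mspace (EJ k) \<times> mspace (EB k))}"

definition param_dist ::
    "(real^'n \<Rightarrow> real) metric \<Rightarrow> ('m::finite \<Rightarrow> (real^'n \<Rightarrow> real) metric) \<Rightarrow> ('m \<Rightarrow> 'p metric) \<Rightarrow>
     ('n, 'm, 'p) param \<Rightarrow> ('n, 'm, 'p) param \<Rightarrow> real" where
  "param_dist EY EJ EB e e' =
     mdist EY (fst e) (fst e') +
     (\<Sum>k\<in>UNIV. mdist (EJ k) (fst (snd e k)) (fst (snd e' k)) +
                mdist (EB k) (snd (snd e k)) (snd (snd e' k)))"

lemma Metric_space_param: "Metric_space (param_space EY EJ EB) (param_dist EY EJ EB)"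
proof
  fix e e' :: "('a, 'b, 'c) param"
  show "0 \<le> param_dist EY EJ EB e e'"
    unfolding param_dist_def by (intro add_nonneg_nonneg sum_nonneg mdist_nonneg)
  show "param_dist EY EJ EB e e' = param_dist EY EJ EB e' e"
    unfolding param_dist_def by (simp add: mdist_commute)
next
  fix e e' :: "('a, 'b, 'c) param"
  assume e: "e \<in> param_space EY EJ EB" and e': "e' \<in> param_space EY EJ EB"
  then have mem: "fst (snd e k) \<in> mspace (EJ k)" "snd (snd e k) \<in> mspace (EB k)"
    "fst (snd e' k) \<in> mspace (EJ k)" "snd (snd e' k) \<in> mspace (EB k)" for k
    by (auto simp: param_space_def mem_Times_iff)
  have "param_dist EY EJ EB e e' = 0 \<longleftrightarrow> mdist EY (fst e) (fst e') = 0 \<and>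
      (\<forall>k. mdist (EJ k) (fst (snd e k)) (fst (snd e' k)) = 0 \<and>
           mdist (EB k) (snd (snd e k)) (snd (snd e' k)) = 0)"
    unfolding param_dist_def
    by (simp add: add_nonneg_eq_0_iff sum_nonneg sum_nonneg_eq_0_iff)
  also have "\<dots> \<longleftrightarrow> e = e'"
    using e e' mem by (auto simp: param_space_def prod_eq_iff fun_eq_iff)
  finally show "param_dist EY EJ EB e e' = 0 \<longleftrightarrow> e = e'" .
next
  fix e e' e'' :: "('a, 'b, 'c) param"
  assume "e \<in> param_space EY EJ EB" "e' \<in> param_space EY EJ EB" "e'' \<in> param_space EY EJ EB"
  then have mem: "fst e \<in> mspace EY" "fst e' \<in> mspace EY" "fst e'' \<in> mspace EY"
    "fst (snd e k) \<in> mspace (EJ k)" "snd (snd e k) \<in> mspace (EB k)"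
    "fst (snd e' k) \<in> mspace (EJ k)" "snd (snd e' k) \<in> mspace (EB k)"
    "fst (snd e'' k) \<in> mspace (EJ k)" "snd (snd e'' k) \<in> mspace (EB k)" for k
    by (auto simp: param_space_def mem_Times_iff)
  let ?d = "\<lambda>e e' k. mdist (EJ k) (fst (snd e k)) (fst (snd e' k)) +
                mdist (EB k) (snd (snd e k)) (snd (snd e' k))"
  have "?d e e'' k \<le> ?d e e' k + ?d e' e'' k" for k
    using mdist_triangle[OF mem(4,6,8)[of k]] mdist_triangle[OF mem(5,7,9)[of k]] by linarith
  then have "(\<Sum>k\<in>UNIV. ?d e e'' k) \<le> (\<Sum>k\<in>UNIV. ?d e e' k + ?d e' e'' k)"
    by (intro sum_mono)
  also have "\<dots> = (\<Sum>k\<in>UNIV. ?d e e' k) + (\<Sum>k\<in>UNIV. ?d e' e'' k)"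
    by (rule sum.distrib)
  finally show "param_dist EY EJ EB e e'' \<le> param_dist EY EJ EB e e' + param_dist EY EJ EB e' e''"
    unfolding param_dist_def using mdist_triangle[OF mem(1-3)] by linarith
qed

definition param_metric ::
    "(real^'n \<Rightarrow> real) metric \<Rightarrow> ('m::finite \<Rightarrow> (real^'n \<Rightarrow> real) metric) \<Rightarrow> ('m \<Rightarrow> 'p metric) \<Rightarrow>
     ('n, 'm, 'p) param metric" where
  "param_metric EY EJ EB = metric (param_space EY EJ EB, param_dist EY EJ EB)"

lemma mspace_param_metric [simp]: "mspace (param_metric EY EJ EB) = param_space EY EJ EB"
  and mdist_param_metric [simp]: "mdist (param_metric EY EJ EB) = param_dist EY EJ EB"
  unfolding param_metric_def
  by (simp_all add: Metric_space.mspace_metric Metric_space.mdist_metric Metric_space_param)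

definition L2_convex :: "(real^'n \<Rightarrow> real) set \<Rightarrow> bool" where
  "L2_convex S \<longleftrightarrow>
     (\<forall>u\<in>S. \<forall>v\<in>S. \<forall>t. 0 \<le> t \<and> t \<le> 1 \<longrightarrow> (\<lambda>x. (1 - t) * u x + t * v x) \<in> S)"

definition L2_closed :: "(real^'n) set \<Rightarrow> (real^'n \<Rightarrow> real) set \<Rightarrow> bool" where
  "L2_closed \<Omega> S \<longleftrightarrow>
     (\<forall>u v. (\<forall>n::nat. u n \<in> S) \<and> v \<in> L2_space \<Omega> \<and> (\<lambda>n. L2_norm \<Omega> (\<lambda>x. u n x - v x)) \<longlonglongrightarrow> 0
        \<longrightarrow> v \<in> S)"

definition L2_bounded :: "(real^'n) set \<Rightarrow> (real^'n \<Rightarrow> real) set \<Rightarrow> bool" where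
  "L2_bounded \<Omega> S \<longleftrightarrow> (\<exists>R. \<forall>u\<in>S. L2_norm \<Omega> u \<le> R)"

definition admissible_set ::
    "('m \<Rightarrow> (real^'n \<Rightarrow> real) \<times> 'p \<Rightarrow> (real^'n \<Rightarrow> real) set) \<Rightarrow> ('n, 'm, 'p) param \<Rightarrow>
     ('m \<Rightarrow> real^'n \<Rightarrow> real) set" where
  "admissible_set U e = {u. \<forall>k. u k \<in> U k (snd e k)}"


section \<open>Calculus and quadratic forms on the product space\<close>

definition L2m_space :: "(real^'n) set \<Rightarrow> ('m \<Rightarrow> real^'n \<Rightarrow> real) set" where
  "L2m_space \<Omega> = {u. \<forall>k. u k \<in> L2_space \<Omega>}"

definition L2m_inner ::
    "(real^'n) set \<Rightarrow> ('m::finite \<Rightarrow> real^'n \<Rightarrow> real) \<Rightarrow> ('m \<Rightarrow> real^'n \<Rightarrow> real) \<Rightarrow> real" where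
  "L2m_inner \<Omega> u v = (\<Sum>k\<in>UNIV. L2_inner \<Omega> (u k) (v k))"

definition L2m_norm :: "(real^'n) set \<Rightarrow> ('m::finite \<Rightarrow> real^'n \<Rightarrow> real) \<Rightarrow> real" where
  "L2m_norm \<Omega> u = sqrt (L2m_inner \<Omega> u u)"

text \<open>\<open>g\<close> is the Riesz representative of the partial Frechet derivative of \<open>\<Phi>\<close> at \<open>u\<close> with respect to
  the \<open>k\<close>-th component.\<close>

definition has_partial_gradient ::
    "(real^'n) set \<Rightarrow> 'm \<Rightarrow> (('m \<Rightarrow> real^'n \<Rightarrow> real) \<Rightarrow> real) \<Rightarrow> ('m \<Rightarrow> real^'n \<Rightarrow> real) \<Rightarrow>
     (real^'n \<Rightarrow> real) \<Rightarrow> bool" where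
  "has_partial_gradient \<Omega> k \<Phi> u g \<longleftrightarrow>
     g \<in> L2_space \<Omega> \<and>
     (\<forall>\<epsilon>>0. \<exists>\<delta>>0. \<forall>v\<in>L2_space \<Omega>. L2_norm \<Omega> v \<le> \<delta> \<longrightarrow>
        \<bar>\<Phi> (u(k := (\<lambda>x. u k x + v x))) - \<Phi> u - L2_inner \<Omega> g v\<bar> \<le> \<epsilon> * L2_norm \<Omega> v)"

text \<open>\<open>D\<close> is the Frechet derivative of \<open>G\<close> at \<open>u\<close>: a bounded linear operator (linearity being understood
  almost everywhere on \<open>\<Omega>\<close>) with remainder of order \<open>o(\<parallel>h\<parallel>)\<close>.\<close>

definition has_L2m_derivative ::
    "(real^'n) set \<Rightarrow> (('m::finite \<Rightarrow> real^'n \<Rightarrow> real) \<Rightarrow> ('m \<Rightarrow> real^'n \<Rightarrow> real)) \<Rightarrow>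
     (('m \<Rightarrow> real^'n \<Rightarrow> real) \<Rightarrow> ('m \<Rightarrow> real^'n \<Rightarrow> real)) \<Rightarrow> ('m \<Rightarrow> real^'n \<Rightarrow> real) \<Rightarrow> bool" where
  "has_L2m_derivative \<Omega> G D u \<longleftrightarrow>
     (\<forall>h\<in>L2m_space \<Omega>. D h \<in> L2m_space \<Omega>) \<and>
     (\<forall>h\<in>L2m_space \<Omega>. \<forall>h'\<in>L2m_space \<Omega>. \<forall>s t k. AE x in lebesgue_on \<Omega>.
        D (\<lambda>j z. s * h j z + t * h' j z) k x = s * D h k x + t * D h' k x) \<and>
     (\<exists>C. \<forall>h\<in>L2m_space \<Omega>. L2m_norm \<Omega> (D h) \<le> C * L2m_norm \<Omega> h) \<and>
     (\<forall>\<epsilon>>0. \<exists>\<delta>>0. \<forall>h\<in>L2m_space \<Omega>. L2m_norm \<Omega> h \<le> \<delta> \<longrightarrow>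
        L2m_norm \<Omega> (\<lambda>k x. G (\<lambda>j z. u j z + h j z) k x - G u k x - D h k x) \<le> \<epsilon> * L2m_norm \<Omega> h)"

definition weakly_converges ::
    "(real^'n) set \<Rightarrow> (nat \<Rightarrow> 'm::finite \<Rightarrow> real^'n \<Rightarrow> real) \<Rightarrow> ('m \<Rightarrow> real^'n \<Rightarrow> real) \<Rightarrow> bool" where
  "weakly_converges \<Omega> h h0 \<longleftrightarrow>
     (\<forall>n. h n \<in> L2m_space \<Omega>) \<and> h0 \<in> L2m_space \<Omega> \<and>
     (\<forall>g\<in>L2m_space \<Omega>. (\<lambda>n. L2m_inner \<Omega> (h n) g) \<longlonglongrightarrow> L2m_inner \<Omega> h0 g)"

definition strongly_converges ::
    "(real^'n) set \<Rightarrow> (nat \<Rightarrow> 'm::finite \<Rightarrow> real^'n \<Rightarrow> real) \<Rightarrow> ('m \<Rightarrow> real^'n \<Rightarrow> real) \<Rightarrow> bool" where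
  "strongly_converges \<Omega> h h0 \<longleftrightarrow>
     (\<forall>n. h n \<in> L2m_space \<Omega>) \<and> h0 \<in> L2m_space \<Omega> \<and>
     (\<lambda>n. L2m_norm \<Omega> (\<lambda>k x. h n k x - h0 k x)) \<longlonglongrightarrow> 0"

definition quadratic_form :: "(real^'n) set \<Rightarrow> (('m \<Rightarrow> real^'n \<Rightarrow> real) \<Rightarrow> real) \<Rightarrow> bool" where
  "quadratic_form \<Omega> Q \<longleftrightarrow>
     (\<exists>b. (\<forall>h\<in>L2m_space \<Omega>. \<forall>h'\<in>L2m_space \<Omega>. \<forall>g\<in>L2m_space \<Omega>. \<forall>s t.
             b (\<lambda>k x. s * h k x + t * h' k x) g = s * b h g + t * b h' g \<and>
             b g (\<lambda>k x. s * h k x + t * h' k x) = s * b g h + t * b g h') \<and>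
          (\<forall>h\<in>L2m_space \<Omega>. Q h = b h h))"

definition legendre_form :: "(real^'n) set \<Rightarrow> (('m::finite \<Rightarrow> real^'n \<Rightarrow> real) \<Rightarrow> real) \<Rightarrow> bool" where
  "legendre_form \<Omega> Q \<longleftrightarrow>
     quadratic_form \<Omega> Q \<and>
     (\<forall>h h0. weakly_converges \<Omega> h h0 \<longrightarrow> ereal (Q h0) \<le> liminf (\<lambda>n. ereal (Q (h n)))) \<and>
     (\<forall>h h0. weakly_converges \<Omega> h h0 \<and> (\<lambda>n. Q (h n)) \<longlonglongrightarrow> Q h0 \<longrightarrow> strongly_converges \<Omega> h h0)"

end

theory Submission
  imports Defs
begin

text \<open>The cost of player \<open>k\<close> is the sum of a state cost and of the control cost
  \<open>1/2 \<integral> \<zeta>\<^sub>k (u\<^sub>k + e\<^sub>Y)\<^sup>2\<close>. The second term contributes \<open>\<integral> \<zeta>\<^sub>k h\<^sub>k\<^sup>2\<close> to the quadratic form, and this is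
  a Legendre form because \<open>\<zeta>\<^sub>k\<close> is bounded away from zero. The rest of the quadratic form is weakly
  sequentially continuous: the state cost is weakly continuous near \<open>ubar\<close>, and its second order
  expansion at \<open>ubar\<close>, which holds uniformly on bounded sets, carries this over to the quadratic term.

  For the weak continuity of the state cost, let \<open>w\<^sub>n\<close> converge weakly to \<open>w\<close> and let \<open>z\<^sub>n\<close> be the
  difference of the states. Ellipticity and monotonicity give
  \<open>c \<parallel>\<nabla>z\<^sub>n\<parallel>\<^sup>2 \<le> \<langle>w\<^sub>n - w, z\<^sub>n\<rangle>\<close>, and the right-hand side is \<open>o(\<parallel>\<nabla>z\<^sub>n\<parallel>)\<close> since \<open>\<parallel>\<phi>(\<cdot> + h) - \<phi>\<parallel> \<le> \<bar>h\<bar> \<parallel>\<nabla>\<phi>\<parallel>\<close>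
  allows \<open>w\<^sub>n - w\<close> to be replaced by its averages over small balls, which tend to zero strongly. The
  uniform bound on the states that the growth conditions require follows from the comparison
  principle and the fact that every single state is bounded.\<close>

section \<open>The space of square integrable functions\<close>

text \<open>No linearised or adjoint state equation appears. The only second order information is
  the Frechet derivative \<open>F'\<close> at \<open>ubar\<close>, so the quadratic term of the
  state cost has to be read off from values of that cost. Component k of \<open>F' h\<close> is
  paired with \<open>h k\<close>, while the state reacts to all components of h. This is a mixed
  second derivative, in the direction h and in the direction of its k-th component, which is why
  perturbations carry two parameters t and s.

  The growth conditions on \<open>L\<close> are local in the state, and the uniform bound on states
  is obtained only on a small ball of controls. A weakly convergent sequence is merely bounded, so
  it is first scaled by small t and s; homogeneity of the quadratic term undoes the scaling.

  The compactness is quantitative: averaging over balls estimates the weakly null controls against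
  all test functions at once, and no subsequence of states is extracted. Elements of the spaces are
  functions known up to null sets, and \<open>weak_partial\<close> is an arbitrary choice, so
  representatives are carried along explicitly.\<close>

lemma L2_measurable: "u \<in> L2_space \<Omega> \<Longrightarrow> u \<in> borel_measurable (lebesgue_on \<Omega>)"
  and L2_integrable_sq: "u \<in> L2_space \<Omega> \<Longrightarrow> integrable (lebesgue_on \<Omega>) (\<lambda>x. (u x)\<^sup>2)"
  by (auto simp: L2_space_def)

lemma L2_integrable_mult:
  assumes "u \<in> L2_space \<Omega>" "v \<in> L2_space \<Omega>"
  shows "integrable (lebesgue_on \<Omega>) (\<lambda>x. u x * v x)"
proof (rule Bochner_Integration.integrable_bound)
  show "integrable (lebesgue_on \<Omega>) (\<lambda>x. (u x)\<^sup>2 + (v x)\<^sup>2)"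
    using assms by (intro Bochner_Integration.integrable_add L2_integrable_sq)
  show "(\<lambda>x. u x * v x) \<in> borel_measurable (lebesgue_on \<Omega>)"
    using assms by (intro borel_measurable_times L2_measurable)
  have "\<bar>s * t\<bar> \<le> s\<^sup>2 + t\<^sup>2" for s t :: real
    using sum_squares_bound[of s t] sum_squares_bound[of s "-t"] zero_le_power2[of s] zero_le_power2[of t]
    by (simp add: abs_le_iff)
  then show "AE x in lebesgue_on \<Omega>. norm (u x * v x) \<le> norm ((u x)\<^sup>2 + (v x)\<^sup>2)"
    by (intro AE_I2) simp
qed

lemma L2_bound:
  assumes "v \<in> L2_space \<Omega>" and "u \<in> borel_measurable (lebesgue_on \<Omega>)"
    and "AE x in lebesgue_on \<Omega>. \<bar>u x\<bar> \<le> C * \<bar>v x\<bar>"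
  shows "u \<in> L2_space \<Omega>"
  unfolding L2_space_def
proof (intro CollectI conjI assms)
  show "integrable (lebesgue_on \<Omega>) (\<lambda>x. (u x)\<^sup>2)"
  proof (rule Bochner_Integration.integrable_bound)
    show "integrable (lebesgue_on \<Omega>) (\<lambda>x. C\<^sup>2 * (v x)\<^sup>2)"
      using L2_integrable_sq[OF assms(1)] by simp
    show "(\<lambda>x. (u x)\<^sup>2) \<in> borel_measurable (lebesgue_on \<Omega>)"
      using assms(2) by measurable
    show "AE x in lebesgue_on \<Omega>. norm ((u x)\<^sup>2) \<le> norm (C\<^sup>2 * (v x)\<^sup>2)"
      using assms(3)
    proof eventually_elim
      case (elim x)
      then have "\<bar>u x\<bar>\<^sup>2 \<le> (C * \<bar>v x\<bar>)\<^sup>2" by (intro power_mono) auto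
      then show ?case by (simp add: power_mult_distrib)
    qed
  qed
qed

lemma L2_cmult: "u \<in> L2_space \<Omega> \<Longrightarrow> (\<lambda>x. c * u x) \<in> L2_space \<Omega>"
  by (auto simp: L2_space_def power_mult_distrib)

lemma L2_uminus: "u \<in> L2_space \<Omega> \<Longrightarrow> (\<lambda>x. - u x) \<in> L2_space \<Omega>"
  using L2_cmult[of u \<Omega> "-1"] by simp

lemma L2_abs: "u \<in> L2_space \<Omega> \<Longrightarrow> (\<lambda>x. \<bar>u x\<bar>) \<in> L2_space \<Omega>"
  by (auto simp: L2_space_def)

lemma L2_zero: "(\<lambda>x. 0) \<in> L2_space \<Omega>"
  by (auto simp: L2_space_def)

lemma L2_add:
  assumes "u \<in> L2_space \<Omega>" "v \<in> L2_space \<Omega>"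
  shows "(\<lambda>x. u x + v x) \<in> L2_space \<Omega>"
proof -
  have "integrable (lebesgue_on \<Omega>) (\<lambda>x. (u x)\<^sup>2 + (v x)\<^sup>2 + 2 * (u x * v x))"
    by (intro Bochner_Integration.integrable_add L2_integrable_sq assms integrable_mult_right
        L2_integrable_mult)
  moreover have "(\<lambda>x. (u x + v x)\<^sup>2) = (\<lambda>x. (u x)\<^sup>2 + (v x)\<^sup>2 + 2 * (u x * v x))"
    by (simp add: power2_sum algebra_simps)
  moreover have "(\<lambda>x. u x + v x) \<in> borel_measurable (lebesgue_on \<Omega>)"
    using assms by (intro borel_measurable_add L2_measurable)
  ultimately show ?thesis by (simp add: L2_space_def)
qed

lemma L2_diff:
  "u \<in> L2_space \<Omega> \<Longrightarrow> v \<in> L2_space \<Omega> \<Longrightarrow> (\<lambda>x. u x - v x) \<in> L2_space \<Omega>"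
  using L2_add[OF _ L2_uminus] by simp

lemma L2_sum:
  "finite I \<Longrightarrow> (\<And>i. i \<in> I \<Longrightarrow> u i \<in> L2_space \<Omega>) \<Longrightarrow> (\<lambda>x. \<Sum>i\<in>I. u i x) \<in> L2_space \<Omega>"
  by (induction I rule: finite_induct) (auto intro: L2_zero L2_add)

lemmas L2_intros = L2_cmult L2_uminus L2_abs L2_zero L2_add L2_diff

lemma L2_mult_Linf:
  assumes "u \<in> L2_space \<Omega>" "b \<in> Linf_space \<Omega>"
  shows "(\<lambda>x. b x * u x) \<in> L2_space \<Omega>"
proof -
  from assms(2) obtain C where b: "b \<in> borel_measurable (lebesgue_on \<Omega>)"
    "AE x in lebesgue_on \<Omega>. \<bar>b x\<bar> \<le> C" by (auto simp: Linf_space_def)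
  show ?thesis
  proof (rule L2_bound[OF assms(1), where C = C])
    show "(\<lambda>x. b x * u x) \<in> borel_measurable (lebesgue_on \<Omega>)"
      using b(1) L2_measurable[OF assms(1)] by measurable
    show "AE x in lebesgue_on \<Omega>. \<bar>b x * u x\<bar> \<le> C * \<bar>u x\<bar>"
      using b(2) by eventually_elim (simp add: abs_mult mult_right_mono)
  qed
qed

section \<open>Inner product, norm and the Cauchy-Schwarz inequality\<close>

lemma L2_inner_commute: "L2_inner \<Omega> u v = L2_inner \<Omega> v u"
  by (simp add: L2_inner_def mult.commute)

lemma L2_inner_add_left:
  "u \<in> L2_space \<Omega> \<Longrightarrow> v \<in> L2_space \<Omega> \<Longrightarrow> w \<in> L2_space \<Omega> \<Longrightarrow>
    L2_inner \<Omega> (\<lambda>x. u x + v x) w = L2_inner \<Omega> u w + L2_inner \<Omega> v w"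
  unfolding L2_inner_def distrib_right
  by (intro Bochner_Integration.integral_add L2_integrable_mult)

lemma L2_inner_cmult_left: "L2_inner \<Omega> (\<lambda>x. c * u x) w = c * L2_inner \<Omega> u w"
  unfolding L2_inner_def by (simp add: mult.assoc)

lemma L2_inner_diff_left:
  "u \<in> L2_space \<Omega> \<Longrightarrow> v \<in> L2_space \<Omega> \<Longrightarrow> w \<in> L2_space \<Omega> \<Longrightarrow>
    L2_inner \<Omega> (\<lambda>x. u x - v x) w = L2_inner \<Omega> u w - L2_inner \<Omega> v w"
  unfolding L2_inner_def left_diff_distrib
  by (intro Bochner_Integration.integral_diff L2_integrable_mult)

lemma L2_inner_sum_left:
  "finite I \<Longrightarrow> (\<And>i. i \<in> I \<Longrightarrow> u i \<in> L2_space \<Omega>) \<Longrightarrow> w \<in> L2_space \<Omega> \<Longrightarrow>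
    L2_inner \<Omega> (\<lambda>x. \<Sum>i\<in>I. u i x) w = (\<Sum>i\<in>I. L2_inner \<Omega> (u i) w)"
proof (induction I rule: finite_induct)
  case empty
  then show ?case by (simp add: L2_inner_def)
next
  case (insert i I)
  then show ?case by (simp add: L2_inner_add_left L2_sum)
qed

lemma L2_inner_cong_AE:
  assumes "u \<in> borel_measurable (lebesgue_on \<Omega>)" "u' \<in> borel_measurable (lebesgue_on \<Omega>)"
    "v \<in> borel_measurable (lebesgue_on \<Omega>)" "AE x in lebesgue_on \<Omega>. u x = u' x"
  shows "L2_inner \<Omega> u v = L2_inner \<Omega> u' v"
  unfolding L2_inner_def
proof (rule integral_cong_AE)
  show "AE x in lebesgue_on \<Omega>. u x * v x = u' x * v x"
    using assms(4) by eventually_elim simp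
qed (use assms in measurable)

lemma L2_inner_self: "L2_inner \<Omega> u u = (LINT x|lebesgue_on \<Omega>. (u x)\<^sup>2)"
  by (simp add: L2_inner_def power2_eq_square)

lemma L2_inner_self_nonneg: "0 \<le> L2_inner \<Omega> u u"
  unfolding L2_inner_self by simp

lemma L2_norm_nonneg [simp]: "0 \<le> L2_norm \<Omega> u"
  by (simp add: L2_norm_def L2_inner_self_nonneg)

lemma L2_norm_sq: "(L2_norm \<Omega> u)\<^sup>2 = L2_inner \<Omega> u u"
  by (simp add: L2_norm_def L2_inner_self_nonneg)

lemma L2_norm_abs: "L2_norm \<Omega> (\<lambda>x. \<bar>u x\<bar>) = L2_norm \<Omega> u"
  by (simp add: L2_norm_def L2_inner_def)

lemma L2_norm_cmult: "L2_norm \<Omega> (\<lambda>x. c * u x) = \<bar>c\<bar> * L2_norm \<Omega> u"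
proof -
  have "L2_inner \<Omega> (\<lambda>x. c * u x) (\<lambda>x. c * u x) = c\<^sup>2 * L2_inner \<Omega> u u"
    by (simp add: L2_inner_def power2_eq_square mult.assoc mult.left_commute)
  then show ?thesis
    by (simp add: L2_norm_def real_sqrt_mult)
qed

lemma L2_norm_uminus: "L2_norm \<Omega> (\<lambda>x. - u x) = L2_norm \<Omega> u"
  using L2_norm_cmult[of \<Omega> "-1" u] by simp

lemma L2_norm_minus_commute: "L2_norm \<Omega> (\<lambda>x. u x - v x) = L2_norm \<Omega> (\<lambda>x. v x - u x)"
  using L2_norm_uminus[of \<Omega> "\<lambda>x. u x - v x"] by simp

lemma L2_norm_mono:
  assumes "u \<in> L2_space \<Omega>" "v \<in> L2_space \<Omega>"
    and "AE x in lebesgue_on \<Omega>. \<bar>u x\<bar> \<le> \<bar>v x\<bar>"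
  shows "L2_norm \<Omega> u \<le> L2_norm \<Omega> v"
  unfolding L2_norm_def L2_inner_self
proof (intro real_sqrt_le_mono integral_mono_AE L2_integrable_sq assms)
  show "AE x in lebesgue_on \<Omega>. (u x)\<^sup>2 \<le> (v x)\<^sup>2"
    using assms(3) by eventually_elim (simp add: abs_le_square_iff)
qed

text \<open>The discriminant argument, done by hand: the elements are plain functions identified
  only almost everywhere, so the semidefinite form \<open>L2_inner\<close> is not the inner product
  of a type class.\<close>

lemma L2_Cauchy_Schwarz:
  assumes "u \<in> L2_space \<Omega>" "v \<in> L2_space \<Omega>"
  shows "\<bar>L2_inner \<Omega> u v\<bar> \<le> L2_norm \<Omega> u * L2_norm \<Omega> v"
proof -
  define A B C where "A = L2_inner \<Omega> u u" and "B = L2_inner \<Omega> u v" and "C = L2_inner \<Omega> v v"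
  have quad: "0 \<le> s\<^sup>2 * A + 2 * s * t * B + t\<^sup>2 * C" for s t
  proof -
    have "0 \<le> (LINT x|lebesgue_on \<Omega>. (s * u x + t * v x)\<^sup>2)" by simp
    also have "\<dots> = (LINT x|lebesgue_on \<Omega>. s\<^sup>2 * (u x * u x) + 2 * s * t * (u x * v x) + t\<^sup>2 * (v x * v x))"
      by (simp add: power2_eq_square algebra_simps)
    also have "\<dots> = s\<^sup>2 * A + 2 * s * t * B + t\<^sup>2 * C"
      unfolding A_def B_def C_def L2_inner_def using assms
      by (simp add: L2_integrable_mult)
    finally show ?thesis .
  qed
  have "B\<^sup>2 \<le> A * C"
  proof (cases "C = 0")
    case True
    have "B = 0"
    proof (rule ccontr)
      assume "B \<noteq> 0"
      \<comment> \<open>For C = 0 the form is affine in t; the value t = -(A + 1) / B brings it down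
        to -A - 2.\<close>
      then have "1\<^sup>2 * A + 2 * 1 * (- (A + 1) / B) * B + (- (A + 1) / B)\<^sup>2 * C = A - 2 * (A + 1)"
        using True by simp
      moreover have "0 \<le> A" unfolding A_def by (rule L2_inner_self_nonneg)
      moreover have "0 \<le> 1\<^sup>2 * A + 2 * 1 * (- (A + 1) / B) * B + (- (A + 1) / B)\<^sup>2 * C" by (rule quad)
      ultimately show False by simp
    qed
    then show ?thesis using True by simp
  next
    case False
    then have "C > 0" unfolding C_def using L2_inner_self_nonneg[of \<Omega> v] by linarith
    \<comment> \<open>The minimising ratio t / s = -B / C, cleared of denominators.\<close>
    have "C * (A * C - B\<^sup>2) \<ge> 0"
      using quad[of C "- B"] by (simp add: power2_eq_square algebra_simps)
    then show ?thesis using \<open>C > 0\<close> by (simp add: zero_le_mult_iff)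
  qed
  then have "sqrt (B\<^sup>2) \<le> sqrt (A * C)" by (rule real_sqrt_le_mono)
  then show ?thesis by (simp add: L2_norm_def real_sqrt_mult A_def B_def C_def)
qed

lemma L2_norm_triangle:
  assumes "u \<in> L2_space \<Omega>" "v \<in> L2_space \<Omega>"
  shows "L2_norm \<Omega> (\<lambda>x. u x + v x) \<le> L2_norm \<Omega> u + L2_norm \<Omega> v"
proof (rule power2_le_imp_le)
  have "(L2_norm \<Omega> (\<lambda>x. u x + v x))\<^sup>2
      = (L2_norm \<Omega> u)\<^sup>2 + (L2_norm \<Omega> v)\<^sup>2 + 2 * L2_inner \<Omega> u v"
    unfolding L2_norm_sq L2_inner_def using assms
    by (simp add: L2_integrable_mult distrib_left distrib_right L2_inner_def mult.commute[of "v _" "u _"])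
  also have "\<dots> \<le> (L2_norm \<Omega> u + L2_norm \<Omega> v)\<^sup>2"
    using L2_Cauchy_Schwarz[OF assms] by (simp add: power2_sum)
  finally show "(L2_norm \<Omega> (\<lambda>x. u x + v x))\<^sup>2 \<le> (L2_norm \<Omega> u + L2_norm \<Omega> v)\<^sup>2" .
qed simp

lemma L2_norm_triangle_diff:
  "u \<in> L2_space \<Omega> \<Longrightarrow> v \<in> L2_space \<Omega> \<Longrightarrow>
    L2_norm \<Omega> (\<lambda>x. u x - v x) \<le> L2_norm \<Omega> u + L2_norm \<Omega> v"
  using L2_norm_triangle[OF _ L2_uminus, of u \<Omega> v] by (simp add: L2_norm_uminus)

section \<open>Convergence in norm and convergence almost everywhere\<close>

lemma L2_norm_zero_imp_AE:
  assumes "u \<in> L2_space \<Omega>" "L2_norm \<Omega> u = 0"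
  shows "AE x in lebesgue_on \<Omega>. u x = 0"
proof -
  have "(LINT x|lebesgue_on \<Omega>. (u x)\<^sup>2) = 0"
    using assms(2) by (simp add: L2_norm_def L2_inner_self)
  then have "AE x in lebesgue_on \<Omega>. (u x)\<^sup>2 = 0"
    using integral_nonneg_eq_0_iff_AE[OF L2_integrable_sq[OF assms(1)]] by simp
  then show ?thesis by simp
qed

text \<open>Convergence in norm is L1 convergence of the squares. The chain rule for
  \<open>softplus\<close> relies on the subsequence, because there a nonlinear factor is evaluated
  along the approximating functions.\<close>

lemma L2_norm_tendsto_AE_subseq:
  assumes "\<And>n. u n \<in> L2_space \<Omega>" "(\<lambda>n. L2_norm \<Omega> (u n)) \<longlonglongrightarrow> 0"
  shows "\<exists>r :: nat \<Rightarrow> nat. strict_mono r \<and> (AE x in lebesgue_on \<Omega>. (\<lambda>n. u (r n) x) \<longlonglongrightarrow> 0)"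
proof -
  have "(\<lambda>n. (L2_norm \<Omega> (u n))\<^sup>2) \<longlonglongrightarrow> 0\<^sup>2" by (intro tendsto_power assms(2))
  then have "(\<lambda>n. LINT x|lebesgue_on \<Omega>. norm ((u n x)\<^sup>2)) \<longlonglongrightarrow> 0"
    by (simp add: L2_norm_sq L2_inner_self)
  with tendsto_L1_AE_subseq[of "lebesgue_on \<Omega>" "\<lambda>n x. (u n x)\<^sup>2"] L2_integrable_sq[OF assms(1)]
  obtain r where r: "strict_mono r" "AE x in lebesgue_on \<Omega>. (\<lambda>n. (u (r n) x)\<^sup>2) \<longlonglongrightarrow> 0" by auto
  have "AE x in lebesgue_on \<Omega>. (\<lambda>n. u (r n) x) \<longlonglongrightarrow> 0"
    using r(2)
  proof eventually_elim
    case (elim x)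
    then have "(\<lambda>n. sqrt ((u (r n) x)\<^sup>2)) \<longlonglongrightarrow> sqrt 0" by (intro tendsto_real_sqrt)
    then show ?case by (simp add: tendsto_rabs_zero_iff)
  qed
  with r(1) show ?thesis by blast
qed

lemma L2_inner_tendsto_AE:
  assumes "\<And>n. u n \<in> L2_space \<Omega>" "v \<in> L2_space \<Omega>" "w \<in> L2_space \<Omega>"
    and "AE x in lebesgue_on \<Omega>. (\<lambda>n. u n x) \<longlonglongrightarrow> u0 x" "u0 \<in> borel_measurable (lebesgue_on \<Omega>)"
    and "\<And>n. AE x in lebesgue_on \<Omega>. \<bar>u n x\<bar> \<le> \<bar>v x\<bar>"
  shows "(\<lambda>n. L2_inner \<Omega> w (u n)) \<longlonglongrightarrow> L2_inner \<Omega> w u0"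
  unfolding L2_inner_def
proof (rule integral_dominated_convergence[where w = "\<lambda>x. \<bar>w x\<bar> * \<bar>v x\<bar>"])
  show "integrable (lebesgue_on \<Omega>) (\<lambda>x. \<bar>w x\<bar> * \<bar>v x\<bar>)"
    using assms by (intro L2_integrable_mult L2_abs)
  show "AE x in lebesgue_on \<Omega>. (\<lambda>n. w x * u n x) \<longlonglongrightarrow> w x * u0 x"
    using assms(4) by eventually_elim (intro tendsto_intros)
  show "AE x in lebesgue_on \<Omega>. norm (w x * u n x) \<le> \<bar>w x\<bar> * \<bar>v x\<bar>" for n
    using assms(6)[of n] by eventually_elim (simp add: abs_mult mult_left_mono)
qed (intro borel_measurable_times L2_measurable assms)+

lemma L2_norm_tendsto_AE:
  assumes "\<And>n. u n \<in> borel_measurable (lebesgue_on \<Omega>)" "v \<in> L2_space \<Omega>"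
    and "AE x in lebesgue_on \<Omega>. (\<lambda>n. u n x) \<longlonglongrightarrow> 0"
    and "\<And>n. AE x in lebesgue_on \<Omega>. \<bar>u n x\<bar> \<le> \<bar>v x\<bar>"
  shows "(\<lambda>n. L2_norm \<Omega> (u n)) \<longlonglongrightarrow> 0"
proof -
  have "(\<lambda>n. LINT x|lebesgue_on \<Omega>. (u n x)\<^sup>2) \<longlonglongrightarrow> (LINT x|lebesgue_on \<Omega>. 0)"
  proof (rule integral_dominated_convergence[where w = "\<lambda>x. (v x)\<^sup>2"])
    show "integrable (lebesgue_on \<Omega>) (\<lambda>x. (v x)\<^sup>2)"
      using assms(2) by (rule L2_integrable_sq)
    show "AE x in lebesgue_on \<Omega>. (\<lambda>n. (u n x)\<^sup>2) \<longlonglongrightarrow> 0"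
      using assms(3) by eventually_elim (use tendsto_power in fastforce)
    show "AE x in lebesgue_on \<Omega>. norm ((u n x)\<^sup>2) \<le> (v x)\<^sup>2" for n
      using assms(4)[of n] by eventually_elim (simp add: abs_le_square_iff)
  qed (use assms in measurable)
  then have "(\<lambda>n. sqrt (LINT x|lebesgue_on \<Omega>. (u n x)\<^sup>2)) \<longlonglongrightarrow> sqrt 0"
    by (intro tendsto_real_sqrt) simp
  then show ?thesis by (simp add: L2_norm_def L2_inner_self)
qed

section \<open>Absolutely convergent series and uniform boundedness\<close>

lemma abs_sum_geometric_weights:
  fixes g :: "nat \<Rightarrow> real"
  shows "(\<Sum>j<n. \<bar>g j\<bar>)\<^sup>2 \<le> 2 * (\<Sum>j<n. 2 ^ j * (g j)\<^sup>2)"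
proof -
  \<comment> \<open>Each summand is split into the square roots of \<open>(1/2) ^ j\<close> and of
    \<open>2 ^ j * (g j)\<^sup>2\<close>; the squares of the first factors add up to at most
    2.\<close>
  have "(\<Sum>j<n. \<bar>g j\<bar>) = (\<Sum>j<n. sqrt ((1/2) ^ j) * (sqrt (2 ^ j) * \<bar>g j\<bar>))"
    by (rule sum.cong) (simp_all add: real_sqrt_mult[symmetric] power_mult_distrib[symmetric] mult.assoc[symmetric])
  then have "(\<Sum>j<n. \<bar>g j\<bar>)\<^sup>2 \<le> (\<Sum>j<n. (sqrt ((1/2) ^ j))\<^sup>2) * (\<Sum>j<n. (sqrt (2 ^ j) * \<bar>g j\<bar>)\<^sup>2)"
    using Cauchy_Schwarz_ineq_sum by metis
  also have "\<dots> = (\<Sum>j<n. (1/2) ^ j) * (\<Sum>j<n. 2 ^ j * (g j)\<^sup>2)"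
    by (simp add: power_mult_distrib)
  also have "\<dots> \<le> 2 * (\<Sum>j<n. 2 ^ j * (g j)\<^sup>2)"
  proof (rule mult_right_mono)
    have "(\<Sum>j<n. (1/2) ^ j) \<le> (\<Sum>j. (1/2::real) ^ j)"
      by (rule sum_le_suminf) (auto simp: summable_geometric)
    then show "(\<Sum>j<n. (1/2::real) ^ j) \<le> 2" by (simp add: suminf_geometric)
  qed (simp add: sum_nonneg)
  finally show ?thesis .
qed

text \<open>By the weighted Cauchy-Schwarz inequality above it is enough to sum the integrable functions
  \<open>2\<^sup>j (g j)\<^sup>2\<close>.\<close>

lemma L2_series:
  fixes g :: "nat \<Rightarrow> real^'n \<Rightarrow> real"
  assumes g: "\<And>j. g j \<in> L2_space \<Omega>" and bound: "\<And>j. L2_norm \<Omega> (g j) \<le> (1/3) ^ j"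
  shows "AE x in lebesgue_on \<Omega>. summable (\<lambda>j. \<bar>g j x\<bar>)"
    and "(\<lambda>x. \<Sum>j. \<bar>g j x\<bar>) \<in> L2_space \<Omega>"
proof -
  let ?M = "lebesgue_on \<Omega>"
  have [measurable]: "g j \<in> borel_measurable ?M" for j using g by (rule L2_measurable)
  define h where "h j x = 2 ^ j * (g j x)\<^sup>2" for j x
  have int_h: "integrable ?M (h j)" for j
    unfolding h_def using L2_integrable_sq[OF g] by simp
  \<comment> \<open>Squaring the bound \<open>(1/3) ^ j\<close> gives \<open>(1/9) ^ j\<close>,
    which outweighs the weight \<open>2 ^ j\<close>.\<close>
  have "(LINT x|?M. h j x) \<le> (2/9) ^ j" for j
  proof -
    have "(LINT x|?M. h j x) = 2 ^ j * (L2_norm \<Omega> (g j))\<^sup>2"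
      unfolding h_def L2_norm_sq L2_inner_self by simp
    also have "\<dots> \<le> 2 ^ j * ((1/3) ^ j)\<^sup>2"
      by (intro mult_left_mono power_mono bound) auto
    also have "\<dots> = (2/9) ^ j"
      by (simp add: power_mult_distrib[symmetric] power2_eq_square)
    finally show ?thesis .
  qed
  moreover have "norm (h j x) = h j x" for j x by (simp add: h_def)
  moreover have "0 \<le> (LINT x|?M. h j x)" for j by (simp add: h_def)
  ultimately have "norm (LINT x|?M. norm (h j x)) \<le> (2/9) ^ j" for j by simp
  then have sum_norm: "summable (\<lambda>j. LINT x|?M. norm (h j x))"
    by (rule summable_comparison_test'[of "\<lambda>j. (2/9::real) ^ j" 0, OF summable_geometric, rotated]) simp
  define H where "H x = (\<Sum>j. h j x)" for x
  have AE_h: "AE x in ?M. summable (\<lambda>j. norm (h j x))"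
  proof -
    have "(\<integral>\<^sup>+x. (\<Sum>j. ennreal (norm (h j x))) \<partial>?M) = (\<Sum>j. (\<integral>\<^sup>+x. ennreal (norm (h j x)) \<partial>?M))"
      by (intro nn_integral_suminf) (simp add: h_def)
    also have "\<dots> = (\<Sum>j. ennreal (LINT x|?M. norm (h j x)))"
      using int_h by (intro suminf_cong nn_integral_eq_integral integrable_norm) auto
    also have "\<dots> = ennreal (\<Sum>j. LINT x|?M. norm (h j x))"
      using sum_norm by (intro suminf_ennreal2) auto
    finally have "(\<integral>\<^sup>+x. (\<Sum>j. ennreal (norm (h j x))) \<partial>?M) \<noteq> \<infinity>" by simp
    then have "AE x in ?M. (\<Sum>j. ennreal (norm (h j x))) \<noteq> \<infinity>"
      by (intro nn_integral_PInf_AE) (simp_all add: h_def)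
    then show ?thesis
      by eventually_elim (rule summable_suminf_not_top, auto)
  qed
  have int_H: "integrable ?M H"
    unfolding H_def by (rule integrable_suminf[OF int_h AE_h sum_norm])
  have partial: "(\<Sum>j<n. \<bar>g j x\<bar>) \<le> sqrt (2 * H x)" if "summable (\<lambda>j. norm (h j x))" for n x
  proof (rule real_le_rsqrt)
    have "(\<Sum>j<n. h j x) \<le> H x"
      unfolding H_def using that by (intro sum_le_suminf) (auto simp: h_def)
    then show "(\<Sum>j<n. \<bar>g j x\<bar>)\<^sup>2 \<le> 2 * H x"
      using abs_sum_geometric_weights[of "\<lambda>j. g j x" n] by (simp add: h_def)
  qed
  have AE_g: "summable (\<lambda>j. \<bar>g j x\<bar>) \<and> (\<Sum>j. \<bar>g j x\<bar>) \<le> sqrt (2 * H x)"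
    if "summable (\<lambda>j. norm (h j x))" for x
  proof
    show "summable (\<lambda>j. \<bar>g j x\<bar>)"
      \<comment> \<open>The criterion asks for sums over \<open>{..n}\<close>, which are the sums
        over \<open>{..<Suc n}\<close>.\<close>
      by (rule bounded_imp_summable[OF _ partial[OF that, of "Suc _", unfolded lessThan_Suc_atMost]]) auto
    then show "(\<Sum>j. \<bar>g j x\<bar>) \<le> sqrt (2 * H x)"
      by (rule suminf_le_const) (rule partial[OF that])
  qed
  show "AE x in ?M. summable (\<lambda>j. \<bar>g j x\<bar>)"
    using AE_h by eventually_elim (use AE_g in blast)
  show "(\<lambda>x. \<Sum>j. \<bar>g j x\<bar>) \<in> L2_space \<Omega>"
    unfolding L2_space_def
  proof (intro CollectI conjI)
    show meas: "(\<lambda>x. \<Sum>j. \<bar>g j x\<bar>) \<in> borel_measurable ?M" by measurable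
    show "integrable ?M (\<lambda>x. (\<Sum>j. \<bar>g j x\<bar>)\<^sup>2)"
    proof (rule Bochner_Integration.integrable_bound)
      show "integrable ?M (\<lambda>x. 2 * H x)" using int_H by simp
      show "AE x in ?M. norm ((\<Sum>j. \<bar>g j x\<bar>)\<^sup>2) \<le> norm (2 * H x)"
        using AE_h
      proof eventually_elim
        case (elim x)
        have H0: "0 \<le> H x" unfolding H_def using elim by (intro suminf_nonneg) (auto simp: h_def)
        from AE_g[OF elim] have "(\<Sum>j. \<bar>g j x\<bar>)\<^sup>2 \<le> (sqrt (2 * H x))\<^sup>2"
          by (intro power_mono suminf_nonneg) auto
        with H0 show ?case by simp
      qed
    qed (use meas in measurable)
  qed
qed

text \<open>Uniform boundedness by a gliding hump: the hump of size \<open>3\<^sup>-\<^sup>j\<close> is added with the sign that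
  keeps \<open>\<bar>L2_inner \<Omega> (h (r j)) (x (Suc j))\<bar>\<close> above \<open>3\<^sup>-\<^sup>j L2_norm \<Omega> (h (r j))\<close>, and all later humps
  together can only halve it.\<close>

lemma L2_uniform_boundedness:
  fixes h :: "nat \<Rightarrow> real^'n \<Rightarrow> real"
  assumes h: "\<And>n. h n \<in> L2_space \<Omega>"
    and bdd: "\<And>g. g \<in> L2_space \<Omega> \<Longrightarrow> \<exists>C. \<forall>n. \<bar>L2_inner \<Omega> (h n) g\<bar> \<le> C"
  shows "\<exists>C. \<forall>n. L2_norm \<Omega> (h n) \<le> C"
proof (rule ccontr)
  assume "\<not> ?thesis"
  \<comment> \<open>Growth \<open>4 ^ j\<close> against humps of norm \<open>(1/3) ^ j\<close>
    leaves \<open>(4/3) ^ j / 2\<close>, which is unbounded.\<close>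
  then have "\<exists>n. L2_norm \<Omega> (h n) \<ge> 4 ^ j" for j :: nat
    by (meson linear not_le)
  then obtain r where r: "\<And>j::nat. L2_norm \<Omega> (h (r j)) \<ge> 4 ^ j" by metis
  define N where "N j = L2_norm \<Omega> (h (r j))" for j
  have N_pos: "N j > 0" for j
    using r[of j] unfolding N_def by (rule less_le_trans[rotated]) simp
  define e where "e j x = (1/3) ^ j / N j * h (r j) x" for j x
  \<comment> \<open>The partial sums are defined by recursion because the sign of the next hump
    depends on the sum so far.\<close>
  define x where "x = rec_nat (\<lambda>_. 0 :: real)
    (\<lambda>j w z. w z + (if L2_inner \<Omega> w (h (r j)) \<ge> 0 then 1 else -1) * e j z)"
  define s where "s j = (if L2_inner \<Omega> (x j) (h (r j)) \<ge> 0 then 1 else -1 :: real)" for j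
  have x0: "x 0 = (\<lambda>_. 0)" and xSuc: "x (Suc j) = (\<lambda>z. x j z + s j * e j z)" for j
    by (auto simp: x_def s_def)
  have e_L2: "e j \<in> L2_space \<Omega>" for j unfolding e_def by (intro L2_cmult h)
  have x_sum: "x n = (\<lambda>z. \<Sum>j<n. s j * e j z)" for n
    by (induction n) (auto simp: x0 xSuc)
  define g where "g j z = s j * e j z" for j z
  have g_L2: "g j \<in> L2_space \<Omega>" for j unfolding g_def by (intro L2_cmult e_L2)
  have norm_g: "L2_norm \<Omega> (g j) = (1/3) ^ j" for j
    unfolding g_def e_def L2_norm_cmult using N_pos[of j]
    by (simp add: N_def s_def)
  have x_g: "x n = (\<lambda>z. \<Sum>j<n. g j z)" for n by (simp add: x_sum g_def)
  have x_L2: "x n \<in> L2_space \<Omega>" for n unfolding x_g by (intro L2_sum g_L2) auto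
  have inner_x: "L2_inner \<Omega> (x n) w = (\<Sum>i = 0..<n. L2_inner \<Omega> (g i) w)"
    if "w \<in> L2_space \<Omega>" for n w
    unfolding x_g lessThan_atLeast0 using that by (intro L2_inner_sum_left g_L2) auto
  note series = L2_series[of g, OF g_L2 norm_g[THEN eq_refl]]
  define G where "G z = (\<Sum>j. g j z)" for z
  have [measurable]: "g j \<in> borel_measurable (lebesgue_on \<Omega>)" for j by (rule L2_measurable[OF g_L2])
  have G_meas: "G \<in> borel_measurable (lebesgue_on \<Omega>)" unfolding G_def by measurable
  have G_L2: "G \<in> L2_space \<Omega>"
  proof (rule L2_bound[OF series(2) G_meas, where C = 1])
    show "AE z in lebesgue_on \<Omega>. \<bar>G z\<bar> \<le> 1 * \<bar>\<Sum>j. \<bar>g j z\<bar>\<bar>"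
      using series(1)
    proof eventually_elim
      case (elim z)
      then show ?case using summable_rabs[OF elim] by (simp add: G_def)
    qed
  qed
  have conv: "(\<lambda>n. L2_inner \<Omega> w (x n)) \<longlonglongrightarrow> L2_inner \<Omega> w G" if "w \<in> L2_space \<Omega>" for w
  proof (rule L2_inner_tendsto_AE[OF x_L2 series(2) that _ G_meas])
    show "AE z in lebesgue_on \<Omega>. (\<lambda>n. x n z) \<longlonglongrightarrow> G z"
      using series(1) unfolding x_g G_def
      by eventually_elim (rule summable_LIMSEQ[OF summable_rabs_cancel])
    show "AE z in lebesgue_on \<Omega>. \<bar>x n z\<bar> \<le> \<bar>\<Sum>j. \<bar>g j z\<bar>\<bar>" for n
      using series(1)
    proof eventually_elim
      case (elim z)
      have "\<bar>x n z\<bar> \<le> (\<Sum>j<n. \<bar>g j z\<bar>)" unfolding x_g by (rule sum_abs)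
      also have "\<dots> \<le> (\<Sum>j. \<bar>g j z\<bar>)" using elim by (intro sum_le_suminf) auto
      finally show ?case by simp
    qed
  qed
  have lower: "(1/3) ^ j * N j / 2 \<le> \<bar>L2_inner \<Omega> (h (r j)) G\<bar>" for j
  proof -
    have "L2_inner \<Omega> (e j) (h (r j)) = (1/3) ^ j / N j * (N j)\<^sup>2"
      unfolding e_def L2_inner_cmult_left N_def L2_norm_sq ..
    also have "\<dots> = (1/3) ^ j * N j" by (simp add: power2_eq_square)
    finally have "L2_inner \<Omega> (x (Suc j)) (h (r j)) = L2_inner \<Omega> (x j) (h (r j)) + s j * ((1/3) ^ j * N j)"
      unfolding xSuc by (simp add: L2_inner_add_left L2_inner_cmult_left x_L2 L2_cmult e_L2 h)
    moreover have "0 \<le> (1/3) ^ j * N j" using N_pos[of j] by simp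
    ultimately have start: "(1/3) ^ j * N j \<le> \<bar>L2_inner \<Omega> (x (Suc j)) (h (r j))\<bar>"
      unfolding s_def by (auto split: if_splits)
    \<comment> \<open>By Cauchy-Schwarz the humps after j contribute at most \<open>N j\<close>
      times a geometric sum, and the powers \<open>(1/3) ^ i\<close> with i > j add up to
      \<open>(1/3) ^ j / 2\<close>.\<close>
    have "\<bar>L2_inner \<Omega> (h (r j)) (x (Suc j + n)) - L2_inner \<Omega> (x (Suc j)) (h (r j))\<bar>
        \<le> (1/3) ^ j * N j / 2" for n
    proof -
      have "L2_inner \<Omega> (h (r j)) (x (Suc j + n)) - L2_inner \<Omega> (x (Suc j)) (h (r j))
          = (\<Sum>i\<in>{Suc j..<Suc j + n}. L2_inner \<Omega> (g i) (h (r j)))"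
        using sum.atLeastLessThan_concat[of 0 "Suc j" "Suc j + n" "\<lambda>i. L2_inner \<Omega> (g i) (h (r j))"]
        unfolding L2_inner_commute[of _ "h (r j)" "x _"] inner_x[OF h] by linarith
      also have "\<bar>\<dots>\<bar> \<le> (\<Sum>i\<in>{Suc j..<Suc j + n}. (1/3) ^ i * N j)"
      proof (intro order_trans[OF sum_abs] sum_mono)
        fix i show "\<bar>L2_inner \<Omega> (g i) (h (r j))\<bar> \<le> (1/3) ^ i * N j"
          using L2_Cauchy_Schwarz[OF g_L2 h, of i "r j"] by (simp add: norm_g N_def)
      qed
      also have "\<dots> = (\<Sum>i\<in>{Suc j..<Suc j + n}. (1/3) ^ i) * N j" by (rule sum_distrib_right[symmetric])
      also have "\<dots> \<le> ((1/3) ^ j / 2) * N j"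
      proof (rule mult_right_mono)
        have "(\<Sum>i\<in>{Suc j..<Suc j + n}. (1/3::real) ^ i) = (1/3) ^ j / 2 * (1 - (1/3) ^ n)"
        proof (induction n)
          case (Suc n)
          have "(\<Sum>i\<in>{Suc j..<Suc j + Suc n}. (1/3::real) ^ i)
              = (\<Sum>i\<in>{Suc j..<Suc j + n}. (1/3) ^ i) + (1/3) ^ (Suc j + n)" by simp
          also have "\<dots> = (1/3) ^ j / 2 * (1 - (1/3) ^ Suc n)"
            unfolding Suc.IH by (simp add: power_add field_simps)
          finally show ?case .
        qed simp
        also have "\<dots> \<le> (1/3) ^ j / 2 * 1" by (intro mult_left_mono) auto
        finally show "(\<Sum>i\<in>{Suc j..<Suc j + n}. (1/3::real) ^ i) \<le> (1/3) ^ j / 2" by simp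
      qed (use N_pos[of j] in simp)
      finally show ?thesis by simp
    qed
    moreover have "(\<lambda>n. \<bar>L2_inner \<Omega> (h (r j)) (x (Suc j + n)) - L2_inner \<Omega> (x (Suc j)) (h (r j))\<bar>)
        \<longlonglongrightarrow> \<bar>L2_inner \<Omega> (h (r j)) G - L2_inner \<Omega> (x (Suc j)) (h (r j))\<bar>"
      using LIMSEQ_ignore_initial_segment[OF conv[OF h[of "r j"]], of "Suc j"]
      by (intro tendsto_intros) (simp add: add.commute)
    ultimately have "\<bar>L2_inner \<Omega> (h (r j)) G - L2_inner \<Omega> (x (Suc j)) (h (r j))\<bar> \<le> (1/3) ^ j * N j / 2"
      by (intro LIMSEQ_le_const2) auto
    with start show ?thesis by linarith
  qed
  obtain C where C: "\<And>n. \<bar>L2_inner \<Omega> (h n) G\<bar> \<le> C" using bdd[OF G_L2] by blast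
  have "(4/3) ^ j \<le> 2 * C" for j
  proof -
    have "(4/3::real) ^ j = (1/3) ^ j * 4 ^ j" by (simp add: power_mult_distrib[symmetric])
    also have "\<dots> \<le> (1/3) ^ j * N j" using r[of j] by (intro mult_left_mono) (auto simp: N_def)
    also have "\<dots> \<le> 2 * C" using lower[of j] C[of "r j"] by simp
    finally show ?thesis .
  qed
  moreover obtain j where "2 * C < (4/3::real) ^ j" using real_arch_pow[of "4/3" "2 * C"] by auto
  ultimately show False by (meson not_le)
qed

section \<open>Smooth functions and test functions\<close>

text \<open>Coinduction for smoothness: the smooth functions form the largest class of everywhere
  differentiable functions that is closed under partial derivatives, so exhibiting one such class is
  enough.\<close>

lemma smooth_if_closed:
  assumes "\<phi> \<in> A" and "\<And>\<psi> x. \<psi> \<in> A \<Longrightarrow> \<psi> differentiable (at x)"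
    and "\<And>\<psi> i. \<psi> \<in> A \<Longrightarrow> classical_partial i \<psi> \<in> A"
  shows "smooth \<phi>"
  unfolding smooth_def
proof (intro allI)
  fix js x
  have "foldr classical_partial js \<phi> \<in> A"
    by (induction js) (simp_all add: assms(1,3))
  then show "foldr classical_partial js \<phi> differentiable (at x)" by (rule assms(2))
qed

lemma smooth_differentiable: "smooth \<phi> \<Longrightarrow> \<phi> differentiable (at x)"
  unfolding smooth_def by (metis foldr_Nil id_apply)

lemma smooth_partial: "smooth \<phi> \<Longrightarrow> smooth (classical_partial i \<phi>)"
  unfolding smooth_def
proof (intro allI)
  fix js x assume "\<forall>js x. foldr classical_partial js \<phi> differentiable (at x)"
  \<comment> \<open>\<open>foldr\<close> starts at the end of the list, so an appended i is the
    innermost derivative.\<close>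
  then have "foldr classical_partial (js @ [i]) \<phi> differentiable (at x)" by blast
  then show "foldr classical_partial js (classical_partial i \<phi>) differentiable (at x)" by simp
qed

lemma smooth_continuous_on: "smooth \<phi> \<Longrightarrow> continuous_on S \<phi>"
  using smooth_differentiable continuous_at_imp_continuous_on differentiable_imp_continuous_within
  by blast

lemma smooth_has_derivative:
  assumes "smooth (\<phi> :: real^'n::finite \<Rightarrow> real)"
  shows "(\<phi> has_derivative (\<lambda>h. \<Sum>i\<in>UNIV. h $ i * classical_partial i \<phi> x)) (at x)"
proof -
  have der: "(\<phi> has_derivative frechet_derivative \<phi> (at x)) (at x)"
    using smooth_differentiable[OF assms] frechet_derivative_works by blast
  then have lin: "linear (frechet_derivative \<phi> (at x))"
    using has_derivative_linear by blast
  have "frechet_derivative \<phi> (at x) h = (\<Sum>i\<in>UNIV. h $ i * classical_partial i \<phi> x)" for h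
  proof -
    have "frechet_derivative \<phi> (at x) h = frechet_derivative \<phi> (at x) (\<Sum>i\<in>UNIV. h $ i *\<^sub>R axis i 1)"
      using basis_expansion[of h] by (simp add: scalar_mult_eq_scaleR)
    also have "\<dots> = (\<Sum>i\<in>UNIV. h $ i * classical_partial i \<phi> x)"
      by (simp add: linear_sum[OF lin] linear_scale[OF lin] classical_partial_def)
    finally show ?thesis .
  qed
  then have "frechet_derivative \<phi> (at x) = (\<lambda>h. \<Sum>i\<in>UNIV. h $ i * classical_partial i \<phi> x)" by auto
  with der show ?thesis by simp
qed

lemma classical_partial_eq:
  assumes "(\<phi> has_derivative D) (at x)"
  shows "classical_partial i \<phi> x = D (axis i 1)"
  unfolding classical_partial_def using frechet_derivative_at[OF assms] by simp

text \<open>A class made to survive the chain and product rules: differentiating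
  \<open>g (\<phi> x)\<close> yields a product of \<open>g' (\<phi> x)\<close> with a smooth
  function. Once G is closed under derivation, smoothness of all compositions follows with no
  formula for higher derivatives.\<close>

inductive_set smooth_algebra :: "(real \<Rightarrow> real) set \<Rightarrow> (real^'n::finite \<Rightarrow> real) set" for G where
  smooth: "smooth \<phi> \<Longrightarrow> \<phi> \<in> smooth_algebra G"
| comp: "g \<in> G \<Longrightarrow> smooth \<phi> \<Longrightarrow> (\<lambda>x. g (\<phi> x)) \<in> smooth_algebra G"
| add: "\<phi> \<in> smooth_algebra G \<Longrightarrow> \<psi> \<in> smooth_algebra G \<Longrightarrow> (\<lambda>x. \<phi> x + \<psi> x) \<in> smooth_algebra G"
| mult: "\<phi> \<in> smooth_algebra G \<Longrightarrow> \<psi> \<in> smooth_algebra G \<Longrightarrow> (\<lambda>x. \<phi> x * \<psi> x) \<in> smooth_algebra G"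

lemma partial_comp:
  assumes "(g has_real_derivative g' (\<phi> x)) (at (\<phi> x))" "\<phi> differentiable (at x)"
  shows "(\<lambda>x. g (\<phi> x)) differentiable (at x)"
    and "classical_partial i (\<lambda>x. g (\<phi> x)) x = g' (\<phi> x) * classical_partial i \<phi> x"
proof -
  have "(\<phi> has_derivative frechet_derivative \<phi> (at x)) (at x)"
    using assms(2) frechet_derivative_works by blast
  then have *: "((\<lambda>x. g (\<phi> x)) has_derivative (\<lambda>h. g' (\<phi> x) * frechet_derivative \<phi> (at x) h)) (at x)"
    by (rule has_derivative_compose) (use assms(1) in \<open>simp add: has_field_derivative_def\<close>)
  then show "(\<lambda>x. g (\<phi> x)) differentiable (at x)" by (rule differentiableI)
  show "classical_partial i (\<lambda>x. g (\<phi> x)) x = g' (\<phi> x) * classical_partial i \<phi> x"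
    unfolding classical_partial_eq[OF *] by (simp add: classical_partial_def)
qed

lemma partial_add_mult:
  assumes "\<phi> differentiable (at x)" "\<psi> differentiable (at x)"
  shows "classical_partial i (\<lambda>x. \<phi> x + \<psi> x) x = classical_partial i \<phi> x + classical_partial i \<psi> x"
    and "classical_partial i (\<lambda>x. \<phi> x * \<psi> x) x
      = \<phi> x * classical_partial i \<psi> x + classical_partial i \<phi> x * \<psi> x"
proof -
  have *: "(\<phi> has_derivative frechet_derivative \<phi> (at x)) (at x)"
    "(\<psi> has_derivative frechet_derivative \<psi> (at x)) (at x)"
    using assms frechet_derivative_works by blast+
  show "classical_partial i (\<lambda>x. \<phi> x + \<psi> x) x = classical_partial i \<phi> x + classical_partial i \<psi> x"
    unfolding classical_partial_eq[OF has_derivative_add[OF *]] by (simp add: classical_partial_def)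
  show "classical_partial i (\<lambda>x. \<phi> x * \<psi> x) x
      = \<phi> x * classical_partial i \<psi> x + classical_partial i \<phi> x * \<psi> x"
    unfolding classical_partial_eq[OF has_derivative_mult[OF *]] by (simp add: classical_partial_def)
qed

lemma smooth_algebra_smooth:
  assumes "\<phi> \<in> smooth_algebra G"
    and G: "\<And>g. g \<in> G \<Longrightarrow> \<exists>g'\<in>G. \<forall>t. (g has_real_derivative g' t) (at t)"
  shows "smooth \<phi>"
proof (rule smooth_if_closed[OF assms(1)])
  show diff: "\<psi> differentiable (at x)" if "\<psi> \<in> smooth_algebra G" for \<psi> x
    using that
  proof induction
    case (comp g \<phi>)
    then show ?case using G[OF comp(1)] partial_comp(1) smooth_differentiable by metis
  qed (auto intro: smooth_differentiable)
  show "classical_partial i \<psi> \<in> smooth_algebra G" if "\<psi> \<in> smooth_algebra G" for \<psi> i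
    using that
  proof induction
    case (smooth \<phi>)
    then show ?case by (intro smooth_algebra.smooth smooth_partial)
  next
    case (comp g \<phi>)
    obtain g' where g': "g' \<in> G" "\<And>t. (g has_real_derivative g' t) (at t)" using G[OF comp(1)] by blast
    have "classical_partial i (\<lambda>x. g (\<phi> x)) = (\<lambda>x. g' (\<phi> x) * classical_partial i \<phi> x)"
      by (intro ext partial_comp(2) g' smooth_differentiable comp)
    then show ?case
      using smooth_algebra.mult[OF smooth_algebra.comp[OF g'(1) comp(2)]
          smooth_algebra.smooth[OF smooth_partial[OF comp(2)]]] by simp
  next
    case (add \<phi> \<psi>)
    have "classical_partial i (\<lambda>x. \<phi> x + \<psi> x) = (\<lambda>x. classical_partial i \<phi> x + classical_partial i \<psi> x)"
      by (intro ext partial_add_mult diff add)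
    with add show ?case by (auto intro: smooth_algebra.add)
  next
    case (mult \<phi> \<psi>)
    have "classical_partial i (\<lambda>x. \<phi> x * \<psi> x)
        = (\<lambda>x. \<phi> x * classical_partial i \<psi> x + classical_partial i \<phi> x * \<psi> x)"
      by (intro ext partial_add_mult diff mult)
    with mult show ?case by (auto intro: smooth_algebra.add smooth_algebra.mult)
  qed
qed

lemma smooth_comp:
  assumes "\<And>g. g \<in> G \<Longrightarrow> \<exists>g'\<in>G. \<forall>t. (g has_real_derivative g' t) (at t)" "g \<in> G" "smooth \<phi>"
  shows "smooth (\<lambda>x. g (\<phi> x))"
  by (rule smooth_algebra_smooth[OF smooth_algebra.comp[OF assms(2,3)] assms(1)])

lemma smooth_add: "smooth \<phi> \<Longrightarrow> smooth \<psi> \<Longrightarrow> smooth (\<lambda>x. \<phi> x + \<psi> x)"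
  by (rule smooth_algebra_smooth[where G = "{}"]) (auto intro: smooth_algebra.intros)

lemma smooth_mult: "smooth \<phi> \<Longrightarrow> smooth \<psi> \<Longrightarrow> smooth (\<lambda>x. \<phi> x * \<psi> x)"
  by (rule smooth_algebra_smooth[where G = "{}"]) (auto intro: smooth_algebra.intros)

section \<open>Affine functions, flat exponentials and smooth positive parts\<close>

lemma smooth_affine: "smooth (\<lambda>x::real^'n::finite. c * x $ i + d)"
proof (rule smooth_if_closed[where A = "range (\<lambda>(c, d) x. c * x $ i + d)"])
  have *: "((\<lambda>x::real^'n. c * x $ i + d) has_derivative (\<lambda>h. c * h $ i)) (at x)" for c d x
    by (auto intro!: derivative_eq_intros bounded_linear_imp_has_derivative bounded_linear_vec_nth)
  show "\<psi> differentiable (at x)" if "\<psi> \<in> range (\<lambda>(c, d) x. c * x $ i + d)" for \<psi> and x :: "real^'n"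
    using that * by (auto intro: differentiableI)
  show "classical_partial j \<psi> \<in> range (\<lambda>(c, d) x. c * x $ i + d)"
    if "\<psi> \<in> range (\<lambda>(c, d) (x::real^'n). c * x $ i + d)" for \<psi> j
  proof -
    obtain c d where \<psi>: "\<psi> = (\<lambda>x. c * x $ i + d)" using \<open>\<psi> \<in> _\<close> by auto
    have "classical_partial j \<psi> = (\<lambda>x. 0 * x $ i + c * axis j 1 $ i)"
      unfolding \<psi> by (rule ext) (simp add: classical_partial_eq[OF *])
    then show ?thesis by (auto intro: rev_image_eqI[of "(0, c * axis j 1 $ i)"])
  qed
qed auto

lemma smooth_const: "smooth (\<lambda>x. c)"
  using smooth_affine[of 0 _ c] by simp

lemma smooth_prod:
  "finite I \<Longrightarrow> (\<And>i. i \<in> I \<Longrightarrow> smooth (\<phi> i)) \<Longrightarrow> smooth (\<lambda>x. \<Prod>i\<in>I. \<phi> i x)"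
  by (induction I rule: finite_induct) (auto intro: smooth_const smooth_mult)

text \<open>The flat function exp(-1/t), continued by 0 to t \<le> 0, with a polynomial factor in
  1/t. The factor makes the family closed under derivation: p becomes X^2 (p - p').\<close>

definition exp_inv :: "real poly \<Rightarrow> real \<Rightarrow> real" where
  "exp_inv p t = (if t > 0 then poly p (1 / t) * exp (- 1 / t) else 0)"

lemma poly_times_exp_minus_tendsto_0: "((\<lambda>x::real. poly p x * exp (- x)) \<longlongrightarrow> 0) at_top"
proof -
  have "((\<lambda>x::real. \<Sum>i\<le>degree p. coeff p i * (x ^ i / exp x)) \<longlongrightarrow> (\<Sum>i\<le>degree p. coeff p i * 0)) at_top"
    by (intro tendsto_intros tendsto_power_div_exp_0)
  then show ?thesis
    by (simp add: poly_altdef sum_distrib_right exp_minus divide_inverse mult.assoc)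
qed

lemma exp_inv_has_derivative:
  "(exp_inv p has_real_derivative exp_inv ([:0, 0, 1:] * (p - pderiv p)) t) (at t)"
proof -
  consider "t > 0" | "t < 0" | "t = 0" by linarith
  then show ?thesis
  proof cases
    case 1
    have "((\<lambda>t. poly p (1 / t) * exp (- 1 / t)) has_real_derivative
        exp_inv ([:0, 0, 1:] * (p - pderiv p)) t) (at t)"
      using 1 by (auto intro!: derivative_eq_intros DERIV_chain2[OF poly_DERIV]
          simp: exp_inv_def field_simps power2_eq_square)
    then show ?thesis
      by (rule has_field_derivative_transform_within_open[of _ _ _ "{0<..}"])
         (use 1 in \<open>auto simp: exp_inv_def\<close>)
  next
    case 2
    have "((\<lambda>t. 0) has_real_derivative exp_inv ([:0, 0, 1:] * (p - pderiv p)) t) (at t)"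
      using 2 by (auto simp: exp_inv_def)
    then show ?thesis
      by (rule has_field_derivative_transform_within_open[of _ _ _ "{..<0}"])
         (use 2 in \<open>auto simp: exp_inv_def\<close>)
  next
    case 3
    \<comment> \<open>Dividing by h multiplies the polynomial by \<open>[:0, 1:]\<close>, and the
      exponential beats every polynomial.\<close>
    have "((\<lambda>h. exp_inv p h / h) \<longlongrightarrow> 0) (at_right 0)"
    proof -
      have "((\<lambda>h::real. poly ([:0, 1:] * p) (inverse h) * exp (- inverse h)) \<longlongrightarrow> 0) (at_right 0)"
        by (rule filterlim_compose[OF poly_times_exp_minus_tendsto_0 filterlim_inverse_at_top_right])
      moreover have "eventually (\<lambda>h. poly ([:0, 1:] * p) (inverse h) * exp (- inverse h)
          = exp_inv p h / h) (at_right 0)"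
        using eventually_at_right_less[of 0]
        by eventually_elim (simp add: exp_inv_def divide_inverse mult_ac)
      ultimately show ?thesis by (rule Lim_transform_eventually)
    qed
    moreover have "((\<lambda>h. exp_inv p h / h) \<longlongrightarrow> 0) (at_left 0)"
      by (rule Lim_transform_eventually[OF tendsto_const])
         (auto simp: eventually_at_filter exp_inv_def)
    ultimately have "((\<lambda>h. exp_inv p h / h) \<longlongrightarrow> 0) (at 0)"
      by (simp add: filterlim_split_at)
    then show ?thesis
      using 3 by (simp add: DERIV_def exp_inv_def[of _ 0])
  qed
qed

lemma smooth_exp_inv: "smooth \<phi> \<Longrightarrow> smooth (\<lambda>x. exp_inv p (\<phi> x))"
  by (rule smooth_comp[where G = "range exp_inv"]) (use exp_inv_has_derivative in blast)+

text \<open>A smooth stand-in for the positive part, since \<open>H10_space\<close> is built from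
  smooth functions. The division by 2 makes it vanish at 0, so composing it with a test function
  keeps the support compact inside the domain.\<close>

definition softplus :: "real \<Rightarrow> real \<Rightarrow> real" where
  "softplus k t = ln ((1 + exp (k * t)) / 2) / k"

definition softplus_deriv :: "real \<Rightarrow> real \<Rightarrow> real" where
  "softplus_deriv k t = 1 - inverse (1 + exp (k * t))"

lemma one_plus_exp_pos: "0 < 1 + exp (t::real)"
  by (simp add: add_pos_pos)

lemma softplus_has_derivative:
  "k > 0 \<Longrightarrow> (softplus k has_real_derivative softplus_deriv k t) (at t)"
proof -
  assume "k > 0"
  have pos: "0 < 1 + exp (k * t)" by (rule one_plus_exp_pos)
  have "((\<lambda>t. ln ((1 + exp (k * t)) / 2) / k) has_real_derivative
      (1 / ((1 + exp (k * t)) / 2)) * (exp (k * t) * k / 2) / k) (at t)"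
    using pos by (auto intro!: derivative_eq_intros)
  moreover have "(1 / ((1 + exp (k * t)) / 2)) * (exp (k * t) * k / 2) / k = softplus_deriv k t"
    using pos \<open>k > 0\<close> by (simp add: softplus_deriv_def divide_simps)
  ultimately show ?thesis unfolding softplus_def by simp
qed

text \<open>The logistic function \<sigma> = \<open>softplus_deriv k\<close> satisfies \<sigma>' = k
  \<sigma> (1 - \<sigma>), so the polynomials in \<sigma> are closed under derivation.\<close>

lemma smooth_softplus:
  assumes "smooth \<phi>" "k > 0"
  shows "smooth (\<lambda>x. softplus k (\<phi> x))"
proof (rule smooth_comp[where g = "softplus k" and G = "insert (softplus k) (range (\<lambda>p t. poly p (softplus_deriv k t)))"])
  fix g assume "g \<in> insert (softplus k) (range (\<lambda>p t. poly p (softplus_deriv k t)))"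
  then consider "g = softplus k" | p where "g = (\<lambda>t. poly p (softplus_deriv k t))" by auto
  then show "\<exists>g'\<in>insert (softplus k) (range (\<lambda>p t. poly p (softplus_deriv k t))).
      \<forall>t. (g has_real_derivative g' t) (at t)"
  proof cases
    case 1
    have "(\<lambda>t. poly [:0, 1:] (softplus_deriv k t)) = softplus_deriv k" by auto
    then show ?thesis using 1 softplus_has_derivative[OF assms(2)]
      by (metis (mono_tags, lifting) insertCI rangeI)
  next
    case 2
    have "(softplus_deriv k has_real_derivative k * softplus_deriv k t * (1 - softplus_deriv k t)) (at t)" for t
      unfolding softplus_deriv_def using one_plus_exp_pos[of "k * t"]
      by (auto intro!: derivative_eq_intros simp: field_simps power2_eq_square)
    from DERIV_chain2[OF poly_DERIV this]
    have "(g has_real_derivative poly (pderiv p * [:0, k, - k:]) (softplus_deriv k t)) (at t)" for t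
      unfolding 2 by (simp add: algebra_simps)
    then show ?thesis by (intro bexI[OF _ insertI2[OF rangeI]] allI)
  qed
qed (use assms in auto)

lemma softplus_0 [simp]: "softplus k 0 = 0"
  by (simp add: softplus_def)

lemma softplus_deriv_range: "0 \<le> softplus_deriv k t" "softplus_deriv k t \<le> 1"
  unfolding softplus_deriv_def using one_plus_exp_pos[of "k * t"] by (auto simp: field_simps)

lemma isCont_softplus_deriv: "isCont (softplus_deriv k) t"
  unfolding softplus_deriv_def using one_plus_exp_pos[of "k * t"] by (intro continuous_intros) auto

lemma softplus_lipschitz:
  assumes "k > 0"
  shows "\<bar>softplus k s - softplus k t\<bar> \<le> \<bar>s - t\<bar>"
proof -
  have "norm (softplus k s - softplus k t) \<le> 1 * norm (s - t)"
    by (rule field_differentiable_bound[where S = UNIV])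
       (use softplus_has_derivative[OF assms] softplus_deriv_range in auto)
  then show ?thesis by simp
qed

text \<open>With m = \<open>max 0 t\<close>, the number 1 + exp(k t) lies between exp(k m) and 2
  exp(k m); the logarithm of the factor 2, divided by k, is the error.\<close>

lemma softplus_approx:
  assumes "k > 0"
  shows "\<bar>softplus k t - max 0 t\<bar> \<le> ln 2 / k"
proof -
  have "ln (1 + exp (k * t)) \<le> ln (2 * exp (k * max 0 t))"
  proof (subst ln_le_cancel_iff)
    have "exp (k * t) \<le> exp (k * max 0 t)" "1 \<le> exp (k * max 0 t)" using assms by auto
    then show "1 + exp (k * t) \<le> 2 * exp (k * max 0 t)" by linarith
  qed (simp_all add: one_plus_exp_pos)
  moreover have "ln (exp (k * max 0 t)) \<le> ln (1 + exp (k * t))"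
    by (subst ln_le_cancel_iff) (simp_all add: one_plus_exp_pos max_def)
  ultimately have "k * max 0 t - ln 2 \<le> ln (1 + exp (k * t)) - ln 2"
    "ln (1 + exp (k * t)) - ln 2 \<le> k * max 0 t"
    by (simp_all add: ln_mult)
  moreover have "k * softplus k t = ln (1 + exp (k * t)) - ln 2"
    unfolding softplus_def using one_plus_exp_pos[of "k * t"] assms by (simp add: ln_div)
  ultimately have "k * (max 0 t - ln 2 / k) \<le> k * softplus k t" "k * softplus k t \<le> k * max 0 t"
    using assms by (simp_all add: right_diff_distrib)
  then have "max 0 t - ln 2 / k \<le> softplus k t" "softplus k t \<le> max 0 t"
    using assms by simp_all
  moreover have "0 \<le> ln 2 / k" using assms by simp
  ultimately show ?thesis by linarith
qed

section \<open>Test functions: algebra, supports and bumps of boxes\<close>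

lemma test_smooth: "\<phi> \<in> test_functions \<Omega> \<Longrightarrow> smooth \<phi>"
  by (simp add: test_functions_def)

lemma test_mono_support:
  assumes "\<phi> \<in> test_functions \<Omega>" "smooth \<psi>" "{x. \<psi> x \<noteq> 0} \<subseteq> closure {x. \<phi> x \<noteq> 0}"
  shows "\<psi> \<in> test_functions \<Omega>"
proof -
  have "closure {x. \<psi> x \<noteq> 0} \<subseteq> closure {x. \<phi> x \<noteq> 0}"
    using closure_mono[OF assms(3)] by simp
  then show ?thesis
    using assms closed_subset compact_Int_closed[of "closure {x. \<phi> x \<noteq> 0}" "closure {x. \<psi> x \<noteq> 0}"]
    by (auto simp: test_functions_def Int_absorb1)
qed

lemma test_add:
  assumes "\<phi> \<in> test_functions \<Omega>" "\<psi> \<in> test_functions \<Omega>"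
  shows "(\<lambda>x. \<phi> x + \<psi> x) \<in> test_functions \<Omega>"
proof -
  have "closure {x. \<phi> x + \<psi> x \<noteq> 0} \<subseteq> closure {x. \<phi> x \<noteq> 0} \<union> closure {x. \<psi> x \<noteq> 0}"
    unfolding closure_Un[symmetric] by (rule closure_mono) auto
  moreover from this have "compact (closure {x. \<phi> x + \<psi> x \<noteq> 0})"
    using assms compact_Int_closed[of "closure {x. \<phi> x \<noteq> 0} \<union> closure {x. \<psi> x \<noteq> 0}" "closure {x. \<phi> x + \<psi> x \<noteq> 0}"]
    by (auto simp: test_functions_def Int_absorb1 compact_Un)
  ultimately show ?thesis
    using assms by (auto simp: test_functions_def smooth_add)
qed

lemma test_mult:
  "\<phi> \<in> test_functions \<Omega> \<Longrightarrow> smooth \<psi> \<Longrightarrow> (\<lambda>x. \<phi> x * \<psi> x) \<in> test_functions \<Omega>"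
  by (rule test_mono_support) (auto intro: smooth_mult test_smooth closure_subset[THEN subsetD])

lemma test_diff:
  assumes "\<phi> \<in> test_functions \<Omega>" "\<psi> \<in> test_functions \<Omega>"
  shows "(\<lambda>x. \<phi> x - \<psi> x) \<in> test_functions \<Omega>"
  using test_add[OF assms(1) test_mult[OF assms(2) smooth_const[of "-1"]]] by simp

lemma test_softplus:
  "\<phi> \<in> test_functions \<Omega> \<Longrightarrow> k > 0 \<Longrightarrow> (\<lambda>x. softplus k (\<phi> x)) \<in> test_functions \<Omega>"
  by (rule test_mono_support[OF _ smooth_softplus[OF test_smooth]])
     (auto intro!: closure_subset[THEN subsetD])

lemma test_partial:
  assumes "\<phi> \<in> test_functions \<Omega>"
  shows "classical_partial i \<phi> \<in> test_functions \<Omega>"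
proof (rule test_mono_support[OF assms smooth_partial[OF test_smooth[OF assms]]], rule subsetI, rule ccontr)
  fix x assume x: "x \<in> {x. classical_partial i \<phi> x \<noteq> 0}" "x \<notin> closure {x. \<phi> x \<noteq> 0}"
  have "(\<phi> has_derivative (\<lambda>h. 0)) (at x)"
  proof (rule has_derivative_transform_within_open)
    show "((\<lambda>x. 0) has_derivative (\<lambda>h. 0)) (at x)" by (rule has_derivative_const)
    show "open (- closure {x. \<phi> x \<noteq> 0})" by (intro open_Compl closed_closure)
    show "0 = \<phi> z" if "z \<in> - closure {x. \<phi> x \<noteq> 0}" for z
      using that closure_subset[of "{x. \<phi> x \<noteq> 0}"] by auto
  qed (use x in simp)
  from classical_partial_eq[OF this] x(1) show False by simp
qed

lemma test_zero_outside: "\<phi> \<in> test_functions \<Omega> \<Longrightarrow> x \<notin> \<Omega> \<Longrightarrow> \<phi> x = 0"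
  unfolding test_functions_def using closure_subset[of "{x. \<phi> x \<noteq> 0}"] by blast

lemma test_continuous_on: "\<phi> \<in> test_functions \<Omega> \<Longrightarrow> continuous_on S \<phi>"
  by (intro smooth_continuous_on test_smooth)

lemma test_bounded:
  assumes "\<phi> \<in> test_functions \<Omega>"
  shows "\<exists>C>0. \<forall>x. \<bar>\<phi> x\<bar> \<le> C"
proof -
  let ?K = "closure {x. \<phi> x \<noteq> 0}"
  have "compact (\<phi> ` ?K)"
    using assms test_continuous_on[OF assms] by (intro compact_continuous_image) (auto simp: test_functions_def)
  then obtain C where "\<forall>x\<in>?K. \<bar>\<phi> x\<bar> \<le> C"
    using compact_imp_bounded[of "\<phi> ` ?K"] by (auto simp: bounded_iff)
  then have "\<bar>\<phi> x\<bar> \<le> max C 1" for x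
    using closure_subset[of "{x. \<phi> x \<noteq> 0}"] by (cases "\<phi> x = 0") force+
  then show ?thesis by (intro exI[of _ "max C 1"]) auto
qed

text \<open>Here \<open>1\<close> is the constant polynomial, so each factor is exp(-1/(m t)), with
  t the distance to a face of the box. It increases to 1 with m, which makes the indicator of the
  open box a dominated limit of test functions.\<close>

definition box_bump :: "nat \<Rightarrow> real^'n::finite \<Rightarrow> real^'n \<Rightarrow> real^'n \<Rightarrow> real" where
  "box_bump m a b x = (\<Prod>i\<in>UNIV. exp_inv 1 (real m * (x $ i - a $ i)) * exp_inv 1 (real m * (b $ i - x $ i)))"

lemma exp_inv_1_range: "0 \<le> exp_inv 1 t" "exp_inv 1 t \<le> 1"
  by (auto simp: exp_inv_def)

lemma box_bump_zero: "x \<notin> box a b \<Longrightarrow> box_bump m a b x = 0"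
  unfolding box_bump_def mem_box_cart
  by (auto simp: exp_inv_def zero_less_mult_iff)

lemma box_bump_range: "0 \<le> box_bump m a b x" "box_bump m a b x \<le> 1"
  unfolding box_bump_def
  by (auto intro!: prod_nonneg prod_le_1 mult_nonneg_nonneg mult_le_one simp: exp_inv_1_range)

lemma test_box_bump:
  fixes a b :: "real^'n::finite"
  assumes "cbox a b \<subseteq> \<Omega>"
  shows "box_bump m a b \<in> test_functions \<Omega>"
proof -
  have "smooth (box_bump m a b)"
    unfolding box_bump_def
  proof (rule smooth_prod)
    fix i :: 'n
    have "smooth (\<lambda>x::real^'n. real m * (x $ i - a $ i))"
      using smooth_affine[of "real m" i "- real m * a $ i"] by (simp add: algebra_simps)
    moreover have "smooth (\<lambda>x::real^'n. real m * (b $ i - x $ i))"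
      using smooth_affine[of "- real m" i "real m * b $ i"] by (simp add: algebra_simps)
    ultimately show "smooth (\<lambda>x. exp_inv 1 (real m * (x $ i - a $ i)) * exp_inv 1 (real m * (b $ i - x $ i)))"
      by (intro smooth_mult[OF smooth_exp_inv smooth_exp_inv])
  qed simp
  moreover have sub: "closure {x. box_bump m a b x \<noteq> 0} \<subseteq> cbox a b"
  proof (rule closure_minimal)
    show "{x. box_bump m a b x \<noteq> 0} \<subseteq> cbox a b"
      using box_bump_zero[of _ a b m] box_subset_cbox[of a b] by blast
  qed (rule closed_cbox)
  moreover have "compact (closure {x. box_bump m a b x \<noteq> 0})"
    using compact_Int_closed[OF compact_cbox closed_closure, of a b] sub by (metis Int_absorb1)
  ultimately show ?thesis using assms by (auto simp: test_functions_def)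
qed

lemma box_bump_tendsto: "(\<lambda>m. box_bump m a b x) \<longlonglongrightarrow> indicator (box a b) x"
proof (cases "x \<in> box a b")
  case True
  have *: "(\<lambda>m. exp_inv 1 (real m * t)) \<longlonglongrightarrow> 1" if "t > 0" for t
  proof (rule Lim_transform_eventually)
    have "(\<lambda>m. exp (- (1 / t) * inverse (real m))) \<longlonglongrightarrow> exp (- (1 / t) * 0)"
      by (intro tendsto_intros LIMSEQ_inverse_real_of_nat[THEN LIMSEQ_imp_Suc])
    then show "(\<lambda>m. exp (- (1 / t) * inverse (real m))) \<longlonglongrightarrow> 1" by simp
    show "\<forall>\<^sub>F m in sequentially. exp (- (1 / t) * inverse (real m)) = exp_inv 1 (real m * t)"
      using eventually_gt_at_top[of 0]
      by eventually_elim (use that in \<open>simp add: exp_inv_def field_simps\<close>)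
  qed
  have "(\<lambda>m. box_bump m a b x) \<longlonglongrightarrow> (\<Prod>i\<in>(UNIV::'a set). 1 * 1)"
    unfolding box_bump_def using True by (intro tendsto_prod tendsto_mult *) (auto simp: mem_box_cart)
  with True show ?thesis by simp
qed (simp add: box_bump_zero)

section \<open>Translations, the Poincare inequality and compactness\<close>

lemma integrable_lborel_bounded_support:
  fixes f :: "'a::euclidean_space \<Rightarrow> real"
  assumes "f \<in> borel_measurable borel" "\<And>x. \<bar>f x\<bar> \<le> C" "\<And>x. f x \<noteq> 0 \<Longrightarrow> norm x \<le> R"
  shows "integrable lborel f"
proof (rule Bochner_Integration.integrable_bound)
  show "integrable lborel (\<lambda>x. C * indicator (cball (0 :: 'a) R) x :: real)"
    using emeasure_bounded_finite[OF bounded_cball, of "0 :: 'a" R]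
    by (intro integrable_mult_right) (simp add: integrable_indicator_iff)
  show "AE x in lborel. norm (f x) \<le> norm (C * indicator (cball 0 R) x)"
  proof (intro AE_I2)
    fix x show "norm (f x) \<le> norm (C * indicator (cball 0 R) x)"
      using assms(2)[of x] assms(3)[of x] by (cases "f x = 0") auto
  qed
qed (use assms(1) in simp)

text \<open>Moves functions supported in the domain to the whole space, where translations
  act.\<close>

lemma L2_inner_zero_outside:
  assumes "\<Omega> \<in> sets lebesgue" "\<And>x. x \<notin> \<Omega> \<Longrightarrow> f x = 0"
  shows "L2_inner \<Omega> f g = L2_inner UNIV f g"
proof -
  have "(\<lambda>x. indicator \<Omega> x *\<^sub>R (f x * g x)) = (\<lambda>x. f x * g x)"
    using assms(2) by (intro ext) (auto simp: indicator_def)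
  moreover have "(LINT x|lebesgue_on \<Omega>. f x * g x) = (LINT x|lebesgue. indicator \<Omega> x *\<^sub>R (f x * g x))"
    using assms(1) by (intro integral_restrict_space) auto
  ultimately show ?thesis
    unfolding L2_inner_def lebesgue_on_UNIV_eq by metis
qed

lemma L2_norm_zero_outside:
  "\<Omega> \<in> sets lebesgue \<Longrightarrow> (\<And>x. x \<notin> \<Omega> \<Longrightarrow> f x = 0) \<Longrightarrow> L2_norm \<Omega> f = L2_norm UNIV f"
  unfolding L2_norm_def using L2_inner_zero_outside by metis

text \<open>For Borel integrands the Lebesgue integral is that of \<open>lborel\<close>, where
  translation invariance and Fubini are applied.\<close>

lemma L2_inner_UNIV_borel:
  fixes f g :: "real^'n \<Rightarrow> real"
  assumes "(\<lambda>x. f x * g x) \<in> borel_measurable borel"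
  shows "L2_inner UNIV f g = (\<integral>x. f x * g x \<partial>lborel)"
  unfolding L2_inner_def lebesgue_on_UNIV_eq using assms by (intro integral_completion) simp

lemma L2_space_bounded_support:
  fixes f :: "real^'n::finite \<Rightarrow> real"
  assumes "f \<in> borel_measurable borel" "\<And>x. \<bar>f x\<bar> \<le> C" "\<And>x. f x \<noteq> 0 \<Longrightarrow> norm x \<le> R"
    and "\<Omega> \<in> sets lebesgue"
  shows "f \<in> L2_space \<Omega>"
proof -
  have meas: "f \<in> borel_measurable lebesgue" using assms(1) by (intro measurable_completion) simp
  have "integrable lborel (\<lambda>x. (f x)\<^sup>2)"
  proof (rule integrable_lborel_bounded_support)
    show "\<bar>(f x)\<^sup>2\<bar> \<le> C\<^sup>2" for x
      using power_mono[OF assms(2), of x 2] by simp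
  qed (use assms in auto)
  then have "integrable lebesgue (\<lambda>x. (f x)\<^sup>2)"
    using assms(1) by (subst integrable_completion) auto
  then have "integrable (lebesgue_on \<Omega>) (\<lambda>x. (f x)\<^sup>2)"
    using assms(4) by (subst integrable_restrict_space) (auto intro: integrable_mult_indicator simp del: real_scaleR_def)
  then show ?thesis
    using meas by (simp add: L2_space_def measurable_restrict_space1)
qed

lemma lborel_integral_translate:
  fixes f :: "'a::euclidean_space \<Rightarrow> real"
  assumes "f \<in> borel_measurable borel"
  shows "(\<integral>x. f (x + h) \<partial>lborel) = (\<integral>x. f x \<partial>lborel)"
proof -
  have "(\<integral>x. f x \<partial>lborel) = (\<integral>x. f x \<partial>distr lborel borel ((+) h))"
    by (simp add: lborel_distr_plus)
  also have "\<dots> = (\<integral>x. f (h + x) \<partial>lborel)"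
    using assms by (intro integral_distr) auto
  finally show ?thesis by (simp add: add.commute)
qed

section \<open>Difference quotients and integrals of test functions\<close>

lemma test_borel: "\<phi> \<in> test_functions \<Omega> \<Longrightarrow> \<phi> \<in> borel_measurable borel"
  by (intro borel_measurable_continuous_onI test_continuous_on)

lemma test_support:
  assumes "\<phi> \<in> test_functions \<Omega>"
  shows "\<exists>R\<ge>0. \<forall>x. \<phi> x \<noteq> 0 \<longrightarrow> norm x \<le> R"
proof -
  have "bounded (closure {x. \<phi> x \<noteq> 0})"
    using assms by (intro compact_imp_bounded) (simp add: test_functions_def)
  then obtain R where "\<forall>x\<in>closure {x. \<phi> x \<noteq> 0}. norm x \<le> R" by (auto simp: bounded_iff)
  then have "\<forall>x. \<phi> x \<noteq> 0 \<longrightarrow> norm x \<le> max R 0"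
    using closure_subset[of "{x. \<phi> x \<noteq> 0}"] by fastforce
  then show ?thesis by (intro exI[of _ "max R 0"]) auto
qed

lemma test_L2:
  assumes "\<phi> \<in> test_functions \<Omega>" "S \<in> sets lebesgue"
  shows "\<phi> \<in> L2_space S"
proof -
  obtain C R where "\<forall>x. \<bar>\<phi> x\<bar> \<le> C" "\<forall>x. \<phi> x \<noteq> 0 \<longrightarrow> norm x \<le> R"
    using test_bounded[OF assms(1)] test_support[OF assms(1)] by blast
  then show ?thesis
    by (intro L2_space_bounded_support[OF test_borel[OF assms(1)] _ _ assms(2)]) auto
qed

lemma test_integrable:
  assumes "\<phi> \<in> test_functions \<Omega>"
  shows "integrable lborel \<phi>"
proof -
  obtain C R where "\<forall>x. \<bar>\<phi> x\<bar> \<le> C" "\<forall>x. \<phi> x \<noteq> 0 \<longrightarrow> norm x \<le> R"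
    using test_bounded[OF assms] test_support[OF assms] by blast
  then show ?thesis
    by (intro integrable_lborel_bounded_support[OF test_borel[OF assms]]) auto
qed

definition directional :: "(real^'n::finite \<Rightarrow> real) \<Rightarrow> real^'n \<Rightarrow> real^'n \<Rightarrow> real" where
  "directional \<phi> h x = (\<Sum>i\<in>UNIV. h $ i * classical_partial i \<phi> x)"

lemma directional_scaleR: "directional \<phi> (c *\<^sub>R h) x = c * directional \<phi> h x"
  by (simp add: directional_def sum_distrib_left mult.assoc)

lemma directional_axis: "directional \<phi> (axis i 1) x = classical_partial i \<phi> x"
proof -
  have "directional \<phi> (axis i 1) x = (\<Sum>j\<in>UNIV. if j = i then classical_partial j \<phi> x else 0)"
    unfolding directional_def by (rule sum.cong) (auto simp: axis_def)
  then show ?thesis by simp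
qed

lemma directional_borel:
  "\<phi> \<in> test_functions \<Omega> \<Longrightarrow> directional \<phi> h \<in> borel_measurable borel"
  unfolding directional_def by (intro borel_measurable_sum borel_measurable_times test_borel[OF test_partial]) auto

lemma directional_bounded:
  assumes "\<phi> \<in> test_functions \<Omega>"
  shows "\<exists>C\<ge>0. \<forall>x. \<bar>directional \<phi> h x\<bar> \<le> C"
proof -
  obtain C where C: "\<And>i x. \<bar>classical_partial i \<phi> x\<bar> \<le> C i"
    using test_bounded[OF test_partial[OF assms]] by metis
  have "\<bar>directional \<phi> h x\<bar> \<le> (\<Sum>i\<in>UNIV. \<bar>h $ i\<bar> * C i)" for x
    unfolding directional_def
    by (rule order_trans[OF sum_abs], rule sum_mono) (simp add: abs_mult C mult_left_mono)
  moreover from this[of undefined] have "0 \<le> (\<Sum>i\<in>UNIV. \<bar>h $ i\<bar> * C i)" by linarith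
  ultimately show ?thesis by blast
qed

lemma directional_sq_le:
  "(directional \<phi> h x)\<^sup>2 \<le> (norm h)\<^sup>2 * (\<Sum>i\<in>UNIV. (classical_partial i \<phi> x)\<^sup>2)"
proof -
  have "(directional \<phi> h x)\<^sup>2 \<le> (\<Sum>i\<in>UNIV. (h $ i)\<^sup>2) * (\<Sum>i\<in>UNIV. (classical_partial i \<phi> x)\<^sup>2)"
    unfolding directional_def by (rule Cauchy_Schwarz_ineq_sum)
  also have "(\<Sum>i\<in>UNIV. (h $ i)\<^sup>2) = (norm h)\<^sup>2"
    by (simp add: norm_vec_def L2_set_def sum_nonneg)
  finally show ?thesis .
qed

lemma smooth_line_derivative:
  assumes "smooth \<phi>"
  shows "((\<lambda>t. \<phi> (x + t *\<^sub>R h)) has_real_derivative directional \<phi> h (x + t *\<^sub>R h)) (at t)"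
proof -
  have "((\<lambda>t. x + t *\<^sub>R h) has_derivative (\<lambda>s. s *\<^sub>R h)) (at t)"
    by (auto intro!: derivative_eq_intros)
  from has_derivative_compose[OF this smooth_has_derivative[OF assms]]
  have "((\<lambda>t. \<phi> (x + t *\<^sub>R h)) has_derivative (\<lambda>s. directional \<phi> (s *\<^sub>R h) (x + t *\<^sub>R h))) (at t)"
    by (simp add: directional_def)
  then show ?thesis
    by (simp add: directional_scaleR has_field_derivative_def mult_commute_abs)
qed

text \<open>The step 1/n, instead of a real variable, gives a sequence to which dominated
  convergence applies. At \<open>n = 0\<close> the leading factor makes it vanish.\<close>

definition difference_quotient :: "(real^'n \<Rightarrow> real) \<Rightarrow> real^'n \<Rightarrow> nat \<Rightarrow> real^'n \<Rightarrow> real" where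
  "difference_quotient \<phi> h n x = real n * (\<phi> (x + (1 / real n) *\<^sub>R h) - \<phi> x)"

lemma difference_quotient_tendsto:
  assumes "smooth \<phi>"
  shows "(\<lambda>n. difference_quotient \<phi> h n x) \<longlonglongrightarrow> directional \<phi> h x"
proof -
  have "((\<lambda>t. (\<phi> (x + t *\<^sub>R h) - \<phi> x) / t) \<longlongrightarrow> directional \<phi> h x) (at 0)"
    using smooth_line_derivative[OF assms, of x h 0] by (simp add: DERIV_def)
  moreover have "filterlim (\<lambda>n. 1 / real n) (at 0) sequentially"
    unfolding filterlim_at
    using eventually_gt_at_top[of "0::nat"] lim_1_over_n by (auto elim: eventually_mono)
  ultimately have "(\<lambda>n. (\<phi> (x + (1 / real n) *\<^sub>R h) - \<phi> x) / (1 / real n)) \<longlonglongrightarrow> directional \<phi> h x"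
    by (rule filterlim_compose)
  then show ?thesis by (simp add: difference_quotient_def mult.commute)
qed

text \<open>The mean value theorem on the segment bounds the quotient by the directional derivative,
  and a step of length at most \<open>norm h\<close> enlarges the support by no more than that.
  Uniformity in n provides the dominating function.\<close>

lemma difference_quotient_bounded:
  assumes "\<phi> \<in> test_functions \<Omega>"
  shows "\<exists>C\<ge>0. \<exists>R. \<forall>n x. \<bar>difference_quotient \<phi> h n x\<bar> \<le> C * indicator (cball 0 R) x"
proof -
  obtain C where C: "C \<ge> 0" "\<And>x. \<bar>directional \<phi> h x\<bar> \<le> C"
    using directional_bounded[OF assms] by blast
  obtain R where R: "\<And>x. \<phi> x \<noteq> 0 \<Longrightarrow> norm x \<le> R"
    using test_support[OF assms] by blast
  have "\<bar>difference_quotient \<phi> h n x\<bar> \<le> C * indicator (cball 0 (R + norm h)) x" for n x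
  proof (cases "n = 0 \<or> difference_quotient \<phi> h n x = 0")
    case True
    then show ?thesis using C(1) by (auto simp: difference_quotient_def)
  next
    case False
    then have n: "real n > 0" "real n \<ge> 1" by auto
    have "norm (\<phi> (x + (1 / real n) *\<^sub>R h) - \<phi> (x + 0 *\<^sub>R h)) \<le> C * norm (1 / real n - 0)"
      by (rule field_differentiable_bound[where S = UNIV and f' = "\<lambda>t. directional \<phi> h (x + t *\<^sub>R h)"])
         (use smooth_line_derivative[OF test_smooth[OF assms]] C in auto)
    then have "real n * \<bar>\<phi> (x + (1 / real n) *\<^sub>R h) - \<phi> x\<bar> \<le> C"
      using n by (simp add: pos_le_divide_eq mult.commute)
    then have "\<bar>difference_quotient \<phi> h n x\<bar> \<le> C"
      by (simp add: difference_quotient_def abs_mult)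
    moreover have "norm x \<le> R + norm h"
    proof -
      have "\<phi> x \<noteq> 0 \<or> \<phi> (x + (1 / real n) *\<^sub>R h) \<noteq> 0"
        using False by (auto simp: difference_quotient_def)
      then have "norm x \<le> R \<or> norm (x + (1 / real n) *\<^sub>R h) \<le> R" using R by blast
      moreover have "norm x \<le> norm (x + (1 / real n) *\<^sub>R h) + norm ((1 / real n) *\<^sub>R h)"
        using norm_triangle_ineq4[of "x + (1 / real n) *\<^sub>R h" "(1 / real n) *\<^sub>R h"] by simp
      moreover have "norm ((1 / real n) *\<^sub>R h) \<le> norm h"
        using n mult_right_mono[of "1 / real n" 1 "norm h"] by simp
      ultimately show ?thesis using norm_ge_zero[of h] by linarith
    qed
    ultimately show ?thesis by simp
  qed
  with C(1) show ?thesis by blast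
qed

lemma difference_quotient_borel:
  assumes "\<phi> \<in> test_functions \<Omega>"
  shows "difference_quotient \<phi> h n \<in> borel_measurable borel"
proof -
  have [measurable]: "\<phi> \<in> borel_measurable borel" by (rule test_borel[OF assms])
  show ?thesis unfolding difference_quotient_def by measurable
qed

text \<open>Serves two exponents: 1 for the vanishing integral of a derivative, 2 for the
  translation estimate. A positive exponent keeps the powers zero outside the ball, hence
  integrable.\<close>

lemma difference_quotient_integral_tendsto:
  fixes \<phi> :: "real^'n::finite \<Rightarrow> real"
  assumes "\<phi> \<in> test_functions \<Omega>"
  shows "(\<lambda>n. \<integral>x. (difference_quotient \<phi> h n x) ^ Suc k \<partial>lborel)
    \<longlonglongrightarrow> (\<integral>x. (directional \<phi> h x) ^ Suc k \<partial>lborel)"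
proof -
  obtain C R where C: "C \<ge> 0"
    and bound: "\<And>n x. \<bar>difference_quotient \<phi> h n x\<bar> \<le> C * indicator (cball 0 R) x"
    using difference_quotient_bounded[OF assms, of h] by blast
  note [measurable] = difference_quotient_borel[OF assms] directional_borel[OF assms]
  show ?thesis
  proof (rule integral_dominated_convergence[where w = "\<lambda>x. C ^ Suc k * indicator (cball 0 R) x"])
    show "integrable lborel (\<lambda>x. C ^ Suc k * indicator (cball (0 :: real^'n) R) x :: real)"
      using emeasure_bounded_finite[OF bounded_cball, of "0 :: real^'n" R]
      by (intro integrable_mult_right) (simp add: integrable_indicator_iff)
    show "AE x in lborel. (\<lambda>n. (difference_quotient \<phi> h n x) ^ Suc k) \<longlonglongrightarrow> (directional \<phi> h x) ^ Suc k"
      by (intro AE_I2 tendsto_power difference_quotient_tendsto test_smooth[OF assms])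
    show "AE x in lborel. norm ((difference_quotient \<phi> h n x) ^ Suc k) \<le> C ^ Suc k * indicator (cball 0 R) x" for n
    proof (intro AE_I2)
      fix x
      have "norm ((difference_quotient \<phi> h n x) ^ Suc k) \<le> (C * indicator (cball 0 R) x) ^ Suc k"
        unfolding norm_power using bound[of n x] by (intro power_mono) auto
      also have "\<dots> = C ^ Suc k * indicator (cball 0 R) x"
        by (auto simp: indicator_def)
      finally show "norm ((difference_quotient \<phi> h n x) ^ Suc k) \<le> C ^ Suc k * indicator (cball 0 R) x" .
    qed
  qed measurable
qed

text \<open>Translation invariance makes every difference quotient integrate to zero, and the limit
  inherits this.\<close>

lemma integral_partial_zero:
  assumes "\<phi> \<in> test_functions \<Omega>"
  shows "(\<integral>x. classical_partial i \<phi> x \<partial>lborel) = 0"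
proof -
  have int: "integrable lborel \<phi>" by (rule test_integrable[OF assms])
  note [measurable] = test_borel[OF assms]
  have "(\<integral>x. (difference_quotient \<phi> (axis i 1) n x) ^ Suc 0 \<partial>lborel) = 0" for n
  proof -
    have tr: "(\<integral>x. \<phi> (x + c) \<partial>lborel) = (\<integral>x. \<phi> x \<partial>lborel)" for c
      by (rule lborel_integral_translate) measurable
    have "integrable lborel (\<lambda>x. \<phi> (x + c))" for c
    proof -
      have "integrable (distr lborel borel ((+) c)) \<phi>" using int by (simp add: lborel_distr_plus)
      then show ?thesis by (subst (asm) integrable_distr_eq) (auto simp: add.commute)
    qed
    then show ?thesis
      by (simp add: difference_quotient_def int tr)
  qed
  then have "(\<integral>x. (directional \<phi> (axis i 1) x) ^ Suc 0 \<partial>lborel) = 0"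
    using difference_quotient_integral_tendsto[OF assms, of "axis i 1" 0]
    by (simp add: LIMSEQ_const_iff)
  then show ?thesis by (simp add: directional_axis)
qed

text \<open>Integration by parts: the product of u and \<open>\<phi>\<close> is again a test
  function, so its partial derivative integrates to zero.\<close>

lemma test_has_weak_partial:
  assumes "u \<in> test_functions \<Omega>" "\<Omega> \<in> sets lebesgue"
  shows "has_weak_partial \<Omega> i u (classical_partial i u)"
  unfolding has_weak_partial_def
proof
  fix \<phi> assume \<phi>: "\<phi> \<in> test_functions \<Omega>"
  note smooth = test_smooth[OF \<phi>] test_smooth[OF assms(1)]
  have prod: "classical_partial i (\<lambda>x. u x * \<phi> x) x
      = u x * classical_partial i \<phi> x + classical_partial i u x * \<phi> x" for x
    by (intro partial_add_mult smooth_differentiable smooth)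
  have "(\<integral>x. u x * classical_partial i \<phi> x + classical_partial i u x * \<phi> x \<partial>lborel) = 0"
    using integral_partial_zero[OF test_mult[OF assms(1) smooth(1)], of i] by (simp add: prod)
  moreover have "integrable lborel (\<lambda>x. u x * classical_partial i \<phi> x)"
    by (rule test_integrable[OF test_mult[OF assms(1) smooth_partial[OF smooth(1)]]])
  moreover have "integrable lborel (\<lambda>x. classical_partial i u x * \<phi> x)"
    by (rule test_integrable[OF test_mult[OF test_partial[OF assms(1)] smooth(1)]])
  ultimately have "(\<integral>x. u x * classical_partial i \<phi> x \<partial>lborel) + (\<integral>x. classical_partial i u x * \<phi> x \<partial>lborel) = 0"
    by simp
  moreover have "L2_inner \<Omega> u (classical_partial i \<phi>) = (\<integral>x. u x * classical_partial i \<phi> x \<partial>lborel)"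
    using L2_inner_zero_outside[OF assms(2), of u] test_zero_outside[OF assms(1)]
      test_borel[OF assms(1)] test_borel[OF test_partial[OF \<phi>, of i]]
    by (simp add: L2_inner_UNIV_borel)
  moreover have "L2_inner \<Omega> (classical_partial i u) \<phi> = (\<integral>x. classical_partial i u x * \<phi> x \<partial>lborel)"
    using L2_inner_zero_outside[OF assms(2), of "classical_partial i u"] test_zero_outside[OF test_partial[OF assms(1)]]
      test_borel[OF test_partial[OF assms(1), of i]] test_borel[OF \<phi>]
    by (simp add: L2_inner_UNIV_borel)
  ultimately show "L2_inner \<Omega> u (classical_partial i \<phi>) = - L2_inner \<Omega> (classical_partial i u) \<phi>"
    by linarith
qed

section \<open>Translation estimate and Poincare inequality\<close>

lemma L2_norm_translate:
  fixes f :: "real^'n::finite \<Rightarrow> real"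
  assumes "f \<in> borel_measurable borel"
  shows "L2_norm UNIV (\<lambda>x. f (x + h)) = L2_norm UNIV f"
proof -
  note [measurable] = assms
  have "L2_inner UNIV (\<lambda>x. f (x + h)) (\<lambda>x. f (x + h)) = (\<integral>x. f (x + h) * f (x + h) \<partial>lborel)"
    by (rule L2_inner_UNIV_borel) measurable
  also have "\<dots> = (\<integral>x. f x * f x \<partial>lborel)"
    by (rule lborel_integral_translate[where f = "\<lambda>x. f x * f x"]) measurable
  also have "\<dots> = L2_inner UNIV f f"
    by (rule L2_inner_UNIV_borel[symmetric]) measurable
  finally show ?thesis by (simp add: L2_norm_def)
qed

lemma translate_L2:
  fixes \<phi> :: "real^'n::finite \<Rightarrow> real"
  assumes "\<phi> \<in> test_functions \<Omega>"
  shows "(\<lambda>x. \<phi> (x + h)) \<in> L2_space UNIV"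
proof -
  obtain C R where C: "\<And>x. \<bar>\<phi> x\<bar> \<le> C" and R: "\<And>x. \<phi> x \<noteq> 0 \<Longrightarrow> norm x \<le> R"
    using test_bounded[OF assms] test_support[OF assms] by blast
  note [measurable] = test_borel[OF assms]
  show ?thesis
  proof (rule L2_space_bounded_support)
    show "\<bar>\<phi> (x + h)\<bar> \<le> C" for x by (rule C)
    show "norm x \<le> R + norm h" if "\<phi> (x + h) \<noteq> 0" for x
      using R[OF that] norm_triangle_ineq4[of "x + h" h] by simp
  qed auto
qed

text \<open>Subadditivity of \<open>h \<mapsto> \<parallel>\<phi>(\<cdot> + h) - \<phi>\<parallel>\<close> bounds it by \<open>n \<parallel>\<phi>(\<cdot> + h/n) - \<phi>\<parallel>\<close>, which tends to the
  norm of the derivative in direction \<open>h\<close>.\<close>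

lemma translation_estimate:
  assumes \<phi>: "\<phi> \<in> test_functions \<Omega>" and \<Omega>: "\<Omega> \<in> sets lebesgue"
  shows "L2_norm UNIV (\<lambda>x. \<phi> (x + h) - \<phi> x) \<le> norm h * L2m_norm \<Omega> (\<lambda>i. classical_partial i \<phi>)"
proof -
  note [measurable] = test_borel[OF \<phi>]
  have step: "L2_norm UNIV (\<lambda>x. \<phi> (x + real n *\<^sub>R k) - \<phi> x) \<le> real n * L2_norm UNIV (\<lambda>x. \<phi> (x + k) - \<phi> x)"
    for n k
  proof (induction n)
    case 0
    then show ?case by (simp add: L2_norm_def L2_inner_def)
  next
    case (Suc n)
    have "L2_norm UNIV (\<lambda>x. \<phi> (x + real (Suc n) *\<^sub>R k) - \<phi> x)
        = L2_norm UNIV (\<lambda>x. (\<phi> ((x + k) + real n *\<^sub>R k) - \<phi> (x + k)) + (\<phi> (x + k) - \<phi> x))"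
      by (simp add: algebra_simps)
    also have "\<dots> \<le> L2_norm UNIV (\<lambda>x. \<phi> ((x + k) + real n *\<^sub>R k) - \<phi> (x + k))
        + L2_norm UNIV (\<lambda>x. \<phi> (x + k) - \<phi> x)"
      using translate_L2[OF \<phi>, of "k + real n *\<^sub>R k"] translate_L2[OF \<phi>, of k] translate_L2[OF \<phi>, of 0]
      by (intro L2_norm_triangle L2_diff) (simp_all add: algebra_simps)
    also have "L2_norm UNIV (\<lambda>x. \<phi> ((x + k) + real n *\<^sub>R k) - \<phi> (x + k))
        = L2_norm UNIV (\<lambda>x. \<phi> (x + real n *\<^sub>R k) - \<phi> x)"
      by (rule L2_norm_translate[where f = "\<lambda>x. \<phi> (x + real n *\<^sub>R k) - \<phi> x"]) measurable
    finally show ?case using Suc.IH by (simp add: distrib_right)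
  qed
  have le: "L2_norm UNIV (\<lambda>x. \<phi> (x + h) - \<phi> x) \<le> sqrt (\<integral>x. (difference_quotient \<phi> h n x)\<^sup>2 \<partial>lborel)"
    if "n > 0" for n
  proof -
    have "L2_norm UNIV (\<lambda>x. \<phi> (x + h) - \<phi> x) \<le> real n * L2_norm UNIV (\<lambda>x. \<phi> (x + (1 / real n) *\<^sub>R h) - \<phi> x)"
      using step[of n "(1 / real n) *\<^sub>R h"] that by simp
    also have "\<dots> = L2_norm UNIV (difference_quotient \<phi> h n)"
      unfolding difference_quotient_def[abs_def] by (subst L2_norm_cmult) simp
    also have "\<dots> = sqrt (\<integral>x. (difference_quotient \<phi> h n x)\<^sup>2 \<partial>lborel)"
      unfolding L2_norm_def using difference_quotient_borel[OF \<phi>]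
      by (subst L2_inner_UNIV_borel) (auto simp: power2_eq_square)
    finally show ?thesis .
  qed
  have "(\<lambda>n. sqrt (\<integral>x. (difference_quotient \<phi> h n x)\<^sup>2 \<partial>lborel)) \<longlonglongrightarrow> sqrt (\<integral>x. (directional \<phi> h x)\<^sup>2 \<partial>lborel)"
    using difference_quotient_integral_tendsto[OF \<phi>, of h 1]
    by (intro tendsto_real_sqrt) (simp add: numeral_2_eq_2)
  then have "L2_norm UNIV (\<lambda>x. \<phi> (x + h) - \<phi> x) \<le> sqrt (\<integral>x. (directional \<phi> h x)\<^sup>2 \<partial>lborel)"
    using le by (intro LIMSEQ_le_const) (auto intro: exI[of _ 1])
  also have "\<dots> \<le> sqrt ((norm h)\<^sup>2 * L2m_inner \<Omega> (\<lambda>i. classical_partial i \<phi>) (\<lambda>i. classical_partial i \<phi>))"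
  proof (rule real_sqrt_le_mono)
    have int: "integrable lborel (\<lambda>x. (classical_partial i \<phi> x)\<^sup>2)" for i
      using test_integrable[OF test_mult[OF test_partial[OF \<phi>] smooth_partial[OF test_smooth[OF \<phi>]]], of i i]
      by (simp add: power2_eq_square)
    have eq: "(\<integral>x. (classical_partial i \<phi> x)\<^sup>2 \<partial>lborel) = L2_inner \<Omega> (classical_partial i \<phi>) (classical_partial i \<phi>)" for i
      using test_borel[OF test_partial[OF \<phi>, of i]] test_zero_outside[OF test_partial[OF \<phi>]]
      by (simp add: L2_inner_zero_outside[OF \<Omega>] L2_inner_UNIV_borel power2_eq_square)
    have "(\<integral>x. (directional \<phi> h x)\<^sup>2 \<partial>lborel)
        \<le> (\<integral>x. (norm h)\<^sup>2 * (\<Sum>i\<in>UNIV. (classical_partial i \<phi> x)\<^sup>2) \<partial>lborel)"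
      by (rule integral_mono') (use int directional_sq_le[of \<phi> h] in \<open>auto intro!: mult_nonneg_nonneg sum_nonneg\<close>)
    also have "\<dots> = (norm h)\<^sup>2 * (\<Sum>i\<in>UNIV. \<integral>x. (classical_partial i \<phi> x)\<^sup>2 \<partial>lborel)"
      using int by simp
    finally show "(\<integral>x. (directional \<phi> h x)\<^sup>2 \<partial>lborel)
        \<le> (norm h)\<^sup>2 * L2m_inner \<Omega> (\<lambda>i. classical_partial i \<phi>) (\<lambda>i. classical_partial i \<phi>)"
      by (simp add: L2m_inner_def eq)
  qed
  finally show ?thesis by (simp add: real_sqrt_mult L2m_norm_def)
qed

text \<open>A translation by more than the diameter makes the supports disjoint, so the translation estimate
  contains the Poincare inequality.\<close>

lemma Poincare_test:
  fixes \<Omega> :: "(real^'n::finite) set"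
  assumes "bounded \<Omega>" "\<Omega> \<in> sets lebesgue"
  shows "\<exists>C\<ge>0. \<forall>\<phi>\<in>test_functions \<Omega>. L2_norm \<Omega> \<phi> \<le> C * L2m_norm \<Omega> (\<lambda>i. classical_partial i \<phi>)"
proof -
  obtain R where R: "R > 0" "\<And>x. x \<in> \<Omega> \<Longrightarrow> norm x \<le> R"
    using assms(1) by (auto simp: bounded_pos)
  \<comment> \<open>Any coordinate direction will do; the length \<open>2 * R + 1\<close> exceeds
    the distance of any two points of the ball of radius R that contains the domain.\<close>
  define h :: "real^'n" where "h = (2 * R + 1) *\<^sub>R axis undefined 1"
  have norm_h: "norm h = 2 * R + 1" using R(1) by (simp add: h_def)
  show ?thesis
  proof (intro exI[of _ "2 * R + 1"] conjI ballI)
    fix \<phi> assume \<phi>: "\<phi> \<in> test_functions \<Omega>"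
    note [measurable] = test_borel[OF \<phi>]
    have disj: "\<phi> (x + h) * \<phi> x = 0" for x
    proof (rule ccontr)
      assume "\<phi> (x + h) * \<phi> x \<noteq> 0"
      then have "norm (x + h) \<le> R" "norm x \<le> R" using test_zero_outside[OF \<phi>] R(2) by auto
      then show False using norm_triangle_ineq4[of "x + h" x] norm_h by simp
    qed
    have "L2_inner UNIV \<phi> \<phi> \<le> L2_inner UNIV (\<lambda>x. \<phi> (x + h) - \<phi> x) (\<lambda>x. \<phi> (x + h) - \<phi> x)"
      unfolding L2_inner_def
    proof (rule integral_mono)
      show "integrable (lebesgue_on UNIV) (\<lambda>x. \<phi> x * \<phi> x)"
        by (intro L2_integrable_mult test_L2[OF \<phi>]) auto
      show "integrable (lebesgue_on UNIV) (\<lambda>x. (\<phi> (x + h) - \<phi> x) * (\<phi> (x + h) - \<phi> x))"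
        by (intro L2_integrable_mult L2_diff test_L2[OF \<phi>] translate_L2[OF \<phi>]) auto
      show "\<phi> x * \<phi> x \<le> (\<phi> (x + h) - \<phi> x) * (\<phi> (x + h) - \<phi> x)" for x
        \<comment> \<open>The mixed term of the square vanishes, and the remaining squares are
          nonnegative.\<close>
        using disj[of x] by auto
    qed
    then have "L2_norm UNIV \<phi> \<le> L2_norm UNIV (\<lambda>x. \<phi> (x + h) - \<phi> x)"
      by (simp add: L2_norm_def)
    also have "\<dots> \<le> norm h * L2m_norm \<Omega> (\<lambda>i. classical_partial i \<phi>)"
      by (rule translation_estimate[OF \<phi> assms(2)])
    finally show "L2_norm \<Omega> \<phi> \<le> (2 * R + 1) * L2m_norm \<Omega> (\<lambda>i. classical_partial i \<phi>)"
      using L2_norm_zero_outside[OF assms(2), of \<phi>] test_zero_outside[OF \<phi>] norm_h by simp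
  qed (use R(1) in simp)
qed

section \<open>Functions orthogonal to all test functions\<close>

lemma integrable_zero_outside:
  fixes f :: "'a::euclidean_space \<Rightarrow> real"
  assumes "\<Omega> \<in> sets lebesgue" "\<And>x. x \<notin> \<Omega> \<Longrightarrow> f x = 0"
  shows "integrable (lebesgue_on \<Omega>) f \<longleftrightarrow> integrable lebesgue f"
proof -
  have "(\<lambda>x. indicator \<Omega> x *\<^sub>R f x) = f"
  proof
    fix x show "indicator \<Omega> x *\<^sub>R f x = f x" using assms(2)[of x] by (cases "x \<in> \<Omega>") auto
  qed
  then show ?thesis
    using assms(1) by (subst integrable_restrict_space) auto
qed

text \<open>Fubini on \<open>lborel\<close> asks for a Borel function on the whole space, whereas
  elements of \<open>L2_space\<close> are Lebesgue measurable on the domain and arbitrary outside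
  it.\<close>

lemma L2_borel_representative:
  fixes v :: "real^'n::finite \<Rightarrow> real"
  assumes "v \<in> L2_space \<Omega>" "open \<Omega>"
  obtains w where "w \<in> borel_measurable borel" "\<And>x. x \<notin> \<Omega> \<Longrightarrow> w x = 0"
    "AE x in lebesgue_on \<Omega>. v x = w x" "w \<in> L2_space \<Omega>"
proof -
  have \<Omega>: "\<Omega> \<in> sets lebesgue" "\<Omega> \<in> sets borel" using assms(2) by auto
  have "(\<lambda>x. if x \<in> \<Omega> then v x else 0) \<in> borel_measurable lebesgue"
    using L2_measurable[OF assms(1)] \<Omega> by (simp add: borel_measurable_if)
  then obtain w0 where w0: "w0 \<in> borel_measurable lborel" "AE x in lborel. (if x \<in> \<Omega> then v x else 0) = w0 x"
    using completion_ex_borel_measurable_real by blast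
  define w where "w x = (if x \<in> \<Omega> then w0 x else 0)" for x
  have w: "w \<in> borel_measurable borel"
    unfolding w_def using w0(1) \<Omega>(2) by (intro measurable_If_set) auto
  have "AE x in lebesgue. x \<in> \<Omega> \<longrightarrow> v x = w x"
    using AE_completion[OF w0(2)] by eventually_elim (auto simp: w_def)
  then have ae: "AE x in lebesgue_on \<Omega>. v x = w x"
    using \<Omega>(1) by (subst AE_restrict_space_iff) auto
  have "w \<in> borel_measurable (lebesgue_on \<Omega>)"
    using w by (intro measurable_restrict_space1 measurable_completion) simp
  then have "w \<in> L2_space \<Omega>"
    by (rule L2_bound[OF assms(1), where C = 1]) (use ae in \<open>eventually_elim, simp\<close>)
  with w ae show ?thesis by (intro that[of w]) (auto simp: w_def)
qed

lemma L2_inner_cong_AE_L2: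
  assumes "u \<in> L2_space \<Omega>" "u' \<in> L2_space \<Omega>" "v \<in> L2_space \<Omega>" "AE x in lebesgue_on \<Omega>. u x = u' x"
  shows "L2_inner \<Omega> u v = L2_inner \<Omega> u' v"
  by (rule L2_inner_cong_AE) (use assms L2_measurable in auto)

lemma L2_indicator:
  assumes "S \<in> sets borel" "bounded S" "\<Omega> \<in> sets lebesgue"
  shows "(indicator S :: real^'n::finite \<Rightarrow> real) \<in> L2_space \<Omega>"
proof -
  obtain R where "\<And>x. x \<in> S \<Longrightarrow> norm x \<le> R" using assms(2) by (auto simp: bounded_iff)
  then show ?thesis
    by (intro L2_space_bounded_support[where C = 1 and R = R])
       (use assms in \<open>auto simp: indicator_def split: if_splits\<close>)
qed

lemma L2_const:
  assumes "bounded \<Omega>" "open \<Omega>"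
  shows "(\<lambda>x::real^'n::finite. c) \<in> L2_space \<Omega>"
proof (rule L2_bound[OF L2_indicator[OF _ assms(1), of \<Omega>], where C = "\<bar>c\<bar>"])
  show "AE x in lebesgue_on \<Omega>. \<bar>c\<bar> \<le> \<bar>c\<bar> * \<bar>indicat_real \<Omega> x\<bar>"
    using assms(2) by (intro AE_I2) simp
qed (use assms in auto)

lemma L2_imp_integrable:
  assumes "u \<in> L2_space \<Omega>" "bounded \<Omega>" "open \<Omega>"
  shows "integrable (lebesgue_on \<Omega>) (u :: real^'n::finite \<Rightarrow> real)"
  using L2_integrable_mult[OF assms(1) L2_const[OF assms(2,3), of 1]] by simp

text \<open>Open boxes form an intersection-stable generator of the Borel sets, so the integral of H
  vanishes over every Borel set, in particular over the sets where H is positive or negative. The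
  integral over the whole space is assumed separately because the complement step uses it.\<close>

lemma AE_zero_if_integral_box_zero:
  fixes H :: "real^'n::finite \<Rightarrow> real"
  assumes int: "integrable lborel H" and UNIV: "(\<integral>x. H x \<partial>lborel) = 0"
    and box: "\<And>a b. (\<integral>x. H x * indicator (box a b) x \<partial>lborel) = 0"
  shows "AE x in lborel. H x = 0"
proof -
  have int_ind: "integrable lborel (\<lambda>x. H x * indicator A x)" if "A \<in> sets borel" for A
    using integrable_mult_indicator[OF _ int, of A] that by (simp add: mult.commute)
  have zero: "(\<integral>x. H x * indicator A x \<partial>lborel) = 0" if A: "A \<in> sets borel" for A
  proof -
    let ?G = "range (\<lambda>(a, b). box a b) :: (real^'n) set set"
    have sig: "sigma_sets UNIV ?G = sets borel" unfolding borel_eq_box by simp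
    have "Int_stable ?G" by (auto simp: Int_stable_def box_Int_box)
    moreover have "?G \<subseteq> Pow UNIV" by auto
    moreover have "A \<in> sigma_sets UNIV ?G" using A sig by simp
    ultimately show ?thesis
    proof (induction rule: sigma_sets_induct_disjoint)
      case (basic A)
      then show ?case using box by auto
    next
      case (compl A)
      then have A: "A \<in> sets borel" unfolding sig by simp
      have "(\<lambda>x. H x * indicator (UNIV - A) x) = (\<lambda>x. H x - H x * indicator A x)"
        by (auto simp: indicator_def)
      then show ?case using compl int int_ind[OF A] UNIV by simp
    next
      case (union A)
      then have A: "A i \<in> sets borel" for i unfolding sig by auto
      have "(\<lambda>i. \<integral>x. H x * indicator (\<Union>j<i. A j) x \<partial>lborel) \<longlonglongrightarrow> (\<integral>x. H x * indicator (\<Union>i. A i) x \<partial>lborel)"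
      proof (rule integral_dominated_convergence[where w = "\<lambda>x. \<bar>H x\<bar>"])
        show "AE x in lborel. (\<lambda>i. H x * indicator (\<Union>j<i. A j) x) \<longlonglongrightarrow> H x * indicator (\<Union>i. A i) x"
          by (intro AE_I2 tendsto_mult tendsto_const LIMSEQ_indicator_UN)
        show "AE x in lborel. norm (H x * indicator (\<Union>j<i. A j) x) \<le> \<bar>H x\<bar>" for i
          by (intro AE_I2) (auto simp: indicator_def)
      qed (use int int_ind A in \<open>auto intro!: borel_measurable_integrable\<close>)
      moreover have "(\<integral>x. H x * indicator (\<Union>j<i. A j) x \<partial>lborel) = 0" for i
      proof (induction i)
        case (Suc i)
        have "A i \<inter> A j = {}" if "j < i" for j
          using union(1) that unfolding disjoint_family_on_def by (metis UNIV_I less_irrefl)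
        then have "A i \<inter> (\<Union>j<i. A j) = {}" by blast
        then have "(\<lambda>x. H x * indicator (\<Union>j<Suc i. A j) x)
            = (\<lambda>x. H x * indicator (\<Union>j<i. A j) x + H x * indicator (A i) x)"
          by (intro ext) (auto simp: indicator_def lessThan_Suc)
        then show ?case
          using Suc int_ind[OF A] int_ind[of "\<Union>j<i. A j"] A union(3) by simp
      qed simp
      ultimately show ?case by (simp add: LIMSEQ_const_iff)
    qed simp
  qed
  have [measurable]: "H \<in> borel_measurable borel" using borel_measurable_integrable[OF int] by simp
  have pos: "{x. H x > 0} \<in> sets borel" and neg: "{x. H x < 0} \<in> sets borel" by measurable
  have "AE x in lborel. H x * indicator {x. H x > 0} x = 0"
    using zero[OF pos] integral_nonneg_eq_0_iff_AE[OF int_ind[OF pos]] by (auto simp: indicator_def)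
  moreover have "AE x in lborel. - (H x * indicator {x. H x < 0} x) = 0"
    using zero[OF neg] integral_nonneg_eq_0_iff_AE[OF integrable_minus[OF int_ind[OF neg]]]
    by (auto simp: indicator_def)
  ultimately show ?thesis
    by eventually_elim (auto simp: indicator_def split: if_splits)
qed

text \<open>Bumps turn orthogonality into vanishing integrals over boxes, but only over boxes whose
  closure lies in the domain. The argument is therefore localised to one closed box at a time, and
  countably many of them cover the domain.\<close>

lemma orthogonal_to_test_functions:
  fixes v :: "real^'n::finite \<Rightarrow> real"
  assumes v: "v \<in> L2_space \<Omega>" and \<Omega>: "open \<Omega>"
    and orth: "\<And>\<phi>. \<phi> \<in> test_functions \<Omega> \<Longrightarrow> L2_inner \<Omega> v \<phi> = 0"
  shows "AE x in lebesgue_on \<Omega>. v x = 0"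
proof -
  have leb: "\<Omega> \<in> sets lebesgue" using \<Omega> by auto
  obtain w where w: "w \<in> borel_measurable borel" "\<And>x. x \<notin> \<Omega> \<Longrightarrow> w x = 0"
    "AE x in lebesgue_on \<Omega>. v x = w x" "w \<in> L2_space \<Omega>"
    using L2_borel_representative[OF v \<Omega>] by blast
  note [measurable] = w(1)
  have inner_w: "L2_inner \<Omega> w g = (\<integral>x. w x * g x \<partial>lborel)" if [measurable]: "g \<in> borel_measurable borel" for g
    by (rule trans[OF L2_inner_zero_outside[OF leb] L2_inner_UNIV_borel]) (simp_all add: w(2))
  have orth_w: "L2_inner \<Omega> w \<phi> = 0" if "\<phi> \<in> test_functions \<Omega>" for \<phi>
    using L2_inner_cong_AE_L2[OF v w(4) test_L2[OF that leb] w(3)] orth[OF that] by simp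
  have box0: "(\<integral>x. w x * indicator (box a b) x \<partial>lborel) = 0" if "cbox a b \<subseteq> \<Omega>" for a b
  proof -
    have "(\<lambda>n. L2_inner \<Omega> w (box_bump n a b)) \<longlonglongrightarrow> L2_inner \<Omega> w (indicator (box a b))"
    proof (rule L2_inner_tendsto_AE[OF _ L2_indicator[of "box a b"] w(4)])
      show "box_bump n a b \<in> L2_space \<Omega>" for n by (rule test_L2[OF test_box_bump[OF that] leb])
      show "AE x in lebesgue_on \<Omega>. (\<lambda>n. box_bump n a b x) \<longlonglongrightarrow> indicat_real (box a b) x"
        by (intro AE_I2 box_bump_tendsto)
      show "indicat_real (box a b) \<in> borel_measurable (lebesgue_on \<Omega>)"
        by (rule L2_measurable[OF L2_indicator[OF _ bounded_box leb]]) simp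
      show "AE x in lebesgue_on \<Omega>. \<bar>box_bump n a b x\<bar> \<le> \<bar>indicat_real (box a b) x\<bar>" for n
        using box_bump_range[of n a b] box_bump_zero[of _ a b n]
        by (intro AE_I2) (auto simp: indicator_def)
    qed (use leb in auto)
    then show ?thesis
      using orth_w[OF test_box_bump[OF that]] by (simp add: LIMSEQ_const_iff inner_w)
  qed
  have cbox0: "AE x in lborel. x \<in> cbox c d \<longrightarrow> w x = 0" if sub: "cbox c d \<subseteq> \<Omega>" for c d
  proof -
    have "AE x in lborel. w x * indicator (box c d) x = 0"
    proof (rule AE_zero_if_integral_box_zero)
      have "integrable (lebesgue_on \<Omega>) (\<lambda>x. w x * indicator (box c d) x)"
        by (rule L2_integrable_mult[OF w(4) L2_indicator]) (use leb in auto)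
      then have "integrable lebesgue (\<lambda>x. w x * indicator (box c d) x)"
        using integrable_zero_outside[OF leb, of "\<lambda>x. w x * indicator (box c d) x"] w(2) by simp
      then show "integrable lborel (\<lambda>x. w x * indicator (box c d) x)"
        by (subst (asm) integrable_completion) auto
      show "(\<integral>x. w x * indicator (box c d) x \<partial>lborel) = 0" by (rule box0[OF sub])
      fix a b
      \<comment> \<open>The same corners describe the open and the closed intersection, so the new
        closed box stays inside the domain.\<close>
      obtain p q where pq: "box c d \<inter> box a b = box p q" "cbox c d \<inter> cbox a b = cbox p q"
        by (rule that[OF box_Int_box Int_interval])
      have "(\<lambda>x. w x * indicator (box c d) x * indicator (box a b) x) = (\<lambda>x. w x * indicator (box p q) x)"
        unfolding pq(1)[symmetric] by (auto simp: indicator_def)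
      then show "(\<integral>x. w x * indicator (box c d) x * indicator (box a b) x \<partial>lborel) = 0"
        using box0[of p q] pq(2) sub by auto
    qed
    moreover have "AE x in lborel. x \<notin> cbox c d - box c d"
      using negligible_frontier_interval[of c d] AE_not_in[of "cbox c d - box c d" lborel]
      by (simp add: negligible_iff_null_sets null_sets_completion_iff)
    ultimately show ?thesis by eventually_elim (auto simp: indicator_def)
  qed
  obtain \<D> where D: "countable \<D>" "\<D> \<subseteq> Pow \<Omega>" "\<And>X. X \<in> \<D> \<Longrightarrow> \<exists>a b. X = cbox a b" "\<Union>\<D> = \<Omega>"
    using open_countable_Union_open_cbox[OF \<Omega>] by (metis (no_types, lifting))
  have "AE x in lborel. \<forall>X\<in>\<D>. x \<in> X \<longrightarrow> w x = 0"
    unfolding AE_ball_countable[OF D(1)]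
  proof
    fix X assume "X \<in> \<D>"
    then show "AE x in lborel. x \<in> X \<longrightarrow> w x = 0" using D(2,3) cbox0 by (metis PowD subsetD)
  qed
  then have "AE x in lebesgue. \<forall>X\<in>\<D>. x \<in> X \<longrightarrow> w x = 0" by (rule AE_completion)
  then have "AE x in lebesgue. x \<in> \<Omega> \<longrightarrow> w x = 0"
    by eventually_elim (use D(4) in blast)
  then have "AE x in lebesgue_on \<Omega>. w x = 0"
    using leb by (subst AE_restrict_space_iff) auto
  with w(3) show ?thesis by eventually_elim simp
qed

section \<open>Averages over balls\<close>

lemma integrable_pair_mult:
  fixes f g :: "'a::euclidean_space \<Rightarrow> real"
  assumes "integrable lborel f" "integrable lborel g"
  shows "integrable (lborel \<Otimes>\<^sub>M lborel) (\<lambda>(x, z). f x * g z)"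
proof (rule lborel_pair.Fubini_integrable)
  have [measurable]: "f \<in> borel_measurable borel" "g \<in> borel_measurable borel"
    using assms[THEN borel_measurable_integrable] by auto
  show "(\<lambda>(x, z). f x * g z) \<in> borel_measurable (lborel \<Otimes>\<^sub>M lborel)" by measurable
  show "integrable lborel (\<lambda>x. \<integral>z. norm (case (x, z) of (x, z) \<Rightarrow> f x * g z) \<partial>lborel)"
    using assms by (simp add: abs_mult)
  show "AE x in lborel. integrable lborel (\<lambda>z. case (x, z) of (x, z) \<Rightarrow> f x * g z)"
    using assms by simp
qed

text \<open>An average without its normalising factor. Written as an inner product with a fixed
  square integrable function, it tends to zero at every z when w runs through a weakly null
  sequence.\<close>

definition ball_integral :: "(real^'n) set \<Rightarrow> real \<Rightarrow> (real^'n \<Rightarrow> real) \<Rightarrow> real^'n \<Rightarrow> real" where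
  "ball_integral \<Omega> \<delta> w z = L2_inner \<Omega> w (indicator (cball z \<delta>))"

text \<open>The pairing of w with \<open>\<phi>\<close>, times the volume of the ball, is split by
  writing \<open>\<phi> x\<close> as (\<open>\<phi> x\<close> - \<open>\<phi> (x + h)\<close>) +
  \<open>\<phi> (x + h)\<close> and integrating over h in the ball. The difference is bounded by the
  translation estimate, uniformly for norm h \<le> \<delta>; by Fubini the other part is the pairing
  of \<open>\<phi>\<close> with the ball integrals of w.\<close>

lemma integral_against_average:
  fixes \<Omega> :: "(real^'n::finite) set" and w :: "real^'n \<Rightarrow> real"
  assumes \<Omega>: "open \<Omega>" "bounded \<Omega>" and w: "w \<in> borel_measurable borel" "\<And>x. x \<notin> \<Omega> \<Longrightarrow> w x = 0"
      "w \<in> L2_space \<Omega>"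
    and \<phi>: "\<phi> \<in> test_functions \<Omega>" and \<delta>: "\<delta> > 0"
  shows "ball_integral \<Omega> \<delta> w \<in> borel_measurable borel"
    and "measure lborel (cball (0::real^'n) \<delta>) * \<bar>L2_inner \<Omega> w \<phi>\<bar>
      \<le> measure lborel (cball (0::real^'n) \<delta>) * (\<delta> * L2_norm \<Omega> w * L2m_norm \<Omega> (\<lambda>i. classical_partial i \<phi>))
        + \<bar>L2_inner \<Omega> \<phi> (ball_integral \<Omega> \<delta> w)\<bar>"
proof -
  let ?B = "cball (0::real^'n) \<delta>"
  let ?\<beta> = "measure lborel ?B"
  let ?G = "L2m_norm \<Omega> (\<lambda>i. classical_partial i \<phi>)"
  have leb: "\<Omega> \<in> sets lebesgue" using \<Omega> by auto
  have fin: "emeasure lborel (cball (0::real^'n) \<delta>) < \<infinity>" by (rule emeasure_bounded_finite) auto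
  note [measurable] = w(1) test_borel[OF \<phi>]
  have [measurable]: "(indicator ?B :: real^'n \<Rightarrow> real) \<in> borel_measurable borel"
    by (intro borel_measurable_indicator borel_closed closed_cball)
  obtain C where C: "C > 0" "\<And>x. \<bar>\<phi> x\<bar> \<le> C" using test_bounded[OF \<phi>] by blast
  have int_w: "integrable lborel w"
  proof -
    have "integrable lebesgue w"
      using L2_imp_integrable[OF w(3) \<Omega>(2,1)] integrable_zero_outside[OF leb, of w] w(2) by simp
    then show ?thesis by (subst (asm) integrable_completion) auto
  qed
  have inner_w: "L2_inner \<Omega> w g = (\<integral>x. w x * g x \<partial>lborel)" if [measurable]: "g \<in> borel_measurable borel" for g
    by (rule trans[OF L2_inner_zero_outside[OF leb] L2_inner_UNIV_borel]) (simp_all add: w(2))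
  have V_eq: "ball_integral \<Omega> \<delta> w z = (\<integral>x. w x * indicator (cball z \<delta>) x \<partial>lborel)" for z
    unfolding ball_integral_def by (rule inner_w) (intro borel_measurable_indicator borel_closed closed_cball)
  have ind_sym: "indicator (cball z \<delta>) x = (indicator ?B (z - x) :: real)" for x z :: "real^'n"
    by (auto simp: indicator_def dist_norm norm_minus_commute)
  have V_eq': "ball_integral \<Omega> \<delta> w = (\<lambda>z. \<integral>x. w x * indicator ?B (z - x) \<partial>lborel)"
    by (rule ext, subst V_eq, rule Bochner_Integration.integral_cong[OF refl], subst ind_sym, rule refl)
  show V_meas: "ball_integral \<Omega> \<delta> w \<in> borel_measurable borel"
    unfolding V_eq' by measurable
  have int_B: "integrable lborel (indicator ?B :: real^'n \<Rightarrow> real)"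
    using fin by (simp add: integrable_indicator_iff)
  have inner_int: "(\<integral>h. indicator ?B h * (\<phi> x - \<phi> (x + h)) \<partial>lborel)
      = ?\<beta> * \<phi> x - (\<integral>z. \<phi> z * indicator ?B (z - x) \<partial>lborel)" for x
  proof -
    have int1: "integrable lborel (\<lambda>h. indicator ?B h * \<phi> x)" using int_B by simp
    have int2: "integrable lborel (\<lambda>h. indicator ?B h * \<phi> (x + h))"
    proof (rule Bochner_Integration.integrable_bound)
      show "integrable lborel (\<lambda>h. C * indicator ?B h)" using int_B by simp
      show "AE h in lborel. norm (indicator ?B h * \<phi> (x + h)) \<le> norm (C * indicator ?B h)"
        using C by (intro AE_I2) (auto simp: indicator_def)
    qed measurable
    have "(\<integral>h. indicator ?B h * (\<phi> x - \<phi> (x + h)) \<partial>lborel)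
        = (\<integral>h. indicator ?B h * \<phi> x \<partial>lborel) - (\<integral>h. indicator ?B h * \<phi> (x + h) \<partial>lborel)"
      using int1 int2 by (simp add: right_diff_distrib)
    also have "(\<integral>h. indicator ?B h * \<phi> x \<partial>lborel) = ?\<beta> * \<phi> x" by simp
    also have "(\<integral>h. indicator ?B h * \<phi> (x + h) \<partial>lborel) = (\<integral>z. \<phi> z * indicator ?B (z - x) \<partial>lborel)"
      using lborel_integral_translate[of "\<lambda>z. \<phi> z * indicator ?B (z - x)" x]
      by (simp add: add.commute mult.commute)
    finally show ?thesis .
  qed
  define T1 T2 where "T1 = (\<integral>x. (\<integral>h. w x * (indicator ?B h * (\<phi> x - \<phi> (x + h))) \<partial>lborel) \<partial>lborel)"
    and "T2 = (\<integral>x. (\<integral>z. w x * (\<phi> z * indicator ?B (z - x)) \<partial>lborel) \<partial>lborel)"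
  have int_pair1: "integrable (lborel \<Otimes>\<^sub>M lborel) (\<lambda>(x, h). w x * (indicator ?B h * (\<phi> x - \<phi> (x + h))))"
  proof (rule Bochner_Integration.integrable_bound)
    show "integrable (lborel \<Otimes>\<^sub>M lborel) (\<lambda>(x, h). w x * (indicator ?B h * (2 * C)))"
      using int_B by (intro integrable_pair_mult int_w) simp
    have "\<bar>\<phi> x - \<phi> (x + h)\<bar> \<le> 2 * C" for x h
      using C(2)[of x] C(2)[of "x + h"] by linarith
    then show "AE p in lborel \<Otimes>\<^sub>M lborel. norm (case p of (x, h) \<Rightarrow> w x * (indicator ?B h * (\<phi> x - \<phi> (x + h))))
        \<le> norm (case p of (x, h) \<Rightarrow> w x * (indicator ?B h * (2 * C)))"
      using C(1) by (intro AE_I2) (auto simp: abs_mult indicator_def intro!: mult_left_mono)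
  qed measurable
  have int_pair2: "integrable (lborel \<Otimes>\<^sub>M lborel) (\<lambda>(x, z). w x * (\<phi> z * indicator ?B (z - x)))"
  proof (rule Bochner_Integration.integrable_bound)
    show "integrable (lborel \<Otimes>\<^sub>M lborel) (\<lambda>(x, z). w x * \<phi> z)"
      by (intro integrable_pair_mult int_w test_integrable[OF \<phi>])
    show "AE p in lborel \<Otimes>\<^sub>M lborel. norm (case p of (x, z) \<Rightarrow> w x * (\<phi> z * indicator ?B (z - x)))
        \<le> norm (case p of (x, z) \<Rightarrow> w x * \<phi> z)"
      by (intro AE_I2) (auto simp: indicator_def)
  qed measurable
  have split: "?\<beta> * L2_inner \<Omega> w \<phi> = T1 + T2"
  proof -
    have "T1 + T2 = (\<integral>x. (\<integral>h. w x * (indicator ?B h * (\<phi> x - \<phi> (x + h))) \<partial>lborel)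
        + (\<integral>z. w x * (\<phi> z * indicator ?B (z - x)) \<partial>lborel) \<partial>lborel)"
      unfolding T1_def T2_def
      using lborel_pair.integrable_fst[OF int_pair1] lborel_pair.integrable_fst[OF int_pair2] by simp
    also have "\<dots> = (\<integral>x. ?\<beta> * (w x * \<phi> x) \<partial>lborel)"
      by (rule Bochner_Integration.integral_cong[OF refl],
          simp only: integral_mult_right_zero inner_int) (simp add: algebra_simps)
    also have "\<dots> = ?\<beta> * L2_inner \<Omega> w \<phi>" by (simp add: inner_w)
    finally show ?thesis ..
  qed
  have T1: "\<bar>T1\<bar> \<le> ?\<beta> * (\<delta> * L2_norm \<Omega> w * ?G)"
  proof -
    \<comment> \<open>With the shift h outermost, the inner integral pairs w with one translation
      difference of \<open>\<phi>\<close>.\<close>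
    have T1_eq: "T1 = (\<integral>h. (\<integral>x. w x * (indicator ?B h * (\<phi> x - \<phi> (x + h))) \<partial>lborel) \<partial>lborel)"
      unfolding T1_def by (rule lborel_pair.Fubini_integral[OF int_pair1, symmetric])
    have bound: "\<bar>\<integral>x. w x * (indicator ?B h * (\<phi> x - \<phi> (x + h))) \<partial>lborel\<bar>
        \<le> indicator ?B h * (\<delta> * L2_norm \<Omega> w * ?G)" for h
    proof (cases "h \<in> ?B")
      case True
      have w_UNIV: "w \<in> L2_space UNIV"
      proof -
        have "integrable lebesgue (\<lambda>x. (w x)\<^sup>2)"
          using L2_integrable_sq[OF w(3)] integrable_zero_outside[OF leb, of "\<lambda>x. (w x)\<^sup>2"] w(2) by simp
        moreover have "w \<in> borel_measurable lebesgue" using w(1) by (intro measurable_completion) simp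
        ultimately show ?thesis by (simp add: L2_space_def lebesgue_on_UNIV_eq)
      qed
      have diff: "(\<lambda>x. \<phi> (x + h) - \<phi> x) \<in> L2_space UNIV"
        by (intro L2_diff translate_L2[OF \<phi>] test_L2[OF \<phi>]) auto
      have "(\<integral>x. w x * (\<phi> x - \<phi> (x + h)) \<partial>lborel) = - (\<integral>x. w x * (\<phi> (x + h) - \<phi> x) \<partial>lborel)"
        unfolding Bochner_Integration.integral_minus[symmetric]
        by (rule Bochner_Integration.integral_cong) (auto simp: algebra_simps)
      then have "\<bar>\<integral>x. w x * (\<phi> x - \<phi> (x + h)) \<partial>lborel\<bar> = \<bar>L2_inner UNIV w (\<lambda>x. \<phi> (x + h) - \<phi> x)\<bar>"
        by (subst L2_inner_UNIV_borel) auto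
      also have "\<dots> \<le> L2_norm UNIV w * L2_norm UNIV (\<lambda>x. \<phi> (x + h) - \<phi> x)"
        by (rule L2_Cauchy_Schwarz[OF w_UNIV diff])
      also have "\<dots> \<le> L2_norm UNIV w * (norm h * ?G)"
        by (intro mult_left_mono translation_estimate[OF \<phi> leb]) simp
      also have "\<dots> \<le> L2_norm UNIV w * (\<delta> * ?G)"
        using True by (intro mult_left_mono mult_right_mono) (auto simp: L2m_norm_def L2m_inner_def intro!: sum_nonneg L2_inner_self_nonneg)
      also have "L2_norm UNIV w = L2_norm \<Omega> w"
        using L2_norm_zero_outside[OF leb, of w] w(2) by simp
      finally show ?thesis using True by (simp add: mult_ac)
    qed simp
    have "\<bar>T1\<bar> \<le> (\<integral>h. \<bar>\<integral>x. w x * (indicator ?B h * (\<phi> x - \<phi> (x + h))) \<partial>lborel\<bar> \<partial>lborel)"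
      unfolding T1_eq by (rule integral_abs_bound)
    also have "\<dots> \<le> (\<integral>h. indicator ?B h * (\<delta> * L2_norm \<Omega> w * ?G) \<partial>lborel)"
      using lborel_pair.integrable_snd[OF int_pair1] int_B bound by (intro integral_mono) auto
    also have "\<dots> = ?\<beta> * (\<delta> * L2_norm \<Omega> w * ?G)" by simp
    finally show ?thesis .
  qed
  have T2: "T2 = L2_inner \<Omega> \<phi> (ball_integral \<Omega> \<delta> w)"
  proof -
    have "T2 = (\<integral>z. (\<integral>x. w x * (\<phi> z * indicator ?B (z - x)) \<partial>lborel) \<partial>lborel)"
      unfolding T2_def by (rule lborel_pair.Fubini_integral[OF int_pair2, symmetric])
    also have "\<dots> = (\<integral>z. \<phi> z * ball_integral \<Omega> \<delta> w z \<partial>lborel)"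
      unfolding V_eq' integral_mult_right_zero[symmetric]
      by (intro Bochner_Integration.integral_cong) (auto simp: mult_ac)
    also have "\<dots> = L2_inner \<Omega> \<phi> (ball_integral \<Omega> \<delta> w)"
      using V_meas test_zero_outside[OF \<phi>]
      by (intro trans[OF L2_inner_zero_outside[OF leb] L2_inner_UNIV_borel, symmetric]) simp_all
    finally show ?thesis .
  qed
  have "?\<beta> * \<bar>L2_inner \<Omega> w \<phi>\<bar> = \<bar>T1 + T2\<bar>"
    using split by (simp add: abs_mult flip: split)
  also have "\<dots> \<le> ?\<beta> * (\<delta> * L2_norm \<Omega> w * ?G) + \<bar>L2_inner \<Omega> \<phi> (ball_integral \<Omega> \<delta> w)\<bar>"
    using T1 T2 by linarith
  finally show "?\<beta> * \<bar>L2_inner \<Omega> w \<phi>\<bar>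
      \<le> ?\<beta> * (\<delta> * L2_norm \<Omega> w * ?G) + \<bar>L2_inner \<Omega> \<phi> (ball_integral \<Omega> \<delta> w)\<bar>" .
qed

section \<open>Product norms and limits in norm\<close>

lemma L2m_norm_nonneg [simp]: "0 \<le> L2m_norm \<Omega> u"
  by (simp add: L2m_norm_def L2m_inner_def sum_nonneg L2_inner_self_nonneg)

lemma L2m_norm_sq: "(L2m_norm \<Omega> u)\<^sup>2 = (\<Sum>k\<in>UNIV. (L2_norm \<Omega> (u k))\<^sup>2)"
  by (simp add: L2m_norm_def L2m_inner_def sum_nonneg L2_inner_self_nonneg L2_norm_sq)

lemma L2m_norm_eq: "L2m_norm \<Omega> u = sqrt (\<Sum>k\<in>UNIV. (L2_norm \<Omega> (u k))\<^sup>2)"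
  using L2m_norm_sq[of \<Omega> u] L2m_norm_nonneg[of \<Omega> u] by (metis real_sqrt_unique)

lemma L2_norm_component_le: "L2_norm \<Omega> (u k) \<le> L2m_norm \<Omega> u"
proof (rule power2_le_imp_le)
  show "(L2_norm \<Omega> (u k))\<^sup>2 \<le> (L2m_norm \<Omega> u)\<^sup>2"
    unfolding L2m_norm_sq by (rule member_le_sum) auto
qed simp

lemma L2_norm_cong_AE:
  assumes "u \<in> L2_space \<Omega>" "v \<in> L2_space \<Omega>" "AE x in lebesgue_on \<Omega>. u x = v x"
  shows "L2_norm \<Omega> u = L2_norm \<Omega> v"
proof (rule antisym)
  show "L2_norm \<Omega> u \<le> L2_norm \<Omega> v"
    by (rule L2_norm_mono[OF assms(1,2)]) (use assms(3) in \<open>eventually_elim, simp\<close>)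
  show "L2_norm \<Omega> v \<le> L2_norm \<Omega> u"
    by (rule L2_norm_mono[OF assms(2,1)]) (use assms(3) in \<open>eventually_elim, simp\<close>)
qed

lemma L2_norm_diff_abs_le:
  assumes "u \<in> L2_space \<Omega>" "v \<in> L2_space \<Omega>"
  shows "\<bar>L2_norm \<Omega> u - L2_norm \<Omega> v\<bar> \<le> L2_norm \<Omega> (\<lambda>x. u x - v x)"
  using L2_norm_triangle[OF L2_diff[OF assms] assms(2)]
    L2_norm_triangle[OF L2_diff[OF assms(2,1)] assms(1)] L2_norm_minus_commute[of \<Omega> u v]
  by (simp add: abs_le_iff)

lemma L2_norm_tendsto:
  assumes "\<And>n. u n \<in> L2_space \<Omega>" "v \<in> L2_space \<Omega>" "(\<lambda>n. L2_norm \<Omega> (\<lambda>x. u n x - v x)) \<longlonglongrightarrow> 0"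
  shows "(\<lambda>n. L2_norm \<Omega> (u n)) \<longlonglongrightarrow> L2_norm \<Omega> v"
proof (rule LIM_zero_cancel, rule Lim_null_comparison[OF _ assms(3)])
  show "\<forall>\<^sub>F n in sequentially. norm (L2_norm \<Omega> (u n) - L2_norm \<Omega> v) \<le> L2_norm \<Omega> (\<lambda>x. u n x - v x)"
    using L2_norm_diff_abs_le[OF assms(1,2)] by simp
qed

lemma L2_inner_tendsto:
  assumes "\<And>n. u n \<in> L2_space \<Omega>" "v \<in> L2_space \<Omega>" "w \<in> L2_space \<Omega>"
    "(\<lambda>n. L2_norm \<Omega> (\<lambda>x. u n x - v x)) \<longlonglongrightarrow> 0"
  shows "(\<lambda>n. L2_inner \<Omega> (u n) w) \<longlonglongrightarrow> L2_inner \<Omega> v w"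
proof (rule LIM_zero_cancel, rule Lim_null_comparison)
  show "\<forall>\<^sub>F n in sequentially. norm (L2_inner \<Omega> (u n) w - L2_inner \<Omega> v w)
      \<le> L2_norm \<Omega> (\<lambda>x. u n x - v x) * L2_norm \<Omega> w"
    using L2_Cauchy_Schwarz[OF L2_diff[OF assms(1,2)] assms(3)]
    by (simp add: L2_inner_diff_left assms)
  show "(\<lambda>n. L2_norm \<Omega> (\<lambda>x. u n x - v x) * L2_norm \<Omega> w) \<longlonglongrightarrow> 0"
    using tendsto_mult_left_zero[OF assms(4)] .
qed

lemma L2_weakly_convergent_bounded:
  fixes v :: "nat \<Rightarrow> real^'n \<Rightarrow> real"
  assumes "\<And>n. v n \<in> L2_space \<Omega>"
    and "\<And>g. g \<in> L2_space \<Omega> \<Longrightarrow> (\<lambda>n. L2_inner \<Omega> (v n) g) \<longlonglongrightarrow> l g"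
  shows "\<exists>C>0. \<forall>n. L2_norm \<Omega> (v n) \<le> C"
proof -
  have "\<exists>C. \<forall>n. L2_norm \<Omega> (v n) \<le> C"
  proof (rule L2_uniform_boundedness[OF assms(1)])
    fix g assume "g \<in> L2_space \<Omega>"
    then have "Bseq (\<lambda>n. L2_inner \<Omega> (v n) g)"
      using assms(2) convergentI convergent_imp_Bseq by blast
    then show "\<exists>C. \<forall>n. \<bar>L2_inner \<Omega> (v n) g\<bar> \<le> C" by (auto simp: Bseq_def)
  qed
  then obtain C where "\<And>n. L2_norm \<Omega> (v n) \<le> C" by blast
  then have "\<And>n. L2_norm \<Omega> (v n) \<le> max C 1" by (simp add: max.coboundedI1)
  then show ?thesis by (intro exI[of _ "max C 1"]) auto
qed

text \<open>The compact embedding in dual form: weak convergence to zero becomes smallness uniform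
  over all test functions, relative to the gradient norm. For a fixed radius the ball integrals tend
  to zero pointwise and are uniformly bounded, hence tend to zero in norm; Poincare absorbs the norm
  of \<open>\<phi>\<close>.\<close>

lemma weakly_null_on_test_functions:
  fixes \<Omega> :: "(real^'n::finite) set" and v :: "nat \<Rightarrow> real^'n \<Rightarrow> real"
  assumes \<Omega>: "open \<Omega>" "bounded \<Omega>" and v: "\<And>n. v n \<in> L2_space \<Omega>"
    and null: "\<And>g. g \<in> L2_space \<Omega> \<Longrightarrow> (\<lambda>n. L2_inner \<Omega> (v n) g) \<longlonglongrightarrow> 0" and \<epsilon>: "\<epsilon> > 0"
  shows "\<forall>\<^sub>F n in sequentially. \<forall>\<phi>\<in>test_functions \<Omega>.
    \<bar>L2_inner \<Omega> (v n) \<phi>\<bar> \<le> \<epsilon> * L2m_norm \<Omega> (\<lambda>i. classical_partial i \<phi>)"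
proof -
  have leb: "\<Omega> \<in> sets lebesgue" using \<Omega> by auto
  obtain M where M: "M > 0" "\<And>n. L2_norm \<Omega> (v n) \<le> M"
    using L2_weakly_convergent_bounded[OF v null] by blast
  obtain C where C: "C \<ge> 0" "\<And>\<phi>. \<phi> \<in> test_functions \<Omega> \<Longrightarrow>
      L2_norm \<Omega> \<phi> \<le> C * L2m_norm \<Omega> (\<lambda>i. classical_partial i \<phi>)"
    using Poincare_test[OF \<Omega>(2) leb] by blast
  \<comment> \<open>Chosen so that replacing \<open>v n\<close> by its averages costs half of
    \<epsilon>; M bounds the norms of the sequence.\<close>
  define \<delta> where "\<delta> = \<epsilon> / (2 * M)"
  have \<delta>: "\<delta> > 0" using \<epsilon> M(1) by (simp add: \<delta>_def)
  define \<beta> where "\<beta> = measure lborel (cball (0::real^'n) \<delta>)"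
  have \<beta>: "\<beta> > 0" using \<delta> by (simp add: \<beta>_def)
  have "\<exists>w. w \<in> borel_measurable borel \<and> (\<forall>x. x \<notin> \<Omega> \<longrightarrow> w x = 0) \<and>
      (AE x in lebesgue_on \<Omega>. v n x = w x) \<and> w \<in> L2_space \<Omega>" for n
    using L2_borel_representative[OF v \<Omega>(1), of n] by blast
  then obtain w where w: "\<And>n. w n \<in> borel_measurable borel" "\<And>n x. x \<notin> \<Omega> \<Longrightarrow> w n x = 0"
    "\<And>n. AE x in lebesgue_on \<Omega>. v n x = w n x" "\<And>n. w n \<in> L2_space \<Omega>"
    by metis
  have inner_w: "L2_inner \<Omega> (w n) g = L2_inner \<Omega> (v n) g" if "g \<in> L2_space \<Omega>" for n g
    using L2_inner_cong_AE_L2[OF v w(4) that w(3)] by simp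
  have norm_w: "L2_norm \<Omega> (w n) \<le> M" for n
    using L2_norm_cong_AE[OF v w(4) w(3), of n] M(2)[of n] by simp
  define V where "V n = ball_integral \<Omega> \<delta> (w n)" for n
  have ball_L2: "(indicator (cball z \<delta>) :: real^'n \<Rightarrow> real) \<in> L2_space \<Omega>" for z
    by (rule L2_indicator) (use leb in auto)
  define K where "K = M * L2_norm \<Omega> (\<lambda>x::real^'n. 1)"
  have zero_test: "(\<lambda>x::real^'n. 0) \<in> test_functions \<Omega>"
    using smooth_const[of 0] by (auto simp: test_functions_def)
  have V_meas: "V n \<in> borel_measurable borel" for n
    unfolding V_def by (rule integral_against_average(1)[OF \<Omega> w(1,2,4) zero_test \<delta>])
  have V_bound: "\<bar>V n z\<bar> \<le> K" for n z
  proof -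
    have "\<bar>V n z\<bar> \<le> L2_norm \<Omega> (w n) * L2_norm \<Omega> (indicator (cball z \<delta>))"
      unfolding V_def ball_integral_def by (rule L2_Cauchy_Schwarz[OF w(4) ball_L2])
    also have "\<dots> \<le> M * L2_norm \<Omega> (\<lambda>x::real^'n. 1)"
    proof (intro mult_mono norm_w L2_norm_mono ball_L2 L2_const \<Omega>)
      show "AE x in lebesgue_on \<Omega>. \<bar>indicat_real (cball z \<delta>) x\<bar> \<le> \<bar>1\<bar>"
        by (intro AE_I2) (simp add: indicator_def)
    qed (use M in auto)
    finally show ?thesis by (simp add: K_def)
  qed
  have "(\<lambda>n. L2_norm \<Omega> (V n)) \<longlonglongrightarrow> 0"
  proof (rule L2_norm_tendsto_AE)
    show "V n \<in> borel_measurable (lebesgue_on \<Omega>)" for n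
      using V_meas by (intro measurable_restrict_space1 measurable_completion) simp
    show "(\<lambda>x. K) \<in> L2_space \<Omega>" by (rule L2_const[OF \<Omega>(2,1)])
    show "AE x in lebesgue_on \<Omega>. (\<lambda>n. V n x) \<longlonglongrightarrow> 0"
      using null[OF ball_L2] by (intro AE_I2) (simp add: V_def ball_integral_def inner_w[OF ball_L2])
    show "AE x in lebesgue_on \<Omega>. \<bar>V n x\<bar> \<le> \<bar>K\<bar>" for n
      using V_bound by (intro AE_I2 order_trans[OF V_bound abs_ge_self])
  qed
  \<comment> \<open>The other half of \<epsilon>, scaled by the volume \<beta> on the left-hand side
    and by the Poincare constant; \<open>C + 1\<close> instead of \<open>C\<close> because
    \<open>C\<close> may be 0.\<close>
  then have "\<forall>\<^sub>F n in sequentially. L2_norm \<Omega> (V n) < \<epsilon> * \<beta> / (2 * (C + 1))"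
    using \<epsilon> \<beta> C(1) by (intro order_tendstoD) auto
  then show ?thesis
  proof eventually_elim
    case (elim n)
    show ?case
    proof
      fix \<phi> assume \<phi>: "\<phi> \<in> test_functions \<Omega>"
      let ?G = "L2m_norm \<Omega> (\<lambda>i. classical_partial i \<phi>)"
      note \<phi>_L2 = test_L2[OF \<phi> leb]
      have V_L2: "V n \<in> L2_space \<Omega>"
      proof (rule L2_bound[OF L2_const[OF \<Omega>(2,1), of K], where C = 1])
        show "V n \<in> borel_measurable (lebesgue_on \<Omega>)"
          using V_meas by (intro measurable_restrict_space1 measurable_completion) simp
        show "AE x in lebesgue_on \<Omega>. \<bar>V n x\<bar> \<le> 1 * \<bar>K\<bar>"
          using V_bound by (intro AE_I2) (simp add: order_trans[OF V_bound abs_ge_self])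
      qed
      have "\<beta> * \<bar>L2_inner \<Omega> (w n) \<phi>\<bar> \<le> \<beta> * (\<delta> * L2_norm \<Omega> (w n) * ?G) + \<bar>L2_inner \<Omega> \<phi> (V n)\<bar>"
        unfolding \<beta>_def V_def by (rule integral_against_average(2)[OF \<Omega> w(1,2,4) \<phi> \<delta>])
      also have "\<dots> \<le> \<beta> * (\<delta> * M * ?G) + (C * ?G) * (\<epsilon> * \<beta> / (2 * (C + 1)))"
      proof (rule add_mono)
        show "\<beta> * (\<delta> * L2_norm \<Omega> (w n) * ?G) \<le> \<beta> * (\<delta> * M * ?G)"
          using \<beta> \<delta> norm_w[of n] by (intro mult_left_mono mult_right_mono) auto
        have "\<bar>L2_inner \<Omega> \<phi> (V n)\<bar> \<le> L2_norm \<Omega> \<phi> * L2_norm \<Omega> (V n)"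
          by (rule L2_Cauchy_Schwarz[OF \<phi>_L2 V_L2])
        also have "\<dots> \<le> (C * ?G) * (\<epsilon> * \<beta> / (2 * (C + 1)))"
          using C(2)[OF \<phi>] C(1) elim by (intro mult_mono) auto
        finally show "\<bar>L2_inner \<Omega> \<phi> (V n)\<bar> \<le> (C * ?G) * (\<epsilon> * \<beta> / (2 * (C + 1)))" .
      qed
      also have "\<dots> \<le> \<beta> * (\<epsilon> / 2 * ?G) + \<beta> * (\<epsilon> / 2 * ?G)"
      proof (rule add_mono)
        show "\<beta> * (\<delta> * M * ?G) \<le> \<beta> * (\<epsilon> / 2 * ?G)" using M(1) by (simp add: \<delta>_def)
        have "(C * ?G) * (\<epsilon> * \<beta> / (2 * (C + 1))) = (C / (C + 1)) * (\<beta> * (\<epsilon> / 2 * ?G))"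
          using C(1) by (simp add: field_simps)
        also have "\<dots> \<le> 1 * (\<beta> * (\<epsilon> / 2 * ?G))"
          using C(1) \<beta> \<epsilon> by (intro mult_right_mono) auto
        finally show "(C * ?G) * (\<epsilon> * \<beta> / (2 * (C + 1))) \<le> \<beta> * (\<epsilon> / 2 * ?G)" by simp
      qed
      also have "\<dots> = \<beta> * (\<epsilon> * ?G)" by (simp add: field_simps)
      finally show "\<bar>L2_inner \<Omega> (v n) \<phi>\<bar> \<le> \<epsilon> * ?G"
        using \<beta> by (simp add: inner_w[OF \<phi>_L2])
    qed
  qed
qed

section \<open>The space with zero boundary values\<close>

text \<open>Membership in the space together with a chosen representative D of the gradient, as the
  closure of the graph of the classical gradient. \<open>weak_partial\<close> is a choice made by
  \<open>SOME\<close> and need not be linear pointwise, whereas D can be prescribed for differences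
  and compositions.\<close>

definition H10_gradient ::
    "(real^'n::finite) set \<Rightarrow> (real^'n \<Rightarrow> real) \<Rightarrow> ('n \<Rightarrow> real^'n \<Rightarrow> real) \<Rightarrow> bool" where
  "H10_gradient \<Omega> u D \<longleftrightarrow> u \<in> L2_space \<Omega> \<and> (\<forall>i. D i \<in> L2_space \<Omega>) \<and>
     (\<exists>\<phi>. (\<forall>n::nat. \<phi> n \<in> test_functions \<Omega>) \<and> (\<lambda>n. L2_norm \<Omega> (\<lambda>x. \<phi> n x - u x)) \<longlonglongrightarrow> 0 \<and>
       (\<forall>i. (\<lambda>n. L2_norm \<Omega> (\<lambda>x. classical_partial i (\<phi> n) x - D i x)) \<longlonglongrightarrow> 0))"

lemma weak_partial_unique:
  fixes \<Omega> :: "(real^'n::finite) set"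
  assumes "open \<Omega>" "g \<in> L2_space \<Omega>" "g' \<in> L2_space \<Omega>"
    "has_weak_partial \<Omega> i u g" "has_weak_partial \<Omega> i u g'"
  shows "AE x in lebesgue_on \<Omega>. g x = g' x"
proof -
  have "AE x in lebesgue_on \<Omega>. g x - g' x = 0"
  proof (rule orthogonal_to_test_functions[OF L2_diff[OF assms(2,3)] assms(1)])
    fix \<phi> assume \<phi>: "\<phi> \<in> test_functions \<Omega>"
    then have "L2_inner \<Omega> g \<phi> = L2_inner \<Omega> g' \<phi>"
      using assms(4,5) unfolding has_weak_partial_def by (metis neg_equal_iff_equal)
    then show "L2_inner \<Omega> (\<lambda>x. g x - g' x) \<phi> = 0"
      using test_L2[OF \<phi>, of \<Omega>] assms(1) by (simp add: L2_inner_diff_left assms(2,3))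
  qed
  then show ?thesis by simp
qed

lemma weak_partial_AE:
  fixes \<Omega> :: "(real^'n::finite) set"
  assumes "open \<Omega>" "g \<in> L2_space \<Omega>" "has_weak_partial \<Omega> i u g"
  shows "weak_partial \<Omega> i u \<in> L2_space \<Omega>" "has_weak_partial \<Omega> i u (weak_partial \<Omega> i u)"
    "AE x in lebesgue_on \<Omega>. weak_partial \<Omega> i u x = g x"
proof -
  have *: "weak_partial \<Omega> i u \<in> L2_space \<Omega> \<and> has_weak_partial \<Omega> i u (weak_partial \<Omega> i u)"
    unfolding weak_partial_def by (rule someI[of _ g]) (use assms in auto)
  then show "weak_partial \<Omega> i u \<in> L2_space \<Omega>" "has_weak_partial \<Omega> i u (weak_partial \<Omega> i u)" by auto
  then show "AE x in lebesgue_on \<Omega>. weak_partial \<Omega> i u x = g x"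
    using weak_partial_unique[OF assms(1) _ assms(2) _ assms(3)] by blast
qed

lemma has_weak_partial_diff:
  fixes \<Omega> :: "(real^'n::finite) set"
  assumes "open \<Omega>" "u \<in> L2_space \<Omega>" "v \<in> L2_space \<Omega>" "g \<in> L2_space \<Omega>" "g' \<in> L2_space \<Omega>"
    "has_weak_partial \<Omega> i u g" "has_weak_partial \<Omega> i v g'"
  shows "has_weak_partial \<Omega> i (\<lambda>x. u x - v x) (\<lambda>x. g x - g' x)"
  unfolding has_weak_partial_def
proof
  fix \<phi> assume \<phi>: "\<phi> \<in> test_functions \<Omega>"
  have leb: "\<Omega> \<in> sets lebesgue" using assms(1) by auto
  show "L2_inner \<Omega> (\<lambda>x. u x - v x) (classical_partial i \<phi>) = - L2_inner \<Omega> (\<lambda>x. g x - g' x) \<phi>"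
    using assms(6,7) \<phi> test_L2[OF \<phi> leb] test_L2[OF test_partial[OF \<phi>] leb]
    by (simp add: L2_inner_diff_left assms(2-5) has_weak_partial_def)
qed

lemma H10_gradient_has_weak_partial:
  assumes "open \<Omega>" "H10_gradient \<Omega> u D"
  shows "has_weak_partial \<Omega> i u (D i)"
  unfolding has_weak_partial_def
proof
  fix \<psi> assume \<psi>: "\<psi> \<in> test_functions \<Omega>"
  have leb: "\<Omega> \<in> sets lebesgue" using assms(1) by auto
  obtain \<phi> where \<phi>: "\<And>n::nat. \<phi> n \<in> test_functions \<Omega>" "(\<lambda>n. L2_norm \<Omega> (\<lambda>x. \<phi> n x - u x)) \<longlonglongrightarrow> 0"
    "\<And>i. (\<lambda>n. L2_norm \<Omega> (\<lambda>x. classical_partial i (\<phi> n) x - D i x)) \<longlonglongrightarrow> 0"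
    and L2: "u \<in> L2_space \<Omega>" "\<And>i. D i \<in> L2_space \<Omega>"
    using assms(2) unfolding H10_gradient_def by blast
  have "(\<lambda>n. L2_inner \<Omega> (\<phi> n) (classical_partial i \<psi>)) \<longlonglongrightarrow> L2_inner \<Omega> u (classical_partial i \<psi>)"
    by (rule L2_inner_tendsto[OF test_L2[OF \<phi>(1) leb] L2(1) test_L2[OF test_partial[OF \<psi>] leb] \<phi>(2)])
  moreover have "L2_inner \<Omega> (\<phi> n) (classical_partial i \<psi>) = - L2_inner \<Omega> (classical_partial i (\<phi> n)) \<psi>" for n
    using test_has_weak_partial[OF \<phi>(1) leb] \<psi> by (simp add: has_weak_partial_def)
  ultimately have "(\<lambda>n. - L2_inner \<Omega> (classical_partial i (\<phi> n)) \<psi>) \<longlonglongrightarrow> L2_inner \<Omega> u (classical_partial i \<psi>)"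
    by simp
  moreover have "(\<lambda>n. - L2_inner \<Omega> (classical_partial i (\<phi> n)) \<psi>) \<longlonglongrightarrow> - L2_inner \<Omega> (D i) \<psi>"
    by (intro tendsto_minus L2_inner_tendsto test_L2[OF test_partial[OF \<phi>(1)] leb] L2 test_L2[OF \<psi> leb] \<phi>(3))
  ultimately show "L2_inner \<Omega> u (classical_partial i \<psi>) = - L2_inner \<Omega> (D i) \<psi>"
    by (rule LIMSEQ_unique)
qed

text \<open>\<open>H1_norm\<close> of a difference contains the weak partial derivative of that
  difference, an independent choice by \<open>SOME\<close>. Uniqueness identifies it almost
  everywhere with the difference of the derivatives.\<close>

lemma H10_gradient_weak_partial:
  fixes \<Omega> :: "(real^'n::finite) set"
  assumes \<Omega>: "open \<Omega>" and u: "u \<in> H10_space \<Omega>"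
  shows "H10_gradient \<Omega> u (\<lambda>i. weak_partial \<Omega> i u)"
proof -
  have leb: "\<Omega> \<in> sets lebesgue" using \<Omega> by auto
  have L2: "u \<in> L2_space \<Omega>" using u by (simp add: H10_space_def H1_space_def)
  have wp: "weak_partial \<Omega> i u \<in> L2_space \<Omega>" "has_weak_partial \<Omega> i u (weak_partial \<Omega> i u)" for i
  proof -
    obtain g where "g \<in> L2_space \<Omega>" "has_weak_partial \<Omega> i u g"
      using u by (auto simp: H10_space_def H1_space_def)
    then show "weak_partial \<Omega> i u \<in> L2_space \<Omega>" "has_weak_partial \<Omega> i u (weak_partial \<Omega> i u)"
      by (rule weak_partial_AE[OF \<Omega>])+
  qed
  obtain \<phi> where \<phi>: "\<And>n::nat. \<phi> n \<in> test_functions \<Omega>" "(\<lambda>n. H1_norm \<Omega> (\<lambda>x. \<phi> n x - u x)) \<longlonglongrightarrow> 0"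
    using u by (auto simp: H10_space_def)
  have "(\<lambda>n. L2_norm \<Omega> (\<lambda>x. \<phi> n x - u x)) \<longlonglongrightarrow> 0"
  proof (rule Lim_null_comparison[OF _ \<phi>(2)])
    show "\<forall>\<^sub>F n in sequentially. norm (L2_norm \<Omega> (\<lambda>x. \<phi> n x - u x)) \<le> H1_norm \<Omega> (\<lambda>x. \<phi> n x - u x)"
      by (auto simp: H1_norm_def intro!: always_eventually real_le_rsqrt sum_nonneg)
  qed
  moreover have "(\<lambda>n. L2_norm \<Omega> (\<lambda>x. classical_partial i (\<phi> n) x - weak_partial \<Omega> i u x)) \<longlonglongrightarrow> 0" for i
  proof (rule Lim_null_comparison[OF _ \<phi>(2)], rule always_eventually, rule allI)
    fix n
    have L2': "(\<lambda>x. classical_partial i (\<phi> n) x - weak_partial \<Omega> i u x) \<in> L2_space \<Omega>"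
      by (intro L2_diff test_L2[OF test_partial[OF \<phi>(1)] leb] wp)
    have hwp: "has_weak_partial \<Omega> i (\<lambda>x. \<phi> n x - u x) (\<lambda>x. classical_partial i (\<phi> n) x - weak_partial \<Omega> i u x)"
      by (intro has_weak_partial_diff[OF \<Omega>] test_L2[OF \<phi>(1) leb] L2 test_L2[OF test_partial[OF \<phi>(1)] leb] wp
          test_has_weak_partial[OF \<phi>(1) leb])
    have "L2_norm \<Omega> (\<lambda>x. classical_partial i (\<phi> n) x - weak_partial \<Omega> i u x)
        = L2_norm \<Omega> (weak_partial \<Omega> i (\<lambda>x. \<phi> n x - u x))"
      using weak_partial_AE[OF \<Omega> L2' hwp] L2' by (intro L2_norm_cong_AE[symmetric])
    also have "\<dots> \<le> H1_norm \<Omega> (\<lambda>x. \<phi> n x - u x)"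
    proof -
      have "(L2_norm \<Omega> (weak_partial \<Omega> i (\<lambda>x. \<phi> n x - u x)))\<^sup>2
          \<le> (\<Sum>i\<in>UNIV. (L2_norm \<Omega> (weak_partial \<Omega> i (\<lambda>x. \<phi> n x - u x)))\<^sup>2)"
        by (rule member_le_sum) auto
      also have "\<dots> \<le> (L2_norm \<Omega> (\<lambda>x. \<phi> n x - u x))\<^sup>2 + \<dots>" by simp
      finally show ?thesis by (simp add: H1_norm_def real_le_rsqrt)
    qed
    finally show "norm (L2_norm \<Omega> (\<lambda>x. classical_partial i (\<phi> n) x - weak_partial \<Omega> i u x))
        \<le> H1_norm \<Omega> (\<lambda>x. \<phi> n x - u x)" by simp
  qed
  ultimately show ?thesis
    unfolding H10_gradient_def using L2 wp \<phi>(1) by blast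
qed

lemma H10_gradient_imp_H10:
  fixes \<Omega> :: "(real^'n::finite) set"
  assumes \<Omega>: "open \<Omega>" and u: "H10_gradient \<Omega> u D"
  shows "u \<in> H10_space \<Omega>" "AE x in lebesgue_on \<Omega>. weak_partial \<Omega> i u x = D i x"
proof -
  have leb: "\<Omega> \<in> sets lebesgue" using \<Omega> by auto
  obtain \<phi> where \<phi>: "\<And>n::nat. \<phi> n \<in> test_functions \<Omega>" "(\<lambda>n. L2_norm \<Omega> (\<lambda>x. \<phi> n x - u x)) \<longlonglongrightarrow> 0"
    "\<And>i. (\<lambda>n. L2_norm \<Omega> (\<lambda>x. classical_partial i (\<phi> n) x - D i x)) \<longlonglongrightarrow> 0"
    and L2: "u \<in> L2_space \<Omega>" "\<And>i. D i \<in> L2_space \<Omega>"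
    using u unfolding H10_gradient_def by blast
  note hwp = H10_gradient_has_weak_partial[OF \<Omega> u]
  show "AE x in lebesgue_on \<Omega>. weak_partial \<Omega> i u x = D i x"
    by (rule weak_partial_AE(3)[OF \<Omega> L2(2) hwp])
  have norm_eq: "L2_norm \<Omega> (weak_partial \<Omega> i (\<lambda>x. \<phi> n x - u x))
      = L2_norm \<Omega> (\<lambda>x. classical_partial i (\<phi> n) x - D i x)" for i n
  proof -
    have L2': "(\<lambda>x. classical_partial i (\<phi> n) x - D i x) \<in> L2_space \<Omega>"
      by (intro L2_diff test_L2[OF test_partial[OF \<phi>(1)] leb] L2)
    have "has_weak_partial \<Omega> i (\<lambda>x. \<phi> n x - u x) (\<lambda>x. classical_partial i (\<phi> n) x - D i x)"
      by (intro has_weak_partial_diff[OF \<Omega>] test_L2[OF \<phi>(1) leb] L2 test_L2[OF test_partial[OF \<phi>(1)] leb] hwp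
          test_has_weak_partial[OF \<phi>(1) leb])
    from weak_partial_AE[OF \<Omega> L2' this] L2' show ?thesis by (intro L2_norm_cong_AE)
  qed
  have "(\<lambda>n. H1_norm \<Omega> (\<lambda>x. \<phi> n x - u x)) \<longlonglongrightarrow> sqrt (0\<^sup>2 + (\<Sum>i\<in>(UNIV::'n set). 0\<^sup>2))"
    unfolding H1_norm_def norm_eq
    by (intro tendsto_real_sqrt tendsto_add tendsto_sum tendsto_power \<phi>)
  then show "u \<in> H10_space \<Omega>"
    using \<phi>(1) L2 hwp by (auto simp: H10_space_def H1_space_def)
qed

lemma H10_gradient_diff:
  fixes \<Omega> :: "(real^'n::finite) set"
  assumes \<Omega>: "open \<Omega>" and u: "H10_gradient \<Omega> u D" and v: "H10_gradient \<Omega> v E"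
  shows "H10_gradient \<Omega> (\<lambda>x. u x - v x) (\<lambda>i x. D i x - E i x)"
proof -
  have leb: "\<Omega> \<in> sets lebesgue" using \<Omega> by auto
  obtain \<phi> where \<phi>: "\<And>n::nat. \<phi> n \<in> test_functions \<Omega>" "(\<lambda>n. L2_norm \<Omega> (\<lambda>x. \<phi> n x - u x)) \<longlonglongrightarrow> 0"
    "\<And>i. (\<lambda>n. L2_norm \<Omega> (\<lambda>x. classical_partial i (\<phi> n) x - D i x)) \<longlonglongrightarrow> 0"
    and L2: "u \<in> L2_space \<Omega>" "\<And>i. D i \<in> L2_space \<Omega>"
    using u unfolding H10_gradient_def by blast
  obtain \<psi> where \<psi>: "\<And>n::nat. \<psi> n \<in> test_functions \<Omega>" "(\<lambda>n. L2_norm \<Omega> (\<lambda>x. \<psi> n x - v x)) \<longlonglongrightarrow> 0"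
    "\<And>i. (\<lambda>n. L2_norm \<Omega> (\<lambda>x. classical_partial i (\<psi> n) x - E i x)) \<longlonglongrightarrow> 0"
    and L2': "v \<in> L2_space \<Omega>" "\<And>i. E i \<in> L2_space \<Omega>"
    using v unfolding H10_gradient_def by blast
  have lim: "(\<lambda>n. L2_norm \<Omega> (\<lambda>x. (a n x - b n x) - (c x - d x))) \<longlonglongrightarrow> 0"
    if "(\<lambda>n. L2_norm \<Omega> (\<lambda>x. a n x - c x)) \<longlonglongrightarrow> 0" "(\<lambda>n. L2_norm \<Omega> (\<lambda>x. b n x - d x)) \<longlonglongrightarrow> 0"
      "\<And>n. a n \<in> L2_space \<Omega>" "\<And>n. b n \<in> L2_space \<Omega>" "c \<in> L2_space \<Omega>" "d \<in> L2_space \<Omega>"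
    for a b :: "nat \<Rightarrow> real^'n \<Rightarrow> real" and c d
  proof (rule Lim_null_comparison[OF _ tendsto_add_zero[OF that(1,2)]], rule always_eventually, rule allI)
    fix n
    have "(\<lambda>x. (a n x - b n x) - (c x - d x)) = (\<lambda>x. (a n x - c x) - (b n x - d x))" by auto
    then show "norm (L2_norm \<Omega> (\<lambda>x. (a n x - b n x) - (c x - d x)))
        \<le> L2_norm \<Omega> (\<lambda>x. a n x - c x) + L2_norm \<Omega> (\<lambda>x. b n x - d x)"
      using L2_norm_triangle_diff[OF L2_diff[OF that(3,5), of n] L2_diff[OF that(4,6), of n]] by simp
  qed
  have partial: "classical_partial i (\<lambda>x. \<phi> n x - \<psi> n x) x = classical_partial i (\<phi> n) x - classical_partial i (\<psi> n) x" for i n x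
  proof -
    have "(\<phi> n has_derivative frechet_derivative (\<phi> n) (at x)) (at x)"
      "(\<psi> n has_derivative frechet_derivative (\<psi> n) (at x)) (at x)"
      using smooth_differentiable test_smooth \<phi>(1) \<psi>(1) frechet_derivative_works by blast+
    from classical_partial_eq[OF has_derivative_diff[OF this]] show ?thesis
      by (simp add: classical_partial_def)
  qed
  show ?thesis
    unfolding H10_gradient_def
  proof (intro conjI exI[of _ "\<lambda>n x. \<phi> n x - \<psi> n x"] allI)
    show "(\<lambda>n. L2_norm \<Omega> (\<lambda>x. \<phi> n x - \<psi> n x - (u x - v x))) \<longlonglongrightarrow> 0"
      by (intro lim \<phi> \<psi> L2 L2' test_L2[OF \<phi>(1) leb] test_L2[OF \<psi>(1) leb])
    show "(\<lambda>n. L2_norm \<Omega> (\<lambda>x. classical_partial i (\<lambda>x. \<phi> n x - \<psi> n x) x - (D i x - E i x))) \<longlonglongrightarrow> 0" for i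
      unfolding partial
      by (intro lim \<phi> \<psi> L2 L2' test_L2[OF test_partial[OF \<phi>(1)] leb] test_L2[OF test_partial[OF \<psi>(1)] leb])
  qed (intro L2_diff test_diff L2 L2' \<phi> \<psi>)+
qed

text \<open>With \<sigma> = \<open>softplus_deriv k\<close>, the error \<sigma>(\<phi>)
  \<partial>\<phi> - \<sigma>(u) D of an approximant \<phi> splits into \<sigma>(\<phi>)
  (\<partial>\<phi> - D), small because 0 \<le> \<sigma> \<le> 1, and (\<sigma>(\<phi>) -
  \<sigma>(u)) D. The latter is handled by dominated convergence along a subsequence that converges
  almost everywhere.\<close>

lemma H10_gradient_softplus:
  fixes \<Omega> :: "(real^'n::finite) set"
  assumes \<Omega>: "open \<Omega>" and u: "H10_gradient \<Omega> u D" and k: "k > 0"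
  shows "H10_gradient \<Omega> (\<lambda>x. softplus k (u x)) (\<lambda>i x. softplus_deriv k (u x) * D i x)"
proof -
  have leb: "\<Omega> \<in> sets lebesgue" using \<Omega> by auto
  obtain \<phi>0 where \<phi>0: "\<And>n::nat. \<phi>0 n \<in> test_functions \<Omega>" "(\<lambda>n. L2_norm \<Omega> (\<lambda>x. \<phi>0 n x - u x)) \<longlonglongrightarrow> 0"
    "\<And>i. (\<lambda>n. L2_norm \<Omega> (\<lambda>x. classical_partial i (\<phi>0 n) x - D i x)) \<longlonglongrightarrow> 0"
    and L2: "u \<in> L2_space \<Omega>" "\<And>i. D i \<in> L2_space \<Omega>"
    using u unfolding H10_gradient_def by blast
  obtain r :: "nat \<Rightarrow> nat" where r: "strict_mono r"
    "AE x in lebesgue_on \<Omega>. (\<lambda>n. \<phi>0 (r n) x - u x) \<longlonglongrightarrow> 0"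
    using L2_norm_tendsto_AE_subseq[OF L2_diff[OF test_L2[OF \<phi>0(1) leb] L2(1)] \<phi>0(2)] by blast
  define \<phi> where "\<phi> n = \<phi>0 (r n)" for n
  have \<phi>: "\<And>n. \<phi> n \<in> test_functions \<Omega>" "(\<lambda>n. L2_norm \<Omega> (\<lambda>x. \<phi> n x - u x)) \<longlonglongrightarrow> 0"
    "\<And>i. (\<lambda>n. L2_norm \<Omega> (\<lambda>x. classical_partial i (\<phi> n) x - D i x)) \<longlonglongrightarrow> 0"
    unfolding \<phi>_def using \<phi>0(1) LIMSEQ_subseq_LIMSEQ[OF \<phi>0(2) r(1)] LIMSEQ_subseq_LIMSEQ[OF \<phi>0(3) r(1)]
    by (auto simp: o_def)
  have \<phi>_L2: "\<phi> n \<in> L2_space \<Omega>" "classical_partial i (\<phi> n) \<in> L2_space \<Omega>" for n i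
    by (rule test_L2[OF \<phi>(1) leb], rule test_L2[OF test_partial[OF \<phi>(1)] leb])
  have conv: "AE x in lebesgue_on \<Omega>. (\<lambda>n. \<phi> n x) \<longlonglongrightarrow> u x"
    using r(2) unfolding \<phi>_def by eventually_elim (rule LIM_zero_cancel)
  have cont: "continuous_on UNIV (softplus k)" "continuous_on UNIV (softplus_deriv k)"
    using softplus_has_derivative[OF k] isCont_softplus_deriv
    by (auto simp: continuous_on_eq_continuous_at intro: DERIV_isCont)
  have meas: "(\<lambda>x. softplus k (w x)) \<in> borel_measurable (lebesgue_on \<Omega>)"
    "(\<lambda>x. softplus_deriv k (w x)) \<in> borel_measurable (lebesgue_on \<Omega>)" if "w \<in> L2_space \<Omega>" for w
    using measurable_compose[OF L2_measurable[OF that] borel_measurable_continuous_onI[OF cont(1)]]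
      measurable_compose[OF L2_measurable[OF that] borel_measurable_continuous_onI[OF cont(2)]] by auto
  have sp_L2: "(\<lambda>x. softplus k (w x)) \<in> L2_space \<Omega>" if "w \<in> L2_space \<Omega>" for w
  proof (rule L2_bound[OF that meas(1)[OF that], where C = 1])
    show "AE x in lebesgue_on \<Omega>. \<bar>softplus k (w x)\<bar> \<le> 1 * \<bar>w x\<bar>"
      using softplus_lipschitz[OF k, of _ 0] by (intro AE_I2) simp
  qed
  have spd_L2: "(\<lambda>x. softplus_deriv k (w x) * g x) \<in> L2_space \<Omega>"
    if "w \<in> L2_space \<Omega>" "g \<in> L2_space \<Omega>" for w g
  proof (rule L2_mult_Linf[OF that(2)])
    show "(\<lambda>x. softplus_deriv k (w x)) \<in> Linf_space \<Omega>"
      unfolding Linf_space_def using meas(2)[OF that(1)] softplus_deriv_range[of k]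
      by (auto intro!: exI[of _ 1] AE_I2)
  qed
  have partial: "classical_partial i (\<lambda>x. softplus k (\<phi> n x)) x
      = softplus_deriv k (\<phi> n x) * classical_partial i (\<phi> n) x" for i n x
    by (intro partial_comp(2) softplus_has_derivative k smooth_differentiable test_smooth[OF \<phi>(1)])
  show ?thesis
    unfolding H10_gradient_def
  proof (intro conjI exI[of _ "\<lambda>n x. softplus k (\<phi> n x)"] allI)
    show "(\<lambda>n. L2_norm \<Omega> (\<lambda>x. softplus k (\<phi> n x) - softplus k (u x))) \<longlonglongrightarrow> 0"
    proof (rule Lim_null_comparison[OF _ \<phi>(2)], rule always_eventually, rule allI)
      fix n
      show "norm (L2_norm \<Omega> (\<lambda>x. softplus k (\<phi> n x) - softplus k (u x))) \<le> L2_norm \<Omega> (\<lambda>x. \<phi> n x - u x)"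
        unfolding real_norm_def abs_of_nonneg[OF L2_norm_nonneg]
        by (intro L2_norm_mono L2_diff sp_L2 \<phi>_L2 L2 AE_I2 softplus_lipschitz k)
    qed
    show "(\<lambda>n. L2_norm \<Omega> (\<lambda>x. classical_partial i (\<lambda>x. softplus k (\<phi> n x)) x - softplus_deriv k (u x) * D i x)) \<longlonglongrightarrow> 0" for i
    proof (rule Lim_null_comparison[OF always_eventually, OF allI])
      have "(\<lambda>n. L2_norm \<Omega> (\<lambda>x. (softplus_deriv k (\<phi> n x) - softplus_deriv k (u x)) * D i x)) \<longlonglongrightarrow> 0"
      proof (rule L2_norm_tendsto_AE[OF _ L2(2)[of i]])
        show "(\<lambda>x. (softplus_deriv k (\<phi> n x) - softplus_deriv k (u x)) * D i x) \<in> borel_measurable (lebesgue_on \<Omega>)" for n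
          using meas(2)[OF \<phi>_L2(1)[of n]] meas(2)[OF L2(1)] L2_measurable[OF L2(2)[of i]]
          by (intro borel_measurable_times borel_measurable_diff)
        show "AE x in lebesgue_on \<Omega>. (\<lambda>n. (softplus_deriv k (\<phi> n x) - softplus_deriv k (u x)) * D i x) \<longlonglongrightarrow> 0"
          using conv
        proof eventually_elim
          case (elim x)
          have "(\<lambda>n. softplus_deriv k (\<phi> n x)) \<longlonglongrightarrow> softplus_deriv k (u x)"
            by (rule isCont_tendsto_compose[OF isCont_softplus_deriv elim])
          then show ?case by (intro tendsto_mult_left_zero LIM_zero)
        qed
        show "AE x in lebesgue_on \<Omega>. \<bar>(softplus_deriv k (\<phi> n x) - softplus_deriv k (u x)) * D i x\<bar> \<le> \<bar>D i x\<bar>" for n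
        proof (intro AE_I2)
          fix x
          have "\<bar>softplus_deriv k (\<phi> n x) - softplus_deriv k (u x)\<bar> \<le> 1"
            using softplus_deriv_range[of k "\<phi> n x"] softplus_deriv_range[of k "u x"] by linarith
          then have "\<bar>softplus_deriv k (\<phi> n x) - softplus_deriv k (u x)\<bar> * \<bar>D i x\<bar> \<le> 1 * \<bar>D i x\<bar>"
            by (rule mult_right_mono) simp
          then show "\<bar>(softplus_deriv k (\<phi> n x) - softplus_deriv k (u x)) * D i x\<bar> \<le> \<bar>D i x\<bar>"
            by (simp add: abs_mult)
        qed
      qed
      from tendsto_add_zero[OF \<phi>(3)[of i] this]
      show "(\<lambda>n. L2_norm \<Omega> (\<lambda>x. classical_partial i (\<phi> n) x - D i x) +
        L2_norm \<Omega> (\<lambda>x. (softplus_deriv k (\<phi> n x) - softplus_deriv k (u x)) * D i x)) \<longlonglongrightarrow> 0" .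
      fix n
      have L2a: "(\<lambda>x. softplus_deriv k (\<phi> n x) * (classical_partial i (\<phi> n) x - D i x)) \<in> L2_space \<Omega>"
        by (intro spd_L2 L2_diff \<phi>_L2 L2)
      have L2b: "(\<lambda>x. (softplus_deriv k (\<phi> n x) - softplus_deriv k (u x)) * D i x) \<in> L2_space \<Omega>"
        using L2_diff[OF spd_L2[OF \<phi>_L2(1)[of n] L2(2)[of i]] spd_L2[OF L2(1) L2(2)[of i]]]
        by (simp add: left_diff_distrib)
      have "(\<lambda>x. classical_partial i (\<lambda>x. softplus k (\<phi> n x)) x - softplus_deriv k (u x) * D i x)
          = (\<lambda>x. softplus_deriv k (\<phi> n x) * (classical_partial i (\<phi> n) x - D i x)
              + (softplus_deriv k (\<phi> n x) - softplus_deriv k (u x)) * D i x)"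
        unfolding partial by (auto simp: algebra_simps)
      moreover have "L2_norm \<Omega> (\<lambda>x. softplus_deriv k (\<phi> n x) * (classical_partial i (\<phi> n) x - D i x))
          \<le> L2_norm \<Omega> (\<lambda>x. classical_partial i (\<phi> n) x - D i x)"
      proof (intro L2_norm_mono[OF L2a] L2_diff \<phi>_L2 L2 AE_I2)
        fix x
        have "\<bar>softplus_deriv k (\<phi> n x)\<bar> * \<bar>classical_partial i (\<phi> n) x - D i x\<bar>
            \<le> 1 * \<bar>classical_partial i (\<phi> n) x - D i x\<bar>"
          using softplus_deriv_range[of k "\<phi> n x"] by (intro mult_right_mono) auto
        then show "\<bar>softplus_deriv k (\<phi> n x) * (classical_partial i (\<phi> n) x - D i x)\<bar>
            \<le> \<bar>classical_partial i (\<phi> n) x - D i x\<bar>" by (simp add: abs_mult)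
      qed
      ultimately show "norm (L2_norm \<Omega> (\<lambda>x. classical_partial i (\<lambda>x. softplus k (\<phi> n x)) x - softplus_deriv k (u x) * D i x))
          \<le> L2_norm \<Omega> (\<lambda>x. classical_partial i (\<phi> n) x - D i x) +
            L2_norm \<Omega> (\<lambda>x. (softplus_deriv k (\<phi> n x) - softplus_deriv k (u x)) * D i x)"
        using L2_norm_triangle[OF L2a L2b] by simp
    qed
  qed (intro sp_L2 spd_L2 test_softplus L2 \<phi> k)+
qed

text \<open>Both sides are continuous along the approximating sequence, so gradient bounds on
  functionals pass from test functions to the whole space with the same constant.\<close>

lemma H10_gradient_extend:
  assumes \<Omega>: "open \<Omega>" and u: "H10_gradient \<Omega> u D" and v: "v \<in> L2_space \<Omega>"
    and test: "\<And>\<phi>. \<phi> \<in> test_functions \<Omega> \<Longrightarrow>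
      \<bar>L2_inner \<Omega> v \<phi>\<bar> \<le> C * L2m_norm \<Omega> (\<lambda>i. classical_partial i \<phi>)"
  shows "\<bar>L2_inner \<Omega> v u\<bar> \<le> C * L2m_norm \<Omega> D"
proof -
  have leb: "\<Omega> \<in> sets lebesgue" using \<Omega> by auto
  obtain \<phi> where \<phi>: "\<And>n::nat. \<phi> n \<in> test_functions \<Omega>" "(\<lambda>n. L2_norm \<Omega> (\<lambda>x. \<phi> n x - u x)) \<longlonglongrightarrow> 0"
    "\<And>i. (\<lambda>n. L2_norm \<Omega> (\<lambda>x. classical_partial i (\<phi> n) x - D i x)) \<longlonglongrightarrow> 0"
    and L2: "u \<in> L2_space \<Omega>" "\<And>i. D i \<in> L2_space \<Omega>"
    using u unfolding H10_gradient_def by blast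
  have "(\<lambda>n. \<bar>L2_inner \<Omega> (\<phi> n) v\<bar>) \<longlonglongrightarrow> \<bar>L2_inner \<Omega> u v\<bar>"
    by (intro tendsto_rabs L2_inner_tendsto test_L2[OF \<phi>(1) leb] L2 v \<phi>)
  moreover have "(\<lambda>n. C * L2m_norm \<Omega> (\<lambda>i. classical_partial i (\<phi> n))) \<longlonglongrightarrow> C * L2m_norm \<Omega> D"
    unfolding L2m_norm_eq
    by (intro tendsto_mult tendsto_const tendsto_real_sqrt tendsto_sum tendsto_power L2_norm_tendsto
        test_L2[OF test_partial[OF \<phi>(1)] leb] L2 \<phi>)
  ultimately have "\<bar>L2_inner \<Omega> u v\<bar> \<le> C * L2m_norm \<Omega> D"
    by (rule LIMSEQ_le) (use test[OF \<phi>(1)] in \<open>auto simp: L2_inner_commute[of _ _ v]\<close>)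
  then show ?thesis by (simp add: L2_inner_commute[of _ v])
qed

text \<open>The extension lemma is applied to the pairing with u itself: on test functions its
  constant is the norm of u times the Poincare constant, and dividing by the norm of u finishes the
  argument.\<close>

lemma Poincare_H10:
  fixes \<Omega> :: "(real^'n::finite) set"
  assumes \<Omega>: "open \<Omega>" "bounded \<Omega>"
  shows "\<exists>C\<ge>0. \<forall>u D. H10_gradient \<Omega> u D \<longrightarrow> L2_norm \<Omega> u \<le> C * L2m_norm \<Omega> D"
proof -
  have leb: "\<Omega> \<in> sets lebesgue" using \<Omega> by auto
  obtain C where C: "C \<ge> 0" "\<And>\<phi>. \<phi> \<in> test_functions \<Omega> \<Longrightarrow>
      L2_norm \<Omega> \<phi> \<le> C * L2m_norm \<Omega> (\<lambda>i. classical_partial i \<phi>)"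
    using Poincare_test[OF \<Omega>(2) leb] by blast
  have "L2_norm \<Omega> u \<le> C * L2m_norm \<Omega> D" if u: "H10_gradient \<Omega> u D" for u D
  proof -
    have L2: "u \<in> L2_space \<Omega>" using u by (simp add: H10_gradient_def)
    have "\<bar>L2_inner \<Omega> u u\<bar> \<le> (L2_norm \<Omega> u * C) * L2m_norm \<Omega> D"
    proof (rule H10_gradient_extend[OF \<Omega>(1) u L2])
      fix \<phi> assume \<phi>: "\<phi> \<in> test_functions \<Omega>"
      have "\<bar>L2_inner \<Omega> u \<phi>\<bar> \<le> L2_norm \<Omega> u * L2_norm \<Omega> \<phi>"
        by (rule L2_Cauchy_Schwarz[OF L2 test_L2[OF \<phi> leb]])
      also have "\<dots> \<le> L2_norm \<Omega> u * (C * L2m_norm \<Omega> (\<lambda>i. classical_partial i \<phi>))"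
        by (intro mult_left_mono C(2) \<phi>) simp
      finally show "\<bar>L2_inner \<Omega> u \<phi>\<bar> \<le> L2_norm \<Omega> u * C * L2m_norm \<Omega> (\<lambda>i. classical_partial i \<phi>)"
        by (simp add: mult.assoc)
    qed
    then have le: "L2_norm \<Omega> u * L2_norm \<Omega> u \<le> L2_norm \<Omega> u * (C * L2m_norm \<Omega> D)"
      using L2_norm_sq[of \<Omega> u] by (simp add: power2_eq_square mult.assoc)
    show ?thesis
    proof (cases "L2_norm \<Omega> u = 0")
      case True
      then show ?thesis using C(1) by simp
    next
      case False
      then have "L2_norm \<Omega> u > 0" using L2_norm_nonneg[of \<Omega> u] by linarith
      with le show ?thesis by simp
    qed
  qed
  with C(1) show ?thesis by blast
qed

lemma weakly_null_on_H10:
  fixes \<Omega> :: "(real^'n::finite) set" and v :: "nat \<Rightarrow> real^'n \<Rightarrow> real"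
  assumes "open \<Omega>" "bounded \<Omega>" "\<And>n. v n \<in> L2_space \<Omega>"
    and "\<And>g. g \<in> L2_space \<Omega> \<Longrightarrow> (\<lambda>n. L2_inner \<Omega> (v n) g) \<longlonglongrightarrow> 0" and "\<epsilon> > 0"
  shows "\<forall>\<^sub>F n in sequentially. \<forall>u D. H10_gradient \<Omega> u D \<longrightarrow>
    \<bar>L2_inner \<Omega> (v n) u\<bar> \<le> \<epsilon> * L2m_norm \<Omega> D"
  by (rule eventually_mono[OF weakly_null_on_test_functions[OF assms]])
     (use H10_gradient_extend[OF assms(1) _ assms(3)] in blast)+

section \<open>The state equation\<close>

lemma lebesgue_on_measurable_AE:
  fixes f g :: "'a::euclidean_space \<Rightarrow> real"
  assumes "\<Omega> \<in> sets lebesgue" "f \<in> borel_measurable (lebesgue_on \<Omega>)" "AE x in lebesgue_on \<Omega>. f x = g x"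
  shows "g \<in> borel_measurable (lebesgue_on \<Omega>)"
proof -
  have "(\<lambda>x. if x \<in> \<Omega> then f x else 0) \<in> borel_measurable lebesgue"
    using assms(1,2) by (simp add: borel_measurable_if)
  moreover have "AE x in lebesgue. (if x \<in> \<Omega> then f x else 0) = (if x \<in> \<Omega> then g x else 0)"
    using assms(1,3) by (subst (asm) AE_restrict_space_iff) auto
  ultimately have "(\<lambda>x. if x \<in> \<Omega> then g x else 0) \<in> borel_measurable lebesgue"
    by (rule borel_measurable_AE)
  then show ?thesis using assms(1) by (simp add: borel_measurable_if)
qed

text \<open>Rounding y down to multiples of 1/(n + 1) leaves countably many values, for which the
  composition is measurable. Continuity holds only for almost every x, so the limit is identified
  almost everywhere, and completeness of the measure does the rest.\<close>

lemma caratheodory_measurable: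
  fixes g :: "real^'n::finite \<Rightarrow> real \<Rightarrow> real"
  assumes \<Omega>: "\<Omega> \<in> sets lebesgue" and g: "caratheodory \<Omega> g"
    and y: "y \<in> borel_measurable (lebesgue_on \<Omega>)"
  shows "(\<lambda>x. g x (y x)) \<in> borel_measurable (lebesgue_on \<Omega>)"
proof -
  define q where "q n x = real_of_int \<lfloor>real (Suc n) * y x\<rfloor> / real (Suc n)" for n x
  have meas: "(\<lambda>x. g x (q n x)) \<in> borel_measurable (lebesgue_on \<Omega>)" for n
    unfolding q_def
  proof (rule measurable_compose_countable[where f = "\<lambda>i x. g x (real_of_int i / real (Suc n))"])
    show "(\<lambda>x. g x (real_of_int i / real (Suc n))) \<in> borel_measurable (lebesgue_on \<Omega>)" for i
      using g by (auto simp: caratheodory_def)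
    have "(\<lambda>x. real (Suc n) * y x) \<in> borel_measurable (lebesgue_on \<Omega>)" using y by measurable
    then show "(\<lambda>x. \<lfloor>real (Suc n) * y x\<rfloor>) \<in> measurable (lebesgue_on \<Omega>) (count_space UNIV)"
      by measurable
  qed
  have q: "(\<lambda>n. q n x) \<longlonglongrightarrow> y x" for x
  proof (rule LIM_zero_cancel, rule Lim_null_comparison[OF _ LIMSEQ_inverse_real_of_nat])
    show "\<forall>\<^sub>F n in sequentially. norm (q n x - y x) \<le> inverse (real (Suc n))"
    proof (rule always_eventually, rule allI)
      fix n
      have "\<bar>real_of_int \<lfloor>real (Suc n) * y x\<rfloor> - real (Suc n) * y x\<bar> \<le> 1" by linarith
      then have "\<bar>(real_of_int \<lfloor>real (Suc n) * y x\<rfloor> - real (Suc n) * y x) / real (Suc n)\<bar> \<le> 1 / real (Suc n)"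
        by (simp add: abs_divide divide_right_mono del: of_nat_Suc)
      moreover have "q n x - y x = (real_of_int \<lfloor>real (Suc n) * y x\<rfloor> - real (Suc n) * y x) / real (Suc n)"
        unfolding q_def by (simp add: diff_divide_distrib del: of_nat_Suc)
      ultimately show "norm (q n x - y x) \<le> inverse (real (Suc n))"
        by (simp only: real_norm_def inverse_eq_divide)
    qed
  qed
  have "AE x in lebesgue_on \<Omega>. continuous_on UNIV (g x)" using g by (simp add: caratheodory_def)
  then have ae: "AE x in lebesgue_on \<Omega>. lim (\<lambda>n. g x (q n x)) = g x (y x)"
  proof eventually_elim
    case (elim x)
    have "(\<lambda>n. g x (q n x)) \<longlonglongrightarrow> g x (y x)"
      by (rule continuous_on_tendsto_compose[OF elim q]) auto
    then show ?case by (rule limI)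
  qed
  have "(\<lambda>x. lim (\<lambda>n. g x (q n x))) \<in> borel_measurable (lebesgue_on \<Omega>)"
    by (rule borel_measurable_lim_metric) (rule meas)
  from lebesgue_on_measurable_AE[OF \<Omega> this ae] show ?thesis .
qed

lemma C2_real_has_derivative: "C2_real g \<Longrightarrow> (g has_real_derivative deriv g t) (at t)"
  by (simp add: C2_real_def DERIV_deriv_iff_field_differentiable)

lemma C2_real_lipschitz:
  assumes g: "C2_real g" and bound: "\<And>t. \<bar>t\<bar> \<le> M \<Longrightarrow> \<bar>deriv g t\<bar> \<le> C" and "\<bar>s\<bar> \<le> M" "\<bar>t\<bar> \<le> M"
  shows "\<bar>g s - g t\<bar> \<le> C * \<bar>s - t\<bar>"
proof -
  have "norm (g s - g t) \<le> C * norm (s - t)"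
  proof (rule field_differentiable_bound[where S = "{-M..M}" and f' = "deriv g"])
    show "(g has_field_derivative deriv g z) (at z within {-M..M})" for z
      using C2_real_has_derivative[OF g] by (rule has_field_derivative_at_within)
    show "norm (deriv g z) \<le> C" if "z \<in> {-M..M}" for z using bound[of z] that by auto
  qed (use assms in auto)
  then show ?thesis by simp
qed

lemma C2_real_mono:
  assumes g: "C2_real g" and "\<And>t. deriv g t \<ge> 0"
  shows "0 \<le> (g s - g t) * (s - t)"
proof -
  have mono: "g p \<le> g q" if "p \<le> q" for p q
    by (rule DERIV_nonneg_imp_nondecreasing[OF that]) (use C2_real_has_derivative[OF g] assms(2) in blast)
  show ?thesis
    using mono[of s t] mono[of t s] by (cases "s \<le> t") (auto intro: mult_nonneg_nonneg mult_nonpos_nonpos)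
qed

text \<open>A nonempty open set is not negligible. This turns the almost everywhere comparison of
  states into a bound at every point of the domain.\<close>

lemma continuous_on_AE_nonpos:
  fixes z :: "real^'n::finite \<Rightarrow> real"
  assumes "open \<Omega>" "continuous_on \<Omega> z" "AE x in lebesgue_on \<Omega>. z x \<le> 0" "x \<in> \<Omega>"
  shows "z x \<le> 0"
proof (rule ccontr)
  assume "\<not> z x \<le> 0"
  let ?S = "{x \<in> \<Omega>. z x > 0}"
  have "open ?S"
    using continuous_on_open_vimage[OF assms(1), of z] assms(2) open_greaterThan[of "0::real"]
    by (auto simp: vimage_def Int_def conj_commute greaterThan_def)
  moreover have "?S \<noteq> {}" using assms(4) \<open>\<not> z x \<le> 0\<close> by auto
  ultimately have "\<not> negligible ?S" by (rule open_not_negligible)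
  moreover have "AE x in lebesgue. x \<notin> ?S"
    using assms(1,3) by (subst (asm) AE_restrict_space_iff) (auto elim: eventually_mono)
  then have "negligible ?S"
    unfolding negligible_iff_null_sets using \<open>open ?S\<close> by (subst AE_iff_null_sets) auto
  ultimately show False by blast
qed

text \<open>The map y is any choice of weak solutions; its weak continuity and local boundedness are
  derived below from the weak formulation and the continuity of each single state.\<close>

locale state_equation =
  fixes \<Omega> :: "(real^'n::finite) set"
    and a :: "'n \<Rightarrow> 'n \<Rightarrow> real^'n \<Rightarrow> real"
    and f :: "real^'n \<Rightarrow> real \<Rightarrow> real"
    and y :: "(real^'n \<Rightarrow> real) \<Rightarrow> (real^'n \<Rightarrow> real)"
  assumes open_domain: "open \<Omega>" and bounded_domain: "bounded \<Omega>"
    and elliptic: "elliptic_coefficients \<Omega> a"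
    and nonlinearity: "state_nonlinearity \<Omega> f"
    and state: "\<And>w. w \<in> L2_space \<Omega> \<Longrightarrow> weak_solution \<Omega> a f w (y w)"
begin

lemma domain_measurable: "\<Omega> \<in> sets lebesgue"
  using open_domain by auto

lemma state_bounded:
  assumes "w \<in> L2_space \<Omega>"
  shows "\<exists>M>0. \<forall>x\<in>\<Omega>. \<bar>y w x\<bar> \<le> M"
proof -
  have "compact (y w ` closure \<Omega>)"
    using state[OF assms] bounded_domain by (intro compact_continuous_image) (auto simp: weak_solution_def)
  then obtain M where "\<forall>x\<in>closure \<Omega>. \<bar>y w x\<bar> \<le> M"
    using compact_imp_bounded[of "y w ` closure \<Omega>"] by (auto simp: bounded_iff)
  then have "\<forall>x\<in>\<Omega>. \<bar>y w x\<bar> \<le> max M 1" using closure_subset[of \<Omega>] by fastforce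
  then show ?thesis by (intro exI[of _ "max M 1"]) auto
qed

lemma state_gradient:
  "w \<in> L2_space \<Omega> \<Longrightarrow> H10_gradient \<Omega> (y w) (\<lambda>i. weak_partial \<Omega> i (y w))"
  using state by (intro H10_gradient_weak_partial open_domain) (auto simp: weak_solution_def)

lemma state_L2: "w \<in> L2_space \<Omega> \<Longrightarrow> y w \<in> L2_space \<Omega>"
  and state_partial_L2: "w \<in> L2_space \<Omega> \<Longrightarrow> weak_partial \<Omega> i (y w) \<in> L2_space \<Omega>"
  using state_gradient by (auto simp: H10_gradient_def)

lemma nonlinearity_L2:
  assumes w: "w \<in> L2_space \<Omega>"
  shows "(\<lambda>x. f x (y w x)) \<in> L2_space \<Omega>"
proof -
  obtain M where M: "M > 0" "\<And>x. x \<in> \<Omega> \<Longrightarrow> \<bar>y w x\<bar> \<le> M" using state_bounded[OF w] by blast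
  obtain C where C: "AE x in lebesgue_on \<Omega>.
      (\<forall>t. \<bar>t\<bar> \<le> M \<longrightarrow> \<bar>deriv (f x) t\<bar> + \<bar>deriv (deriv (f x)) t\<bar> \<le> C)"
    using nonlinearity M(1) unfolding state_nonlinearity_def by (force elim: eventually_mono)
  have C2: "AE x in lebesgue_on \<Omega>. C2_real (f x)" and car: "caratheodory \<Omega> f"
    and f0: "(\<lambda>x. f x 0) \<in> L2_space \<Omega>"
    using nonlinearity by (auto simp: state_nonlinearity_def caratheodory_C2_def)
  show ?thesis
  proof (rule L2_bound[where C = 1])
    show "(\<lambda>x. \<bar>f x 0\<bar> + \<bar>C * y w x\<bar>) \<in> L2_space \<Omega>"
      by (intro L2_intros f0 state_L2 w)
    show "(\<lambda>x. f x (y w x)) \<in> borel_measurable (lebesgue_on \<Omega>)"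
      by (rule caratheodory_measurable[OF domain_measurable car L2_measurable[OF state_L2[OF w]]])
    have "AE x in lebesgue_on \<Omega>. x \<in> \<Omega>" by (rule AE_I2) simp
    with C C2 show "AE x in lebesgue_on \<Omega>. \<bar>f x (y w x)\<bar> \<le> 1 * \<bar>\<bar>f x 0\<bar> + \<bar>C * y w x\<bar>\<bar>"
    proof eventually_elim
      case (elim x)
      have "\<bar>f x (y w x) - f x 0\<bar> \<le> C * \<bar>y w x - 0\<bar>"
      proof (rule C2_real_lipschitz[OF elim(2)])
        show "\<bar>deriv (f x) t\<bar> \<le> C" if "\<bar>t\<bar> \<le> M" for t
          using elim(1) that abs_ge_zero[of "deriv (deriv (f x)) t"] by (meson add_increasing2 order_trans order_refl)
      qed (use M elim(3) in auto)
      also have "\<dots> \<le> \<bar>C * y w x\<bar>" by (simp add: abs_mult mult_right_mono)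
      finally have "\<bar>f x (y w x)\<bar> \<le> \<bar>f x 0\<bar> + \<bar>C * y w x\<bar>" by linarith
      then show ?case by simp
    qed
  qed
qed

text \<open>A form in gradients and not in functions, so that differences and multiples of gradients
  can be inserted directly, whichever representatives \<open>weak_partial\<close> selects.\<close>

definition energy_form :: "('n \<Rightarrow> real^'n \<Rightarrow> real) \<Rightarrow> ('n \<Rightarrow> real^'n \<Rightarrow> real) \<Rightarrow> real" where
  "energy_form D E = (LINT x|lebesgue_on \<Omega>. (\<Sum>i\<in>UNIV. \<Sum>j\<in>UNIV. a i j x * D i x * E j x))"

lemma energy_form_integrable:
  assumes "\<And>i. D i \<in> L2_space \<Omega>" "\<And>i. E i \<in> L2_space \<Omega>"
  shows "integrable (lebesgue_on \<Omega>) (\<lambda>x. \<Sum>i\<in>UNIV. \<Sum>j\<in>UNIV. a i j x * D i x * E j x)"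
  using elliptic
  by (intro Bochner_Integration.integrable_sum L2_integrable_mult L2_mult_Linf assms)
     (auto simp: elliptic_coefficients_def)

lemma energy_form_diff_left:
  assumes "\<And>i. D i \<in> L2_space \<Omega>" "\<And>i. D' i \<in> L2_space \<Omega>" "\<And>i. E i \<in> L2_space \<Omega>"
  shows "energy_form (\<lambda>i x. D i x - D' i x) E = energy_form D E - energy_form D' E"
proof -
  have "(\<Sum>i\<in>UNIV. \<Sum>j\<in>UNIV. a i j x * (D i x - D' i x) * E j x)
      = (\<Sum>i\<in>UNIV. \<Sum>j\<in>UNIV. a i j x * D i x * E j x) - (\<Sum>i\<in>UNIV. \<Sum>j\<in>UNIV. a i j x * D' i x * E j x)" for x
    by (simp add: algebra_simps sum_subtractf)
  then show ?thesis
    unfolding energy_form_def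
    using energy_form_integrable[OF assms(1,3)] energy_form_integrable[OF assms(2,3)] by simp
qed

lemma weak_formulation:
  assumes w: "w \<in> L2_space \<Omega>" and v: "H10_gradient \<Omega> v E"
  shows "energy_form (\<lambda>i. weak_partial \<Omega> i (y w)) E + L2_inner \<Omega> (\<lambda>x. f x (y w x)) v = L2_inner \<Omega> w v"
proof -
  note v' = H10_gradient_imp_H10[OF open_domain v]
  have L2: "weak_partial \<Omega> i v \<in> L2_space \<Omega>" "E i \<in> L2_space \<Omega>" for i
    using H10_gradient_weak_partial[OF open_domain v'(1)] v by (auto simp: H10_gradient_def)
  have "energy_form (\<lambda>i. weak_partial \<Omega> i (y w)) (\<lambda>i. weak_partial \<Omega> i v)
      = energy_form (\<lambda>i. weak_partial \<Omega> i (y w)) E"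
    unfolding energy_form_def
  proof (rule integral_cong_AE)
    have "AE x in lebesgue_on \<Omega>. \<forall>i\<in>UNIV. weak_partial \<Omega> i v x = E i x"
      by (subst AE_finite_all) (auto intro: v'(2))
    then show "AE x in lebesgue_on \<Omega>.
        (\<Sum>i\<in>UNIV. \<Sum>j\<in>UNIV. a i j x * weak_partial \<Omega> i (y w) x * weak_partial \<Omega> j v x)
        = (\<Sum>i\<in>UNIV. \<Sum>j\<in>UNIV. a i j x * weak_partial \<Omega> i (y w) x * E j x)"
      by eventually_elim simp
  qed (rule borel_measurable_integrable[OF energy_form_integrable[OF state_partial_L2[OF w]]], rule L2)+
  moreover have "energy_form (\<lambda>i. weak_partial \<Omega> i (y w)) (\<lambda>i. weak_partial \<Omega> i v)
      + L2_inner \<Omega> (\<lambda>x. f x (y w x)) v = L2_inner \<Omega> w v"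
    using state[OF w] v'(1) unfolding weak_solution_def energy_form_def L2_inner_def by blast
  ultimately show ?thesis by simp
qed

lemma weak_formulation_diff:
  assumes w: "w \<in> L2_space \<Omega>" "w' \<in> L2_space \<Omega>" and v: "H10_gradient \<Omega> v E"
  shows "energy_form (\<lambda>i x. weak_partial \<Omega> i (y w) x - weak_partial \<Omega> i (y w') x) E
      = L2_inner \<Omega> (\<lambda>x. w x - w' x) v - L2_inner \<Omega> (\<lambda>x. f x (y w x) - f x (y w' x)) v"
proof -
  have "v \<in> L2_space \<Omega>" "\<And>i. E i \<in> L2_space \<Omega>" using v by (auto simp: H10_gradient_def)
  then show ?thesis
    using weak_formulation[OF w(1) v] weak_formulation[OF w(2) v]
    by (simp add: energy_form_diff_left state_partial_L2 w L2_inner_diff_left nonlinearity_L2)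
qed

text \<open>The weight g serves two tests: g = 1 in the energy estimate, and the derivative of
  \<open>softplus\<close> in the comparison principle, where g D is the gradient of the function
  tested with. Since 0 \<le> g \<le> 1, the square of g is at most g.\<close>

lemma energy_form_coercive:
  "\<exists>c>0. \<forall>D g. (\<forall>i. D i \<in> L2_space \<Omega>) \<longrightarrow> (\<forall>i. (\<lambda>x. g x * D i x) \<in> L2_space \<Omega>) \<longrightarrow>
    (\<forall>x. 0 \<le> g x \<and> g x \<le> 1) \<longrightarrow>
    c * (L2m_norm \<Omega> (\<lambda>i x. g x * D i x))\<^sup>2 \<le> energy_form D (\<lambda>i x. g x * D i x)"
proof -
  obtain c where c: "c > 0" "AE x in lebesgue_on \<Omega>. \<forall>\<xi>::real^'n.
        c * (norm \<xi>)\<^sup>2 \<le> (\<Sum>i\<in>UNIV. \<Sum>j\<in>UNIV. a i j x * \<xi> $ i * \<xi> $ j)"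
    using elliptic by (auto simp: elliptic_coefficients_def)
  have "c * (L2m_norm \<Omega> (\<lambda>i x. g x * D i x))\<^sup>2 \<le> energy_form D (\<lambda>i x. g x * D i x)"
    if D: "\<forall>i. D i \<in> L2_space \<Omega>" and gD: "\<forall>i. (\<lambda>x. g x * D i x) \<in> L2_space \<Omega>"
      and g: "\<forall>x. 0 \<le> g x \<and> g x \<le> 1" for D g
  proof -
    have int: "integrable (lebesgue_on \<Omega>) (\<lambda>x. (g x * D i x)\<^sup>2)" for i
      using L2_integrable_sq gD by blast
    have "c * (L2m_norm \<Omega> (\<lambda>i x. g x * D i x))\<^sup>2
        = (LINT x|lebesgue_on \<Omega>. c * (\<Sum>i\<in>UNIV. (g x * D i x)\<^sup>2))"
      unfolding L2m_norm_sq L2_norm_sq L2_inner_self using int by simp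
    also have "\<dots> \<le> energy_form D (\<lambda>i x. g x * D i x)"
      unfolding energy_form_def
    proof (rule integral_mono_AE)
      show "integrable (lebesgue_on \<Omega>) (\<lambda>x. c * (\<Sum>i\<in>UNIV. (g x * D i x)\<^sup>2))" using int by simp
      show "integrable (lebesgue_on \<Omega>) (\<lambda>x. \<Sum>i\<in>UNIV. \<Sum>j\<in>UNIV. a i j x * D i x * (g x * D j x))"
        by (rule energy_form_integrable) (use D gD in auto)
      show "AE x in lebesgue_on \<Omega>. c * (\<Sum>i\<in>UNIV. (g x * D i x)\<^sup>2)
          \<le> (\<Sum>i\<in>UNIV. \<Sum>j\<in>UNIV. a i j x * D i x * (g x * D j x))"
        using c(2)
      proof eventually_elim
        case (elim x)
        let ?\<xi> = "\<chi> i. D i x"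
        have "c * (\<Sum>i\<in>UNIV. (g x * D i x)\<^sup>2) = (g x)\<^sup>2 * (c * (norm ?\<xi>)\<^sup>2)"
          by (simp add: norm_vec_def L2_set_def sum_nonneg power_mult_distrib sum_distrib_left mult_ac)
        also have "\<dots> \<le> g x * (c * (norm ?\<xi>)\<^sup>2)"
          using g c(1) by (intro mult_right_mono) (auto simp: power2_eq_square mult_left_le_one_le)
        also have "\<dots> \<le> g x * (\<Sum>i\<in>UNIV. \<Sum>j\<in>UNIV. a i j x * ?\<xi> $ i * ?\<xi> $ j)"
          using g elim by (intro mult_left_mono) blast+
        also have "\<dots> = (\<Sum>i\<in>UNIV. \<Sum>j\<in>UNIV. a i j x * D i x * (g x * D j x))"
          by (simp add: sum_distrib_left mult_ac)
        finally show ?case .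
      qed
    qed
    finally show ?thesis .
  qed
  with c(1) show ?thesis by blast
qed

lemma nonlinearity_monotone:
  "AE x in lebesgue_on \<Omega>. \<forall>s t. 0 \<le> (f x s - f x t) * (s - t)"
proof -
  have "AE x in lebesgue_on \<Omega>. C2_real (f x)" "AE x in lebesgue_on \<Omega>. \<forall>t. deriv (f x) t \<ge> 0"
    using nonlinearity by (auto simp: state_nonlinearity_def caratheodory_C2_def)
  then show ?thesis by eventually_elim (blast intro: C2_real_mono)
qed

lemma state_weak_to_strong:
  assumes w: "\<And>n. w n \<in> L2_space \<Omega>" "w0 \<in> L2_space \<Omega>"
    and weak: "\<And>g. g \<in> L2_space \<Omega> \<Longrightarrow> (\<lambda>n. L2_inner \<Omega> (w n) g) \<longlonglongrightarrow> L2_inner \<Omega> w0 g"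
  shows "(\<lambda>n. L2_norm \<Omega> (\<lambda>x. y (w n) x - y w0 x)) \<longlonglongrightarrow> 0"
proof -
  obtain c where c: "c > 0" "\<And>D g. (\<forall>i. D i \<in> L2_space \<Omega>) \<Longrightarrow> (\<forall>i. (\<lambda>x. g x * D i x) \<in> L2_space \<Omega>) \<Longrightarrow>
    (\<forall>x. 0 \<le> g x \<and> g x \<le> 1) \<Longrightarrow>
    c * (L2m_norm \<Omega> (\<lambda>i x. g x * D i x))\<^sup>2 \<le> energy_form D (\<lambda>i x. g x * D i x)"
    using energy_form_coercive by blast
  obtain C where C: "C \<ge> 0" "\<And>u D. H10_gradient \<Omega> u D \<Longrightarrow> L2_norm \<Omega> u \<le> C * L2m_norm \<Omega> D"
    using Poincare_H10[OF open_domain bounded_domain] by blast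
  define z where "z = (\<lambda>n x. y (w n) x - y w0 x)"
  define D where "D = (\<lambda>n i x. weak_partial \<Omega> i (y (w n)) x - weak_partial \<Omega> i (y w0) x)"
  have zD: "H10_gradient \<Omega> (z n) (D n)" for n
    unfolding z_def D_def by (intro H10_gradient_diff open_domain state_gradient w)
  have D_L2: "D n i \<in> L2_space \<Omega>" for n i
    using zD[of n] by (auto simp: H10_gradient_def)
  have energy: "c * (L2m_norm \<Omega> (D n))\<^sup>2 \<le> L2_inner \<Omega> (\<lambda>x. w n x - w0 x) (z n)" for n
  proof -
    have "c * (L2m_norm \<Omega> (D n))\<^sup>2 \<le> energy_form (D n) (D n)"
      using c(2)[of "D n" "\<lambda>x. 1"] D_L2 by simp
    also have "\<dots> = L2_inner \<Omega> (\<lambda>x. w n x - w0 x) (z n)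
        - L2_inner \<Omega> (\<lambda>x. f x (y (w n) x) - f x (y w0 x)) (z n)"
      using weak_formulation_diff[OF w(1)[of n] w(2) zD[of n]] by (simp add: D_def)
    also have "0 \<le> L2_inner \<Omega> (\<lambda>x. f x (y (w n) x) - f x (y w0 x)) (z n)"
      unfolding L2_inner_def z_def
      by (rule integral_nonneg_AE) (use nonlinearity_monotone in \<open>eventually_elim, simp\<close>)
    then have "L2_inner \<Omega> (\<lambda>x. w n x - w0 x) (z n)
        - L2_inner \<Omega> (\<lambda>x. f x (y (w n) x) - f x (y w0 x)) (z n) \<le> L2_inner \<Omega> (\<lambda>x. w n x - w0 x) (z n)" by simp
    finally show ?thesis .
  qed
  have null: "(\<lambda>n. L2_inner \<Omega> (\<lambda>x. w n x - w0 x) g) \<longlonglongrightarrow> 0" if "g \<in> L2_space \<Omega>" for g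
    using LIM_zero[OF weak[OF that]] by (simp add: L2_inner_diff_left w that)
  show ?thesis
  proof (rule LIMSEQ_I)
    fix r :: real assume r: "r > 0"
    \<comment> \<open>The energy estimate gives a gradient norm of at most \<epsilon> / c, hence by
      Poincare a norm of at most C \<epsilon> / c, which is below r; \<open>C + 1\<close> guards
      against \<open>C = 0\<close>.\<close>
    define \<epsilon> where "\<epsilon> = c * r / (2 * (C + 1))"
    have \<epsilon>: "\<epsilon> > 0" using c(1) C(1) r by (simp add: \<epsilon>_def)
    obtain N where N: "\<And>n u D. n \<ge> N \<Longrightarrow> H10_gradient \<Omega> u D \<Longrightarrow>
        \<bar>L2_inner \<Omega> (\<lambda>x. w n x - w0 x) u\<bar> \<le> \<epsilon> * L2m_norm \<Omega> D"
      using weakly_null_on_H10[OF open_domain bounded_domain L2_diff[OF w] null \<epsilon>]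
      unfolding eventually_sequentially by blast
    have "L2_norm \<Omega> (z n) < r" if "n \<ge> N" for n
    proof -
      have "c * (L2m_norm \<Omega> (D n))\<^sup>2 \<le> \<epsilon> * L2m_norm \<Omega> (D n)"
        using energy[of n] N[OF that zD[of n]] by linarith
      then have "L2m_norm \<Omega> (D n) \<le> \<epsilon> / c"
      proof (cases "L2m_norm \<Omega> (D n) = 0")
        case False
        then have "L2m_norm \<Omega> (D n) > 0" using L2m_norm_nonneg[of \<Omega> "D n"] by linarith
        moreover assume "c * (L2m_norm \<Omega> (D n))\<^sup>2 \<le> \<epsilon> * L2m_norm \<Omega> (D n)"
        ultimately show ?thesis using c(1) by (simp add: power2_eq_square field_simps)
      qed (use c \<epsilon> in simp)
      then have "L2_norm \<Omega> (z n) \<le> C * (\<epsilon> / c)"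
        using C(2)[OF zD[of n]] C(1) by (meson mult_left_mono order_trans)
      also have "\<dots> = (C / (C + 1)) * (r / 2)" using c(1) by (simp add: \<epsilon>_def)
      also have "\<dots> \<le> 1 * (r / 2)" using C(1) r by (intro mult_right_mono) auto
      also have "\<dots> < r" using r by simp
      finally show ?thesis .
    qed
    then show "\<exists>no. \<forall>n\<ge>no. norm (L2_norm \<Omega> (\<lambda>x. y (w n) x - y w0 x) - 0) < r"
      unfolding z_def by auto
  qed
qed

text \<open>The comparison principle tests with \<open>softplus k\<close> of the difference of the states, a smooth
  approximation of its positive part.\<close>

lemma comparison_principle:
  assumes w: "w \<in> L2_space \<Omega>" "w' \<in> L2_space \<Omega>" and le: "AE x in lebesgue_on \<Omega>. w x \<le> w' x"
    and x: "x \<in> \<Omega>"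
  shows "y w x \<le> y w' x"
proof -
  obtain c where c: "c > 0" "\<And>D g. (\<forall>i. D i \<in> L2_space \<Omega>) \<Longrightarrow> (\<forall>i. (\<lambda>x. g x * D i x) \<in> L2_space \<Omega>) \<Longrightarrow>
    (\<forall>x. 0 \<le> g x \<and> g x \<le> 1) \<Longrightarrow>
    c * (L2m_norm \<Omega> (\<lambda>i x. g x * D i x))\<^sup>2 \<le> energy_form D (\<lambda>i x. g x * D i x)"
    using energy_form_coercive by blast
  obtain C where C: "C \<ge> 0" "\<And>u D. H10_gradient \<Omega> u D \<Longrightarrow> L2_norm \<Omega> u \<le> C * L2m_norm \<Omega> D"
    using Poincare_H10[OF open_domain bounded_domain] by blast
  define z where "z = (\<lambda>x. y w x - y w' x)"
  define D where "D = (\<lambda>i x. weak_partial \<Omega> i (y w) x - weak_partial \<Omega> i (y w') x)"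
  define F where "F = (\<lambda>x. f x (y w x) - f x (y w' x))"
  define W where "W = (\<lambda>x. w x - w' x)"
  define p where "p = (\<lambda>x. max 0 (z x))"
  have zD: "H10_gradient \<Omega> z D"
    unfolding z_def D_def by (intro H10_gradient_diff open_domain state_gradient w)
  have D_L2: "D i \<in> L2_space \<Omega>" and z_L2: "z \<in> L2_space \<Omega>" for i
    using zD by (auto simp: H10_gradient_def)
  have F_L2: "F \<in> L2_space \<Omega>" unfolding F_def by (intro L2_diff nonlinearity_L2 w)
  have W_L2: "W \<in> L2_space \<Omega>" unfolding W_def by (intro L2_diff w)
  have p_L2: "p \<in> L2_space \<Omega>"
  proof (rule L2_bound[OF z_L2, where C = 1])
    show "p \<in> borel_measurable (lebesgue_on \<Omega>)"
      unfolding p_def using L2_measurable[OF z_L2] by measurable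
  qed (auto simp: p_def)
  define v where "v = (\<lambda>n x. softplus (real (Suc n)) (z x))"
  define E where "E = (\<lambda>n i x. softplus_deriv (real (Suc n)) (z x) * D i x)"
  have vE: "H10_gradient \<Omega> (v n) (E n)" for n
    unfolding v_def E_def by (intro H10_gradient_softplus open_domain zD) simp
  have v_L2: "v n \<in> L2_space \<Omega>" and E_L2: "E n i \<in> L2_space \<Omega>" for n i
    using vE[of n] by (auto simp: H10_gradient_def)
  \<comment> \<open>Poincare replaces the gradient by \<open>v n\<close> itself. The limit then
    involves norms and inner products of functions only, and the gradient of the positive part never
    has to be identified.\<close>
  have bound: "c * (L2_norm \<Omega> (v n))\<^sup>2 \<le> C\<^sup>2 * (L2_inner \<Omega> W (v n) - L2_inner \<Omega> F (v n))" for n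
  proof -
    have "c * (L2_norm \<Omega> (v n))\<^sup>2 \<le> c * (C * L2m_norm \<Omega> (E n))\<^sup>2"
      using c(1) C(2)[OF vE[of n]] by (intro mult_left_mono power_mono) auto
    also have "\<dots> = C\<^sup>2 * (c * (L2m_norm \<Omega> (E n))\<^sup>2)" by (simp add: power_mult_distrib)
    also have "\<dots> \<le> C\<^sup>2 * energy_form D (E n)"
      using c(2)[of D "\<lambda>x. softplus_deriv (real (Suc n)) (z x)"] D_L2 E_L2[of n]
        softplus_deriv_range[of "real (Suc n)"]
      by (intro mult_left_mono) (auto simp: E_def)
    also have "energy_form D (E n) = L2_inner \<Omega> W (v n) - L2_inner \<Omega> F (v n)"
      using weak_formulation_diff[OF w vE] by (simp add: D_def W_def F_def)
    finally show ?thesis .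
  qed
  have v_p: "(\<lambda>n. L2_norm \<Omega> (\<lambda>x. v n x - p x)) \<longlonglongrightarrow> 0"
  proof (rule Lim_null_comparison)
    show "(\<lambda>n. \<bar>ln 2 * inverse (real (Suc n))\<bar> * L2_norm \<Omega> (\<lambda>x::real^'n. 1)) \<longlonglongrightarrow> 0"
      by (intro tendsto_mult_left_zero tendsto_rabs_zero tendsto_mult_right_zero LIMSEQ_inverse_real_of_nat)
    have "L2_norm \<Omega> (\<lambda>x. v n x - p x) \<le> L2_norm \<Omega> (\<lambda>x::real^'n. ln 2 * inverse (real (Suc n)) * 1)" for n
    proof (intro L2_norm_mono L2_diff v_L2 p_L2 L2_const bounded_domain open_domain AE_I2)
      fix x
      show "\<bar>v n x - p x\<bar> \<le> \<bar>ln 2 * inverse (real (Suc n)) * 1\<bar>"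
        using softplus_approx[of "real (Suc n)" "z x"] abs_ge_self[of "ln 2 / real (Suc n)"]
        unfolding v_def p_def divide_inverse mult_1_right by linarith
    qed
    then show "\<forall>\<^sub>F n in sequentially. norm (L2_norm \<Omega> (\<lambda>x. v n x - p x))
        \<le> \<bar>ln 2 * inverse (real (Suc n))\<bar> * L2_norm \<Omega> (\<lambda>x::real^'n. 1)"
      unfolding L2_norm_cmult by simp
  qed
  have "c * (L2_norm \<Omega> p)\<^sup>2 \<le> C\<^sup>2 * (L2_inner \<Omega> W p - L2_inner \<Omega> F p)"
  proof (rule LIMSEQ_le)
    show "(\<lambda>n. c * (L2_norm \<Omega> (v n))\<^sup>2) \<longlonglongrightarrow> c * (L2_norm \<Omega> p)\<^sup>2"
      by (intro tendsto_mult tendsto_const tendsto_power L2_norm_tendsto v_L2 p_L2 v_p)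
    show "(\<lambda>n. C\<^sup>2 * (L2_inner \<Omega> W (v n) - L2_inner \<Omega> F (v n)))
        \<longlonglongrightarrow> C\<^sup>2 * (L2_inner \<Omega> W p - L2_inner \<Omega> F p)"
      unfolding L2_inner_commute[of \<Omega> W] L2_inner_commute[of \<Omega> F]
      by (intro tendsto_mult tendsto_const tendsto_diff L2_inner_tendsto v_L2 p_L2 v_p W_L2 F_L2)
  qed (use bound in blast)
  \<comment> \<open>\<open>W\<close> is nonpositive and \<open>p\<close> nonnegative; by
    monotonicity \<open>F\<close> and \<open>z\<close> never have opposite signs.\<close>
  also have "\<dots> \<le> 0"
  proof -
    have "L2_inner \<Omega> W p \<le> (LINT x|lebesgue_on \<Omega>. 0)"
      unfolding L2_inner_def
    proof (rule integral_mono_AE[OF L2_integrable_mult[OF W_L2 p_L2]])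
      show "AE x in lebesgue_on \<Omega>. W x * p x \<le> 0"
        using le by eventually_elim (auto simp: W_def p_def intro!: mult_nonpos_nonneg)
    qed simp
    moreover have "0 \<le> L2_inner \<Omega> F p"
      unfolding L2_inner_def
    proof (rule integral_nonneg_AE)
      show "AE x in lebesgue_on \<Omega>. 0 \<le> F x * p x"
        using nonlinearity_monotone
      proof eventually_elim
        case (elim x)
        then have "0 \<le> F x * z x" by (simp add: F_def z_def)
        then show ?case by (auto simp: p_def max_def)
      qed
    qed
    ultimately show ?thesis by (intro mult_nonneg_nonpos) auto
  qed
  finally have "c * (L2_norm \<Omega> p)\<^sup>2 \<le> 0" .
  then have "L2_norm \<Omega> p = 0" using c(1) by (simp add: mult_le_0_iff)
  then have "AE x in lebesgue_on \<Omega>. p x = 0" by (rule L2_norm_zero_imp_AE[OF p_L2])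
  then have "AE x in lebesgue_on \<Omega>. z x \<le> 0" by eventually_elim (simp add: p_def max_def split: if_splits)
  moreover have "continuous_on \<Omega> z"
    unfolding z_def using state[OF w(1)] state[OF w(2)] closure_subset[of \<Omega>]
    by (intro continuous_on_diff) (auto simp: weak_solution_def intro: continuous_on_subset)
  ultimately have "z x \<le> 0" using continuous_on_AE_nonpos[OF open_domain] x by blast
  then show ?thesis by (simp add: z_def)
qed

text \<open>Local boundedness is a gliding hump: if perturbations \<open>v j\<close> with \<open>L2_norm \<Omega> (v j) \<le> 3\<^sup>-\<^sup>j\<close> produced
  states of size \<open>j\<close>, the comparison principle would make one of the states of
  \<open>w \<plusminus> (\<Sum>j. \<bar>v j\<bar>)\<close> unbounded.\<close>

lemma state_locally_bounded:
  assumes w: "w \<in> L2_space \<Omega>"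
  shows "\<exists>\<delta>>0. \<exists>M>0. \<forall>v\<in>L2_space \<Omega>. L2_norm \<Omega> v \<le> \<delta> \<longrightarrow> (\<forall>x\<in>\<Omega>. \<bar>y (\<lambda>x. w x + v x) x\<bar> \<le> M)"
proof (rule ccontr)
  assume contra: "\<not> ?thesis"
  \<comment> \<open>The negated claim with \<delta> = \<open>(1/3) ^ j\<close>, the decay required
    by \<open>L2_series\<close>, and M = \<open>Suc j\<close>, which is positive also for j =
    0.\<close>
  have "\<exists>v\<in>L2_space \<Omega>. L2_norm \<Omega> v \<le> (1/3) ^ j \<and> (\<exists>x\<in>\<Omega>. real (Suc j) < \<bar>y (\<lambda>x. w x + v x) x\<bar>)" for j :: nat
  proof (rule ccontr)
    assume "\<not> ?thesis"
    then have "\<forall>v\<in>L2_space \<Omega>. L2_norm \<Omega> v \<le> (1/3) ^ j \<longrightarrow> (\<forall>x\<in>\<Omega>. \<bar>y (\<lambda>x. w x + v x) x\<bar> \<le> real (Suc j))"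
      by (meson not_le)
    moreover have "(1/3::real) ^ j > 0" "real (Suc j) > 0" by simp_all
    ultimately show False using contra by blast
  qed
  then obtain v where v: "\<And>j::nat. v j \<in> L2_space \<Omega>" "\<And>j. L2_norm \<Omega> (v j) \<le> (1/3) ^ j"
    "\<And>j. \<exists>x\<in>\<Omega>. real (Suc j) < \<bar>y (\<lambda>x. w x + v j x) x\<bar>"
    by metis
  define V where "V x = (\<Sum>j. \<bar>v j x\<bar>)" for x
  have V: "AE x in lebesgue_on \<Omega>. summable (\<lambda>j. \<bar>v j x\<bar>)" "V \<in> L2_space \<Omega>"
    unfolding V_def using L2_series[OF v(1,2)] by auto
  have le: "AE x in lebesgue_on \<Omega>. \<bar>v j x\<bar> \<le> V x" for j
    using V(1)
  proof eventually_elim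
    case (elim x)
    then show ?case unfolding V_def using sum_le_suminf[OF elim, of "{j}"] by auto
  qed
  have L2: "(\<lambda>x. w x + v j x) \<in> L2_space \<Omega>" "(\<lambda>x. w x + V x) \<in> L2_space \<Omega>" "(\<lambda>x. w x - V x) \<in> L2_space \<Omega>" for j
    by (intro L2_intros w v V)+
  obtain M1 where M1: "\<And>x. x \<in> \<Omega> \<Longrightarrow> \<bar>y (\<lambda>x. w x + V x) x\<bar> \<le> M1" using state_bounded[OF L2(2)] by blast
  obtain M2 where M2: "\<And>x. x \<in> \<Omega> \<Longrightarrow> \<bar>y (\<lambda>x. w x - V x) x\<bar> \<le> M2" using state_bounded[OF L2(3)] by blast
  obtain j :: nat where j: "real j > max M1 M2" using reals_Archimedean2 by blast
  obtain x where x: "x \<in> \<Omega>" "real (Suc j) < \<bar>y (\<lambda>x. w x + v j x) x\<bar>" using v(3) by blast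
  have "y (\<lambda>x. w x + v j x) x \<le> y (\<lambda>x. w x + V x) x"
    by (rule comparison_principle[OF L2(1,2) _ x(1)]) (use le[of j] in \<open>eventually_elim, simp\<close>)
  moreover have "y (\<lambda>x. w x - V x) x \<le> y (\<lambda>x. w x + v j x) x"
    by (rule comparison_principle[OF L2(3,1) _ x(1)]) (use le[of j] in \<open>eventually_elim, simp\<close>)
  ultimately show False using M1[OF x(1)] M2[OF x(1)] j x(2) by (simp add: abs_le_iff) linarith
qed

end

section \<open>Product space\<close>

lemma L2m_component: "u \<in> L2m_space \<Omega> \<Longrightarrow> u k \<in> L2_space \<Omega>"
  by (simp add: L2m_space_def)

lemma L2m_norm_L2_set: "L2m_norm \<Omega> u = L2_set (\<lambda>k. L2_norm \<Omega> (u k)) UNIV"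
  by (simp add: L2m_norm_eq L2_set_def)

lemma L2m_norm_triangle:
  assumes "u \<in> L2m_space \<Omega>" "v \<in> L2m_space \<Omega>"
  shows "L2m_norm \<Omega> (\<lambda>k x. u k x + v k x) \<le> L2m_norm \<Omega> u + L2m_norm \<Omega> v"
proof -
  have "L2m_norm \<Omega> (\<lambda>k x. u k x + v k x) \<le> L2_set (\<lambda>k. L2_norm \<Omega> (u k) + L2_norm \<Omega> (v k)) UNIV"
    unfolding L2m_norm_L2_set
    by (rule L2_set_mono) (auto intro!: L2_norm_triangle L2m_component assms)
  also have "\<dots> \<le> L2m_norm \<Omega> u + L2m_norm \<Omega> v"
    unfolding L2m_norm_L2_set by (rule L2_set_triangle_ineq)
  finally show ?thesis .
qed

lemma L2m_norm_cmult: "L2m_norm \<Omega> (\<lambda>k x. c * u k x) = \<bar>c\<bar> * L2m_norm \<Omega> u"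
  by (simp add: L2m_norm_eq L2_norm_cmult power_mult_distrib sum_distrib_left[symmetric] real_sqrt_mult)

text \<open>The direction in which only player k deviates. Applied to a constant family, it embeds a
  single function as the k-th component.\<close>

definition single :: "'m \<Rightarrow> ('m \<Rightarrow> real^'n \<Rightarrow> real) \<Rightarrow> 'm \<Rightarrow> real^'n \<Rightarrow> real" where
  "single k h j x = (if j = k then h j x else 0)"

lemma single_eq: "single k h j = (if j = k then h j else (\<lambda>x. 0))"
  by (auto simp: single_def)

lemma single_L2m: "h \<in> L2m_space \<Omega> \<Longrightarrow> single k h \<in> L2m_space \<Omega>"
  by (auto simp: L2m_space_def single_eq L2_zero)

lemma L2m_combination:
  "h \<in> L2m_space \<Omega> \<Longrightarrow> h' \<in> L2m_space \<Omega> \<Longrightarrow> (\<lambda>j x. t * h j x + s * h' j x) \<in> L2m_space \<Omega>"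
  by (auto simp: L2m_space_def intro!: L2_add L2_cmult)

lemma L2_norm_zero: "L2_norm \<Omega> (\<lambda>x. 0) = 0"
  by (simp add: L2_norm_def L2_inner_def)

lemma L2m_inner_single:
  "L2m_inner \<Omega> u (single k (\<lambda>_. g)) = L2_inner \<Omega> (u k) g"
proof -
  have "L2m_inner \<Omega> u (single k (\<lambda>_. g)) = (\<Sum>j\<in>UNIV. if j = k then L2_inner \<Omega> (u j) g else 0)"
    unfolding L2m_inner_def by (rule sum.cong) (auto simp: single_eq L2_inner_def)
  then show ?thesis by simp
qed

lemma L2m_norm_single_le: "L2m_norm \<Omega> (single k h) \<le> L2m_norm \<Omega> h"
  unfolding L2m_norm_L2_set by (rule L2_set_mono) (auto simp: single_eq L2_norm_zero)

lemma L2m_norm_combination_single_le: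
  assumes "h \<in> L2m_space \<Omega>"
  shows "L2m_norm \<Omega> (\<lambda>j x. t * h j x + s * single k h j x) \<le> (\<bar>t\<bar> + \<bar>s\<bar>) * L2m_norm \<Omega> h"
proof -
  have "(\<lambda>j x. t * h j x) \<in> L2m_space \<Omega>" "(\<lambda>j x. s * single k h j x) \<in> L2m_space \<Omega>"
    using assms single_L2m[OF assms, of k] by (auto simp: L2m_space_def intro!: L2_cmult)
  from L2m_norm_triangle[OF this] have "L2m_norm \<Omega> (\<lambda>j x. t * h j x + s * single k h j x)
      \<le> \<bar>t\<bar> * L2m_norm \<Omega> h + \<bar>s\<bar> * L2m_norm \<Omega> (single k h)"
    unfolding L2m_norm_cmult .
  also have "\<dots> \<le> (\<bar>t\<bar> + \<bar>s\<bar>) * L2m_norm \<Omega> h"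
    using L2m_norm_single_le[of \<Omega> k h] by (simp add: distrib_right mult_left_mono)
  finally show ?thesis .
qed

lemma weakly_converges_component:
  assumes "weakly_converges \<Omega> h h0" "g \<in> L2_space \<Omega>"
  shows "(\<lambda>n. L2_inner \<Omega> (h n k) g) \<longlonglongrightarrow> L2_inner \<Omega> (h0 k) g"
proof -
  have "single k (\<lambda>_. g) \<in> L2m_space \<Omega>"
    using assms(2) by (intro single_L2m) (simp add: L2m_space_def)
  then have "(\<lambda>n. L2m_inner \<Omega> (h n) (single k (\<lambda>_. g))) \<longlonglongrightarrow> L2m_inner \<Omega> h0 (single k (\<lambda>_. g))"
    using assms(1) by (simp add: weakly_converges_def)
  then show ?thesis by (simp add: L2m_inner_single)
qed

lemma weakly_converges_bounded:
  fixes h :: "nat \<Rightarrow> 'm::finite \<Rightarrow> real^'n \<Rightarrow> real"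
  assumes "weakly_converges \<Omega> h h0"
  shows "\<exists>C>0. (\<forall>n. L2m_norm \<Omega> (h n) \<le> C) \<and> L2m_norm \<Omega> h0 \<le> C"
proof -
  have "\<exists>C>0. \<forall>n. L2_norm \<Omega> (h n k) \<le> C" for k
    by (rule L2_weakly_convergent_bounded)
       (use assms weakly_converges_component[OF assms] in \<open>auto simp: weakly_converges_def L2m_space_def\<close>)
  then obtain C where C: "\<And>n k. L2_norm \<Omega> (h n k) \<le> C k" by metis
  have "L2m_norm \<Omega> (h n) \<le> L2_set C UNIV" for n
    unfolding L2m_norm_L2_set by (rule L2_set_mono) (use C in auto)
  then show ?thesis
    by (intro exI[of _ "max 1 (max (L2_set C UNIV) (L2m_norm \<Omega> h0))"]) (auto simp: max.coboundedI1 max.coboundedI2)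
qed

section \<open>Second order expansion of the costs\<close>

lemma cost_integrand_bound:
  fixes l :: "real^'n::finite \<Rightarrow> real \<Rightarrow> real"
  assumes "cost_integrand \<Omega> l" "M > 0"
  obtains \<psi> where "\<psi> \<in> L2_space \<Omega>"
    "AE x in lebesgue_on \<Omega>. \<forall>s t. \<bar>s\<bar> \<le> M \<longrightarrow> \<bar>t\<bar> \<le> M \<longrightarrow> \<bar>l x s - l x t\<bar> \<le> \<psi> x * \<bar>s - t\<bar>"
proof -
  obtain \<psi> C where \<psi>: "\<psi> \<in> L2_space \<Omega>"
    and bound: "AE x in lebesgue_on \<Omega>.
        (\<forall>t. \<bar>t\<bar> \<le> M \<longrightarrow> \<bar>deriv (l x) t\<bar> \<le> \<psi> x \<and> \<bar>deriv (deriv (l x)) t\<bar> \<le> C) \<and>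
        (\<forall>t1 t2. \<bar>t1\<bar> \<le> M \<and> \<bar>t2\<bar> \<le> M \<longrightarrow>
           \<bar>deriv (deriv (l x)) t2 - deriv (deriv (l x)) t1\<bar> \<le> C * \<bar>t2 - t1\<bar>)"
    using assms unfolding cost_integrand_def by blast
  have "AE x in lebesgue_on \<Omega>. C2_real (l x)"
    using assms(1) by (auto simp: cost_integrand_def caratheodory_C2_def)
  with bound have "AE x in lebesgue_on \<Omega>. \<forall>s t. \<bar>s\<bar> \<le> M \<longrightarrow> \<bar>t\<bar> \<le> M \<longrightarrow> \<bar>l x s - l x t\<bar> \<le> \<psi> x * \<bar>s - t\<bar>"
    by eventually_elim (blast intro: C2_real_lipschitz)
  with \<psi> show ?thesis by (rule that)
qed

text \<open>The Lipschitz weight \<open>\<psi>\<close> of the integrand depends on the bound M of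
  the states, so one M has to serve the whole sequence. Then Cauchy-Schwarz bounds the difference of
  the integrals by the norm of \<open>\<psi>\<close> times the distance of the functions.\<close>

lemma cost_integral_tendsto:
  fixes l :: "real^'n::finite \<Rightarrow> real \<Rightarrow> real"
  assumes \<Omega>: "open \<Omega>" and l: "cost_integrand \<Omega> l" and M: "M > 0"
    and v: "\<And>n. v n \<in> L2_space \<Omega>" "v0 \<in> L2_space \<Omega>"
    and bound: "\<And>n x. x \<in> \<Omega> \<Longrightarrow> \<bar>v n x\<bar> \<le> M" "\<And>x. x \<in> \<Omega> \<Longrightarrow> \<bar>v0 x\<bar> \<le> M"
    and conv: "(\<lambda>n. L2_norm \<Omega> (\<lambda>x. v n x - v0 x)) \<longlonglongrightarrow> 0"
  shows "(\<lambda>n. LINT x|lebesgue_on \<Omega>. l x (v n x)) \<longlonglongrightarrow> (LINT x|lebesgue_on \<Omega>. l x (v0 x))"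
proof -
  have leb: "\<Omega> \<in> sets lebesgue" using \<Omega> by auto
  have in_\<Omega>: "AE x in lebesgue_on \<Omega>. x \<in> \<Omega>" by (rule AE_I2) simp
  obtain \<psi> where \<psi>: "\<psi> \<in> L2_space \<Omega>"
    "AE x in lebesgue_on \<Omega>. \<forall>s t. \<bar>s\<bar> \<le> M \<longrightarrow> \<bar>t\<bar> \<le> M \<longrightarrow> \<bar>l x s - l x t\<bar> \<le> \<psi> x * \<bar>s - t\<bar>"
    using cost_integrand_bound[OF l M] .
  have int: "integrable (lebesgue_on \<Omega>) (\<lambda>x. l x (u x))"
    if u: "u \<in> L2_space \<Omega>" "\<And>x. x \<in> \<Omega> \<Longrightarrow> \<bar>u x\<bar> \<le> M" for u
  proof (rule Bochner_Integration.integrable_bound)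
    show "integrable (lebesgue_on \<Omega>) (\<lambda>x. \<bar>l x 0\<bar> + \<bar>\<psi> x\<bar> * \<bar>u x\<bar>)"
      using l by (intro Bochner_Integration.integrable_add L2_integrable_mult L2_abs \<psi> u integrable_abs)
        (auto simp: cost_integrand_def L1_space_def)
    show "(\<lambda>x. l x (u x)) \<in> borel_measurable (lebesgue_on \<Omega>)"
      using l by (intro caratheodory_measurable[OF leb _ L2_measurable[OF u(1)]])
        (auto simp: cost_integrand_def caratheodory_C2_def)
    show "AE x in lebesgue_on \<Omega>. norm (l x (u x)) \<le> norm (\<bar>l x 0\<bar> + \<bar>\<psi> x\<bar> * \<bar>u x\<bar>)"
      using \<psi>(2) in_\<Omega>
    proof eventually_elim
      case (elim x)
      have "\<bar>l x (u x) - l x 0\<bar> \<le> \<psi> x * \<bar>u x - 0\<bar>"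
        using elim(1)[rule_format, of "u x" 0] u(2)[OF elim(2)] M by simp
      also have "\<dots> \<le> \<bar>\<psi> x\<bar> * \<bar>u x\<bar>" by (simp add: mult_right_mono)
      finally have "\<bar>l x (u x)\<bar> \<le> \<bar>l x 0\<bar> + \<bar>\<psi> x\<bar> * \<bar>u x\<bar>" by linarith
      then show ?case by simp
    qed
  qed
  show ?thesis
  proof (rule LIM_zero_cancel, rule Lim_null_comparison)
    show "(\<lambda>n. L2_norm \<Omega> \<psi> * L2_norm \<Omega> (\<lambda>x. v n x - v0 x)) \<longlonglongrightarrow> 0"
      by (rule tendsto_mult_right_zero[OF conv])
    show "\<forall>\<^sub>F n in sequentially. norm ((LINT x|lebesgue_on \<Omega>. l x (v n x)) - (LINT x|lebesgue_on \<Omega>. l x (v0 x)))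
        \<le> L2_norm \<Omega> \<psi> * L2_norm \<Omega> (\<lambda>x. v n x - v0 x)"
    proof (rule always_eventually, rule allI)
      fix n
      note int_n = int[OF v(1) bound(1), of n] and int_0 = int[OF v(2) bound(2)]
      have "\<bar>(LINT x|lebesgue_on \<Omega>. l x (v n x)) - (LINT x|lebesgue_on \<Omega>. l x (v0 x))\<bar>
          = \<bar>LINT x|lebesgue_on \<Omega>. l x (v n x) - l x (v0 x)\<bar>"
        using int_n int_0 by simp
      also have "\<dots> \<le> (LINT x|lebesgue_on \<Omega>. \<bar>l x (v n x) - l x (v0 x)\<bar>)" by (rule integral_abs_bound)
      also have "\<dots> \<le> L2_inner \<Omega> \<psi> (\<lambda>x. \<bar>v n x - v0 x\<bar>)"
        unfolding L2_inner_def
      proof (rule integral_mono_AE)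
        show "integrable (lebesgue_on \<Omega>) (\<lambda>x. \<bar>l x (v n x) - l x (v0 x)\<bar>)"
          using int_n int_0 by simp
        show "integrable (lebesgue_on \<Omega>) (\<lambda>x. \<psi> x * \<bar>v n x - v0 x\<bar>)"
          by (intro L2_integrable_mult L2_abs L2_diff \<psi> v)
        show "AE x in lebesgue_on \<Omega>. \<bar>l x (v n x) - l x (v0 x)\<bar> \<le> \<psi> x * \<bar>v n x - v0 x\<bar>"
          using \<psi>(2) in_\<Omega> by eventually_elim (use bound in blast)
      qed
      also have "\<dots> \<le> L2_norm \<Omega> \<psi> * L2_norm \<Omega> (\<lambda>x. v n x - v0 x)"
        using L2_Cauchy_Schwarz[OF \<psi>(1) L2_abs[OF L2_diff[OF v]], of n]
        unfolding L2_norm_abs by linarith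
      finally show "norm ((LINT x|lebesgue_on \<Omega>. l x (v n x)) - (LINT x|lebesgue_on \<Omega>. l x (v0 x)))
          \<le> L2_norm \<Omega> \<psi> * L2_norm \<Omega> (\<lambda>x. v n x - v0 x)" by simp
    qed
  qed
qed

text \<open>Reduces the partial gradient to an ordinary derivative in s, to which the mean value
  theorem applies.\<close>

lemma partial_gradient_line_derivative:
  fixes \<Phi> :: "('m \<Rightarrow> real^'n \<Rightarrow> real) \<Rightarrow> real"
  assumes grad: "has_partial_gradient \<Omega> k \<Phi> (\<lambda>j x. u j x + s * single k h j x) g"
    and h: "h k \<in> L2_space \<Omega>"
  shows "((\<lambda>s. \<Phi> (\<lambda>j x. u j x + s * single k h j x)) has_real_derivative L2_inner \<Omega> g (h k)) (at s)"
  unfolding DERIV_def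
proof (rule LIM_I)
  fix r :: real assume r: "r > 0"
  let ?N = "L2_norm \<Omega> (h k)"
  \<comment> \<open>Adding \<open>\<tau> * h k\<close> to the k-th component is the same as moving
    the parameter from s to \<open>s + \<tau>\<close>.\<close>
  have upd: "(\<lambda>j x. u j x + s * single k h j x)(k := (\<lambda>x. (u k x + s * single k h k x) + \<tau> * h k x))
      = (\<lambda>j x. u j x + (s + \<tau>) * single k h j x)" for \<tau>
    by (rule ext) (auto simp: single_def distrib_right)
  \<comment> \<open>The norm of \<open>h k\<close> may be 0, so \<open>?N + 1\<close> is the divisor
    for both the tolerance and the step size.\<close>
  have N1: "?N + 1 > 0" using L2_norm_nonneg[of \<Omega> "h k"] by linarith
  then have "r / (?N + 1) > 0" using r by simp
  then obtain \<delta> where \<delta>: "\<delta> > 0" "\<And>v. v \<in> L2_space \<Omega> \<Longrightarrow> L2_norm \<Omega> v \<le> \<delta> \<Longrightarrow>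
      \<bar>\<Phi> ((\<lambda>j x. u j x + s * single k h j x)(k := (\<lambda>x. (u k x + s * single k h k x) + v x)))
        - \<Phi> (\<lambda>j x. u j x + s * single k h j x) - L2_inner \<Omega> g v\<bar> \<le> r / (?N + 1) * L2_norm \<Omega> v"
    using grad unfolding has_partial_gradient_def by blast
  show "\<exists>c>0. \<forall>\<tau>. \<tau> \<noteq> 0 \<and> norm (\<tau> - 0) < c \<longrightarrow>
      norm ((\<Phi> (\<lambda>j x. u j x + (s + \<tau>) * single k h j x) - \<Phi> (\<lambda>j x. u j x + s * single k h j x)) / \<tau>
        - L2_inner \<Omega> g (h k)) < r"
  proof (intro exI[of _ "\<delta> / (?N + 1)"] conjI allI impI)
    show "\<delta> / (?N + 1) > 0" using \<delta>(1) N1 by simp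
    fix \<tau> :: real assume "\<tau> \<noteq> 0 \<and> norm (\<tau> - 0) < \<delta> / (?N + 1)"
    then have \<tau>: "\<tau> \<noteq> 0" "\<bar>\<tau>\<bar> < \<delta> / (?N + 1)" by auto
    have "\<bar>\<tau>\<bar> * ?N \<le> \<bar>\<tau>\<bar> * (?N + 1)" by (intro mult_left_mono) auto
    also have "\<dots> \<le> \<delta>" using \<tau>(2) N1 by (simp add: pos_less_divide_eq less_imp_le)
    finally have small: "L2_norm \<Omega> (\<lambda>x. \<tau> * h k x) \<le> \<delta>" by (simp add: L2_norm_cmult)
    let ?d = "\<Phi> (\<lambda>j x. u j x + (s + \<tau>) * single k h j x) - \<Phi> (\<lambda>j x. u j x + s * single k h j x)"
    have "\<bar>?d - \<tau> * L2_inner \<Omega> g (h k)\<bar> \<le> r / (?N + 1) * (\<bar>\<tau>\<bar> * ?N)"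
      using \<delta>(2)[OF L2_cmult[OF h] small]
      unfolding upd L2_norm_cmult L2_inner_commute[of _ g] L2_inner_cmult_left .
    then have "\<bar>?d - \<tau> * L2_inner \<Omega> g (h k)\<bar> / \<bar>\<tau>\<bar> \<le> r / (?N + 1) * (\<bar>\<tau>\<bar> * ?N) / \<bar>\<tau>\<bar>"
      by (rule divide_right_mono) simp
    also have "\<dots> = r * (?N / (?N + 1))" using \<tau>(1) by simp
    also have "\<dots> < r * 1" using r N1 by (intro mult_strict_left_mono) (auto simp: divide_less_eq)
    also have "\<bar>?d - \<tau> * L2_inner \<Omega> g (h k)\<bar> / \<bar>\<tau>\<bar> = \<bar>?d / \<tau> - L2_inner \<Omega> g (h k)\<bar>"
      using \<tau>(1) by (simp add: abs_divide[symmetric] diff_divide_distrib)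
    finally show "norm (?d / \<tau> - L2_inner \<Omega> g (h k)) < r" by simp
  qed
qed

text \<open>Only the derivative at \<open>u\<close> of the map \<open>F\<close> of partial gradients is used: \<open>F\<close> along the segment is
  replaced by its affine approximation, and the mean value theorem bounds the error.\<close>

lemma partial_gradient_expansion:
  fixes \<Phi> :: "('m::finite \<Rightarrow> real^'n \<Rightarrow> real) \<Rightarrow> real"
  assumes grad: "\<And>v. v \<in> L2m_space \<Omega> \<Longrightarrow> has_partial_gradient \<Omega> k \<Phi> v (F v k)"
    and F: "\<And>v j. v \<in> L2m_space \<Omega> \<Longrightarrow> F v j \<in> L2_space \<Omega>"
    and F': "has_L2m_derivative \<Omega> F F' u" and u: "u \<in> L2m_space \<Omega>" and \<epsilon>: "\<epsilon> > 0"
  shows "\<exists>\<delta>>0. \<forall>h\<in>L2m_space \<Omega>. \<forall>t s. (\<bar>t\<bar> + \<bar>s\<bar>) * L2m_norm \<Omega> h \<le> \<delta> \<longrightarrow>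
    \<bar>\<Phi> (\<lambda>j x. u j x + (t * h j x + s * single k h j x)) - \<Phi> (\<lambda>j x. u j x + t * h j x)
      - (s * L2_inner \<Omega> (F u k) (h k) + t * s * L2_inner \<Omega> (F' h k) (h k)
        + s\<^sup>2 / 2 * L2_inner \<Omega> (F' (single k h) k) (h k))\<bar>
    \<le> \<epsilon> * (\<bar>t\<bar> + \<bar>s\<bar>) * \<bar>s\<bar> * (L2m_norm \<Omega> h)\<^sup>2"
proof -
  obtain \<delta> where \<delta>: "\<delta> > 0" "\<And>p. p \<in> L2m_space \<Omega> \<Longrightarrow> L2m_norm \<Omega> p \<le> \<delta> \<Longrightarrow>
      L2m_norm \<Omega> (\<lambda>k x. F (\<lambda>j z. u j z + p j z) k x - F u k x - F' p k x) \<le> \<epsilon> * L2m_norm \<Omega> p"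
    using F' \<epsilon> unfolding has_L2m_derivative_def by blast
  have F'_L2: "F' p j \<in> L2_space \<Omega>" if "p \<in> L2m_space \<Omega>" for p j
    using F' that by (auto simp: has_L2m_derivative_def L2m_space_def)
  have "\<bar>\<Phi> (\<lambda>j x. u j x + (t * h j x + s * single k h j x)) - \<Phi> (\<lambda>j x. u j x + t * h j x)
      - (s * L2_inner \<Omega> (F u k) (h k) + t * s * L2_inner \<Omega> (F' h k) (h k)
        + s\<^sup>2 / 2 * L2_inner \<Omega> (F' (single k h) k) (h k))\<bar>
    \<le> \<epsilon> * (\<bar>t\<bar> + \<bar>s\<bar>) * \<bar>s\<bar> * (L2m_norm \<Omega> h)\<^sup>2"
    if h: "h \<in> L2m_space \<Omega>" and small: "(\<bar>t\<bar> + \<bar>s\<bar>) * L2m_norm \<Omega> h \<le> \<delta>" for h t s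
  proof -
    let ?A = "L2_inner \<Omega> (F u k) (h k)" and ?B = "L2_inner \<Omega> (F' h k) (h k)"
      and ?C = "L2_inner \<Omega> (F' (single k h) k) (h k)" and ?N = "L2m_norm \<Omega> h"
    define p where "p = (\<lambda>\<sigma> j x. t * h j x + \<sigma> * single k h j x)"
    define v where "v = (\<lambda>\<sigma> j x. u j x + p \<sigma> j x)"
    \<comment> \<open>The cost minus its quadratic model along the segment. The derivative of
      \<open>G\<close> is the remainder of the first order expansion of \<open>F\<close>, paired
      with \<open>h k\<close>.\<close>
    define G where "G = (\<lambda>\<sigma>. \<Phi> (v \<sigma>) - (\<sigma> * ?A + t * \<sigma> * ?B + \<sigma>\<^sup>2 / 2 * ?C))"
    have hk: "h k \<in> L2_space \<Omega>" by (rule L2m_component[OF h])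
    have p_L2m: "p \<sigma> \<in> L2m_space \<Omega>" for \<sigma>
      unfolding p_def by (intro L2m_combination h single_L2m)
    have v_L2m: "v \<sigma> \<in> L2m_space \<Omega>" for \<sigma>
      using u p_L2m[of \<sigma>] by (auto simp: v_def L2m_space_def intro!: L2_add)
    define D where "D = (\<lambda>\<sigma>. L2_inner \<Omega> (\<lambda>x. F (v \<sigma>) k x - F u k x - F' (p \<sigma>) k x) (h k))"
    have deriv: "(G has_real_derivative D \<sigma>) (at \<sigma>)" for \<sigma>
    proof -
      have v_eq: "v \<sigma> = (\<lambda>j x. (u j x + t * h j x) + \<sigma> * single k h j x)" for \<sigma>
        by (simp add: v_def p_def add.assoc)
      have "((\<lambda>\<sigma>. \<Phi> (v \<sigma>)) has_real_derivative L2_inner \<Omega> (F (v \<sigma>) k) (h k)) (at \<sigma>)"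
        using partial_gradient_line_derivative[OF grad[OF v_L2m[of \<sigma>], unfolded v_eq] hk]
        by (simp add: v_eq)
      moreover have "((\<lambda>\<sigma>. \<sigma> * ?A + t * \<sigma> * ?B + \<sigma>\<^sup>2 / 2 * ?C) has_real_derivative
          (?A + t * ?B + \<sigma> * ?C)) (at \<sigma>)"
        by (auto intro!: derivative_eq_intros)
      ultimately have "(G has_real_derivative
          (L2_inner \<Omega> (F (v \<sigma>) k) (h k) - (?A + t * ?B + \<sigma> * ?C))) (at \<sigma>)"
        unfolding G_def by (rule DERIV_diff)
      moreover have "D \<sigma> = L2_inner \<Omega> (F (v \<sigma>) k) (h k) - (?A + t * ?B + \<sigma> * ?C)"
      proof -
        have lin: "AE x in lebesgue_on \<Omega>. F' (p \<sigma>) k x = t * F' h k x + \<sigma> * F' (single k h) k x"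
          using F' h single_L2m[OF h, of k] unfolding has_L2m_derivative_def p_def by blast
        have "L2_inner \<Omega> (F' (p \<sigma>) k) (h k) = L2_inner \<Omega> (\<lambda>x. t * F' h k x + \<sigma> * F' (single k h) k x) (h k)"
          by (rule L2_inner_cong_AE_L2[OF _ _ hk lin])
             (intro L2_add L2_cmult F'_L2 h single_L2m p_L2m)+
        also have "\<dots> = t * ?B + \<sigma> * ?C"
          by (simp add: L2_inner_add_left L2_inner_cmult_left L2_cmult F'_L2 h single_L2m hk)
        finally show ?thesis
          unfolding D_def
          by (simp add: L2_inner_diff_left L2_diff F v_L2m u F'_L2 p_L2m hk)
      qed
      ultimately show ?thesis by simp
    qed
    have bound: "\<bar>D \<sigma>\<bar> \<le> \<epsilon> * (\<bar>t\<bar> + \<bar>s\<bar>) * ?N\<^sup>2" if "\<bar>\<sigma>\<bar> \<le> \<bar>s\<bar>" for \<sigma>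
    proof -
      let ?R = "\<lambda>k x. F (v \<sigma>) k x - F u k x - F' (p \<sigma>) k x"
      have "L2m_norm \<Omega> (p \<sigma>) \<le> (\<bar>t\<bar> + \<bar>\<sigma>\<bar>) * ?N"
        unfolding p_def by (rule L2m_norm_combination_single_le[OF h])
      also have "\<dots> \<le> (\<bar>t\<bar> + \<bar>s\<bar>) * ?N" using that by (intro mult_right_mono) auto
      finally have p_norm: "L2m_norm \<Omega> (p \<sigma>) \<le> (\<bar>t\<bar> + \<bar>s\<bar>) * ?N" .
      have "\<bar>D \<sigma>\<bar> \<le> L2_norm \<Omega> (?R k) * L2_norm \<Omega> (h k)"
        unfolding D_def by (intro L2_Cauchy_Schwarz L2_diff F v_L2m u F'_L2 p_L2m hk)
      also have "\<dots> \<le> L2m_norm \<Omega> ?R * ?N"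
        by (intro mult_mono L2_norm_component_le) (auto intro: L2_norm_component_le)
      also have "\<dots> \<le> (\<epsilon> * L2m_norm \<Omega> (p \<sigma>)) * ?N"
        using \<delta>(2)[OF p_L2m order_trans[OF p_norm small]] by (intro mult_right_mono) (auto simp: v_def)
      also have "\<dots> \<le> (\<epsilon> * ((\<bar>t\<bar> + \<bar>s\<bar>) * ?N)) * ?N"
        using p_norm \<epsilon> by (intro mult_right_mono mult_left_mono) auto
      finally show ?thesis by (simp add: power2_eq_square mult_ac)
    qed
    \<comment> \<open>The symmetric interval covers both signs of s.\<close>
    have "norm (G s - G 0) \<le> \<epsilon> * (\<bar>t\<bar> + \<bar>s\<bar>) * ?N\<^sup>2 * norm (s - 0)"
      by (rule field_differentiable_bound[where S = "{-\<bar>s\<bar>..\<bar>s\<bar>}" and f' = D])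
         (use deriv bound in \<open>auto intro: has_field_derivative_at_within\<close>)
    then show ?thesis by (simp add: G_def v_def p_def mult_ac)
  qed
  with \<delta>(1) show ?thesis by blast
qed

section \<open>The quadratic form of the game\<close>

text \<open>The parameter is frozen: \<open>e\<^sub>Y\<close> and \<open>e\<close> are the
  components of one parameter, so that \<open>F\<close> is a map of the controls alone.\<close>

locale perturbed_game = state_equation \<Omega> a f y
  for \<Omega> :: "(real^'n::finite) set" and a f y +
  fixes L :: "'m::finite \<Rightarrow> real^'n \<Rightarrow> real \<Rightarrow> real"
    and \<zeta> B :: "'m \<Rightarrow> real^'n \<Rightarrow> real"
    and \<zeta>0 :: "'m \<Rightarrow> real"
    and e\<^sub>Y :: "real^'n \<Rightarrow> real"
    and e :: "'m \<Rightarrow> (real^'n \<Rightarrow> real) \<times> 'p"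
    and F F' :: "('m \<Rightarrow> real^'n \<Rightarrow> real) \<Rightarrow> ('m \<Rightarrow> real^'n \<Rightarrow> real)"
    and ubar :: "'m \<Rightarrow> real^'n \<Rightarrow> real"
  assumes zeta: "\<And>k. \<zeta> k \<in> Linf_space \<Omega>" "\<And>k. \<zeta>0 k > 0"
      "\<And>k. AE x in lebesgue_on \<Omega>. \<zeta> k x \<ge> \<zeta>0 k"
    and B: "\<And>k. B k \<in> Linf_space \<Omega>"
    and L: "\<And>k. cost_integrand \<Omega> (L k)"
    and e\<^sub>Y: "e\<^sub>Y \<in> L2_space \<Omega>" and e\<^sub>J: "\<And>k. fst (e k) \<in> L2_space \<Omega>"
    and gradient: "\<And>u k. u \<in> L2m_space \<Omega> \<Longrightarrow>
      has_partial_gradient \<Omega> k (\<lambda>v. perturbed_cost \<Omega> L \<zeta> B y k v e\<^sub>Y (e k)) u (F u k)"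
    and ubar: "ubar \<in> L2m_space \<Omega>"
    and F': "has_L2m_derivative \<Omega> F F' ubar"
begin

lemma total_control_L2: "u \<in> L2m_space \<Omega> \<Longrightarrow> total_control B u \<in> L2_space \<Omega>"
  unfolding total_control_def by (intro L2_sum L2_mult_Linf B L2m_component) auto

lemma total_control_weak:
  assumes h: "weakly_converges \<Omega> h h0" and g: "g \<in> L2_space \<Omega>"
  shows "(\<lambda>n. L2_inner \<Omega> (total_control B (h n)) g) \<longlonglongrightarrow> L2_inner \<Omega> (total_control B h0) g"
proof -
  have "L2_inner \<Omega> (total_control B u) g = (\<Sum>i\<in>UNIV. L2_inner \<Omega> (u i) (\<lambda>x. B i x * g x))"
    if u: "u \<in> L2m_space \<Omega>" for u
  proof -
    have "L2_inner \<Omega> (total_control B u) g = (\<Sum>i\<in>UNIV. L2_inner \<Omega> (\<lambda>x. B i x * u i x) g)"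
      unfolding total_control_def by (intro L2_inner_sum_left L2_mult_Linf B L2m_component u g) auto
    then show ?thesis by (simp add: L2_inner_def mult_ac)
  qed
  moreover have "h n \<in> L2m_space \<Omega>" "h0 \<in> L2m_space \<Omega>" for n
    using h by (auto simp: weakly_converges_def)
  ultimately show ?thesis
    by (auto intro!: tendsto_sum weakly_converges_component[OF h] L2_mult_Linf g B)
qed

section \<open>Splitting of the cost and weak continuity of the state cost\<close>

definition state_cost :: "'m \<Rightarrow> ('m \<Rightarrow> real^'n \<Rightarrow> real) \<Rightarrow> real" where
  "state_cost k u = (LINT x|lebesgue_on \<Omega>. L k x (y (\<lambda>x. total_control B u x + B k x * e\<^sub>Y x) x))
    + L2_inner \<Omega> (fst (e k)) (y (\<lambda>x. total_control B u x + e\<^sub>Y x))"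

definition control_cost :: "'m \<Rightarrow> ('m \<Rightarrow> real^'n \<Rightarrow> real) \<Rightarrow> real" where
  "control_cost k u = 1/2 * (LINT x|lebesgue_on \<Omega>. \<zeta> k x * (u k x + e\<^sub>Y x)\<^sup>2)"

lemma perturbed_cost_eq:
  "perturbed_cost \<Omega> L \<zeta> B y k u e\<^sub>Y (e k) = state_cost k u + control_cost k u"
proof -
  have "total_control B (u(k := (\<lambda>x. u k x + e\<^sub>Y x))) = (\<lambda>x. total_control B u x + B k x * e\<^sub>Y x)"
  proof
    fix x
    have "total_control B (u(k := (\<lambda>x. u k x + e\<^sub>Y x))) x
        = (\<Sum>i\<in>UNIV. B i x * u i x + (if i = k then B k x * e\<^sub>Y x else 0))"
      unfolding total_control_def by (rule sum.cong) (auto simp: distrib_left)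
    then show "total_control B (u(k := (\<lambda>x. u k x + e\<^sub>Y x))) x = total_control B u x + B k x * e\<^sub>Y x"
      by (simp add: sum.distrib total_control_def)
  qed
  then show ?thesis
    by (simp add: perturbed_cost_def cost_def state_cost_def control_cost_def)
qed

text \<open>The parameter t moves all players along h, and s moves player k alone. The product t s
  in the expansion then carries \<open>F' h\<close> in component k, paired with
  \<open>h k\<close>.\<close>

definition shift :: "'m \<Rightarrow> real \<Rightarrow> real \<Rightarrow> ('m \<Rightarrow> real^'n \<Rightarrow> real) \<Rightarrow> 'm \<Rightarrow> real^'n \<Rightarrow> real" where
  "shift k t s h = (\<lambda>j x. ubar j x + (t * h j x + s * single k h j x))"

lemma total_control_shift:
  "total_control B (shift k t s h) x
    = total_control B ubar x + (t * total_control B h x + s * (B k x * h k x))"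
proof -
  have "B i x * shift k t s h i x
      = B i x * ubar i x + t * (B i x * h i x) + (if i = k then s * (B k x * h k x) else 0)" for i
    by (simp add: shift_def single_def algebra_simps)
  then show ?thesis
    by (simp add: total_control_def sum.distrib sum_distrib_left)
qed

text \<open>A weakly convergent sequence is bounded, so small t and s bring all shifted controls
  into the ball on which the states are uniformly bounded. The admissible size depends on the
  sequence, which is harmless because t and s are chosen after it.\<close>

lemma state_cost_tendsto:
  assumes h: "weakly_converges \<Omega> h h0"
  shows "\<exists>\<tau>>0. \<forall>t s. \<bar>t\<bar> \<le> \<tau> \<longrightarrow> \<bar>s\<bar> \<le> \<tau> \<longrightarrow>
    (\<lambda>n. state_cost k (shift k t s (h n))) \<longlonglongrightarrow> state_cost k (shift k t s h0)"
proof -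
  have h_L2m: "h n \<in> L2m_space \<Omega>" "h0 \<in> L2m_space \<Omega>" for n
    using h by (auto simp: weakly_converges_def)
  \<comment> \<open>The change of the total control under \<open>shift\<close>. It is linear in (t,
    s), so bounds for \<open>p 1 0\<close> and \<open>p 0 1\<close> control all small
    shifts.\<close>
  define p where "p = (\<lambda>t s h x. t * total_control B h x + s * (B k x * h k x))"
  have p_L2: "p t s h \<in> L2_space \<Omega>" if "h \<in> L2m_space \<Omega>" for t s h
    unfolding p_def by (intro L2_add L2_cmult total_control_L2 L2_mult_Linf B L2m_component that)
  have p_inner: "L2_inner \<Omega> (p t s h) g = t * L2_inner \<Omega> (total_control B h) g + s * L2_inner \<Omega> (h k) (\<lambda>x. B k x * g x)"
    if "h \<in> L2m_space \<Omega>" "g \<in> L2_space \<Omega>" for t s h g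
  proof -
    have "L2_inner \<Omega> (\<lambda>x. B k x * h k x) g = L2_inner \<Omega> (h k) (\<lambda>x. B k x * g x)"
      by (simp add: L2_inner_def mult_ac)
    then show ?thesis
      unfolding p_def
      by (simp add: L2_inner_add_left L2_inner_cmult_left L2_cmult total_control_L2 L2_mult_Linf B L2m_component that)
  qed
  have p_weak: "(\<lambda>n. L2_inner \<Omega> (p t s (h n)) g) \<longlonglongrightarrow> L2_inner \<Omega> (p t s h0) g" if g: "g \<in> L2_space \<Omega>" for t s g
    unfolding p_inner[OF h_L2m(1) g] p_inner[OF h_L2m(2) g]
    by (intro tendsto_intros total_control_weak[OF h g] weakly_converges_component[OF h] L2_mult_Linf g B)
  have conv: "(\<lambda>n. L2_norm \<Omega> (\<lambda>x. y (\<lambda>x. v x + p t s (h n) x) x - y (\<lambda>x. v x + p t s h0 x) x)) \<longlonglongrightarrow> 0"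
    if v: "v \<in> L2_space \<Omega>" for v t s
  proof (rule state_weak_to_strong)
    show "(\<lambda>x. v x + p t s (h n) x) \<in> L2_space \<Omega>" "(\<lambda>x. v x + p t s h0 x) \<in> L2_space \<Omega>" for n
      by (intro L2_add v p_L2 h_L2m)+
    fix g assume g: "g \<in> L2_space \<Omega>"
    show "(\<lambda>n. L2_inner \<Omega> (\<lambda>x. v x + p t s (h n) x) g) \<longlonglongrightarrow> L2_inner \<Omega> (\<lambda>x. v x + p t s h0 x) g"
      using tendsto_add[OF tendsto_const p_weak[OF g]]
      by (simp add: L2_inner_add_left v p_L2 h_L2m g)
  qed
  \<comment> \<open>There are two base controls because \<open>e\<^sub>Y\<close> enters the integral
    cost through \<open>B k\<close> and the tracking term directly. Local boundedness is invoked
    around \<open>w\<close> only; the term based on \<open>w'\<close> is linear in the state, so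
    norm convergence suffices.\<close>
  define w where "w x = total_control B ubar x + B k x * e\<^sub>Y x" for x
  define w' where "w' x = total_control B ubar x + e\<^sub>Y x" for x
  have w: "w \<in> L2_space \<Omega>" "w' \<in> L2_space \<Omega>"
    unfolding w_def w'_def by (intro L2_add total_control_L2 ubar L2_mult_Linf B e\<^sub>Y)+
  have state_cost_shift: "state_cost k (shift k t s h) =
      (LINT x|lebesgue_on \<Omega>. L k x (y (\<lambda>x. w x + p t s h x) x))
      + L2_inner \<Omega> (fst (e k)) (y (\<lambda>x. w' x + p t s h x))" for t s h
    unfolding state_cost_def total_control_shift w_def w'_def p_def by (simp add: algebra_simps)
  obtain \<delta> M where \<delta>: "\<delta> > 0" and M: "M > 0" "\<And>v x. v \<in> L2_space \<Omega> \<Longrightarrow> L2_norm \<Omega> v \<le> \<delta> \<Longrightarrow> x \<in> \<Omega> \<Longrightarrow>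
      \<bar>y (\<lambda>x. w x + v x) x\<bar> \<le> M"
    using state_locally_bounded[OF w(1)] by blast
  obtain C1 where C1: "C1 > 0" "\<And>n. L2_norm \<Omega> (p 1 0 (h n)) \<le> C1"
    using L2_weakly_convergent_bounded[OF p_L2[OF h_L2m(1)] p_weak[of _ 1 0]] by blast
  obtain C2 where C2: "C2 > 0" "\<And>n. L2_norm \<Omega> (p 0 1 (h n)) \<le> C2"
    using L2_weakly_convergent_bounded[OF p_L2[OF h_L2m(1)] p_weak[of _ 0 1]] by blast
  define C where "C = C1 + C2 + L2_norm \<Omega> (p 1 0 h0) + L2_norm \<Omega> (p 0 1 h0)"
  have C: "C > 0" using C1(1) C2(1) unfolding C_def by (simp add: add_pos_nonneg)
  have p_split: "L2_norm \<Omega> (p t s h') \<le> \<bar>t\<bar> * L2_norm \<Omega> (p 1 0 h') + \<bar>s\<bar> * L2_norm \<Omega> (p 0 1 h')"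
    if "h' \<in> L2m_space \<Omega>" for t s h'
  proof -
    have "p t s h' = (\<lambda>x. t * p 1 0 h' x + s * p 0 1 h' x)" by (simp add: p_def)
    then show ?thesis
      using L2_norm_triangle[OF L2_cmult[OF p_L2[OF that]] L2_cmult[OF p_L2[OF that]], of t 1 0 s 0 1]
      by (simp add: L2_norm_cmult)
  qed
  show ?thesis
  proof (intro exI[of _ "\<delta> / C"] conjI allI impI)
    show "\<delta> / C > 0" using \<delta> C by simp
    fix t s :: real assume ts: "\<bar>t\<bar> \<le> \<delta> / C" "\<bar>s\<bar> \<le> \<delta> / C"
    have small: "L2_norm \<Omega> (p t s h') \<le> \<delta>"
      if "h' \<in> L2m_space \<Omega>" "L2_norm \<Omega> (p 1 0 h') + L2_norm \<Omega> (p 0 1 h') \<le> C" for h'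
    proof -
      have "L2_norm \<Omega> (p t s h') \<le> \<delta> / C * L2_norm \<Omega> (p 1 0 h') + \<delta> / C * L2_norm \<Omega> (p 0 1 h')"
        using p_split[OF that(1), of t s] ts
        by (elim order_trans) (intro add_mono mult_right_mono, auto)
      also have "\<dots> = \<delta> / C * (L2_norm \<Omega> (p 1 0 h') + L2_norm \<Omega> (p 0 1 h'))"
        by (simp add: distrib_left)
      also have "\<dots> \<le> \<delta> / C * C" using \<delta> C that(2) by (intro mult_left_mono) auto
      finally show ?thesis using C by simp
    qed
    have "L2_norm \<Omega> (p 1 0 (h n)) + L2_norm \<Omega> (p 0 1 (h n)) \<le> C" for n
      using C1(2)[of n] C2(2)[of n] L2_norm_nonneg[of \<Omega> "p 1 0 h0"] L2_norm_nonneg[of \<Omega> "p 0 1 h0"]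
      unfolding C_def by linarith
    then have small_n: "L2_norm \<Omega> (p t s (h n)) \<le> \<delta>" for n by (rule small[OF h_L2m(1)])
    have small_0: "L2_norm \<Omega> (p t s h0) \<le> \<delta>"
      using C1(1) C2(1) by (intro small h_L2m) (simp add: C_def)
    have states: "y (\<lambda>x. v x + p t s (h n) x) \<in> L2_space \<Omega>" "y (\<lambda>x. v x + p t s h0 x) \<in> L2_space \<Omega>"
      if "v \<in> L2_space \<Omega>" for v n
      by (intro state_L2 L2_add that p_L2 h_L2m)+
    show "(\<lambda>n. state_cost k (shift k t s (h n))) \<longlonglongrightarrow> state_cost k (shift k t s h0)"
      unfolding state_cost_shift
    proof (rule tendsto_add)
      show "(\<lambda>n. LINT x|lebesgue_on \<Omega>. L k x (y (\<lambda>x. w x + p t s (h n) x) x))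
          \<longlonglongrightarrow> (LINT x|lebesgue_on \<Omega>. L k x (y (\<lambda>x. w x + p t s h0 x) x))"
        by (rule cost_integral_tendsto[OF open_domain L M(1) states[OF w(1)] _ _ conv[OF w(1)]])
           (intro M(2) p_L2 h_L2m small_n small_0, assumption)+
      show "(\<lambda>n. L2_inner \<Omega> (fst (e k)) (y (\<lambda>x. w' x + p t s (h n) x)))
          \<longlonglongrightarrow> L2_inner \<Omega> (fst (e k)) (y (\<lambda>x. w' x + p t s h0 x))"
        unfolding L2_inner_commute[of _ "fst (e k)"]
        by (rule L2_inner_tendsto[OF states[OF w(2)] e\<^sub>J conv[OF w(2)]])
    qed
  qed
qed

lemma zeta_mult_L2: "g \<in> L2_space \<Omega> \<Longrightarrow> (\<lambda>x. \<zeta> k x * g x) \<in> L2_space \<Omega>"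
  by (rule L2_mult_Linf[OF _ zeta(1)])

text \<open>Exact, because this cost is quadratic and sees t and s only through t + s: the
  coefficient is half of (t + s)^2 - t^2.\<close>

lemma control_cost_shift:
  assumes h: "h \<in> L2m_space \<Omega>"
  shows "control_cost k (shift k t s h) - control_cost k (shift k t 0 h)
    = s * L2_inner \<Omega> (\<lambda>x. \<zeta> k x * (ubar k x + e\<^sub>Y x)) (h k)
      + (t * s + s\<^sup>2 / 2) * L2_inner \<Omega> (\<lambda>x. \<zeta> k x * h k x) (h k)"
proof -
  let ?b = "\<lambda>x. ubar k x + e\<^sub>Y x"
  have b: "?b \<in> L2_space \<Omega>" by (intro L2_add L2m_component ubar e\<^sub>Y)
  have hk: "h k \<in> L2_space \<Omega>" by (rule L2m_component[OF h])
  have eq: "control_cost k (shift k t s h)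
      = 1/2 * (L2_inner \<Omega> (\<lambda>x. \<zeta> k x * ?b x) ?b + 2 * (t + s) * L2_inner \<Omega> (\<lambda>x. \<zeta> k x * ?b x) (h k)
        + (t + s)\<^sup>2 * L2_inner \<Omega> (\<lambda>x. \<zeta> k x * h k x) (h k))" for t s
  proof -
    have "\<zeta> k x * (shift k t s h k x + e\<^sub>Y x)\<^sup>2
        = \<zeta> k x * ?b x * ?b x + 2 * (t + s) * (\<zeta> k x * ?b x * h k x) + (t + s)\<^sup>2 * (\<zeta> k x * h k x * h k x)" for x
      by (simp add: shift_def single_def power2_eq_square algebra_simps)
    then have "control_cost k (shift k t s h) = 1/2 * (LINT x|lebesgue_on \<Omega>.
        \<zeta> k x * ?b x * ?b x + 2 * (t + s) * (\<zeta> k x * ?b x * h k x) + (t + s)\<^sup>2 * (\<zeta> k x * h k x * h k x))"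
      by (simp add: control_cost_def)
    also have "\<dots> = 1/2 * ((LINT x|lebesgue_on \<Omega>. \<zeta> k x * ?b x * ?b x)
        + 2 * (t + s) * (LINT x|lebesgue_on \<Omega>. \<zeta> k x * ?b x * h k x)
        + (t + s)\<^sup>2 * (LINT x|lebesgue_on \<Omega>. \<zeta> k x * h k x * h k x))"
      using L2_integrable_mult[OF zeta_mult_L2[OF b] b] L2_integrable_mult[OF zeta_mult_L2[OF b] hk]
        L2_integrable_mult[OF zeta_mult_L2[OF hk] hk]
      by simp
    finally show ?thesis by (simp add: L2_inner_def)
  qed
  show ?thesis unfolding eq by (simp add: power2_eq_square algebra_simps)
qed

lemma F_L2: "u \<in> L2m_space \<Omega> \<Longrightarrow> F u k \<in> L2_space \<Omega>"
  using gradient by (simp add: has_partial_gradient_def)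

lemma F'_L2: "h \<in> L2m_space \<Omega> \<Longrightarrow> F' h k \<in> L2_space \<Omega>"
  using F' by (auto simp: has_L2m_derivative_def L2m_space_def)

text \<open>The mixed second derivative of the state cost. It is defined by subtraction because
  \<open>F'\<close> differentiates the gradients of the full costs, while the contribution of the
  control cost is explicit.\<close>

definition compact_part :: "'m \<Rightarrow> ('m \<Rightarrow> real^'n \<Rightarrow> real) \<Rightarrow> real" where
  "compact_part k h = L2_inner \<Omega> (F' h k) (h k) - L2_inner \<Omega> (\<lambda>x. \<zeta> k x * h k x) (h k)"

text \<open>The expansion of the full cost minus the exact expansion of the control cost. The error
  stays of second order in t and s, uniformly in h as long as the shift is small.\<close>

lemma state_cost_expansion:
  assumes \<epsilon>: "\<epsilon> > 0"
  shows "\<exists>\<delta>>0. \<forall>h\<in>L2m_space \<Omega>. \<forall>t s. (\<bar>t\<bar> + \<bar>s\<bar>) * L2m_norm \<Omega> h \<le> \<delta> \<longrightarrow>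
    \<bar>state_cost k (shift k t s h) - state_cost k (shift k t 0 h)
      - (s * L2_inner \<Omega> (\<lambda>x. F ubar k x - \<zeta> k x * (ubar k x + e\<^sub>Y x)) (h k) + t * s * compact_part k h
        + s\<^sup>2 / 2 * (L2_inner \<Omega> (F' (single k h) k) (h k) - L2_inner \<Omega> (\<lambda>x. \<zeta> k x * h k x) (h k)))\<bar>
    \<le> \<epsilon> * (\<bar>t\<bar> + \<bar>s\<bar>) * \<bar>s\<bar> * (L2m_norm \<Omega> h)\<^sup>2"
proof -
  obtain \<delta> where \<delta>: "\<delta> > 0" "\<And>h t s. h \<in> L2m_space \<Omega> \<Longrightarrow> (\<bar>t\<bar> + \<bar>s\<bar>) * L2m_norm \<Omega> h \<le> \<delta> \<Longrightarrow>
    \<bar>(state_cost k (shift k t s h) + control_cost k (shift k t s h))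
      - (state_cost k (shift k t 0 h) + control_cost k (shift k t 0 h))
      - (s * L2_inner \<Omega> (F ubar k) (h k) + t * s * L2_inner \<Omega> (F' h k) (h k)
        + s\<^sup>2 / 2 * L2_inner \<Omega> (F' (single k h) k) (h k))\<bar>
    \<le> \<epsilon> * (\<bar>t\<bar> + \<bar>s\<bar>) * \<bar>s\<bar> * (L2m_norm \<Omega> h)\<^sup>2"
    using partial_gradient_expansion[OF gradient F_L2 F' ubar \<epsilon>, of k]
    unfolding perturbed_cost_eq by (auto simp: shift_def)
  have "state_cost k (shift k t s h) - state_cost k (shift k t 0 h)
      - (s * L2_inner \<Omega> (\<lambda>x. F ubar k x - \<zeta> k x * (ubar k x + e\<^sub>Y x)) (h k) + t * s * compact_part k h
        + s\<^sup>2 / 2 * (L2_inner \<Omega> (F' (single k h) k) (h k) - L2_inner \<Omega> (\<lambda>x. \<zeta> k x * h k x) (h k)))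
    = (state_cost k (shift k t s h) + control_cost k (shift k t s h))
      - (state_cost k (shift k t 0 h) + control_cost k (shift k t 0 h))
      - (s * L2_inner \<Omega> (F ubar k) (h k) + t * s * L2_inner \<Omega> (F' h k) (h k)
        + s\<^sup>2 / 2 * L2_inner \<Omega> (F' (single k h) k) (h k))" if h: "h \<in> L2m_space \<Omega>" for h t s
  proof -
    have "L2_inner \<Omega> (\<lambda>x. F ubar k x - \<zeta> k x * (ubar k x + e\<^sub>Y x)) (h k)
        = L2_inner \<Omega> (F ubar k) (h k) - L2_inner \<Omega> (\<lambda>x. \<zeta> k x * (ubar k x + e\<^sub>Y x)) (h k)"
      by (intro L2_inner_diff_left F_L2 zeta_mult_L2 L2_add L2m_component ubar e\<^sub>Y h)
    moreover have "S - S0 - (s * (A - Z) + t * s * (B' - G) + s\<^sup>2 / 2 * (C' - G))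
        = (S + c) - (S0 + c0) - (s * A + t * s * B' + s\<^sup>2 / 2 * C')"
      if "c - c0 = s * Z + (t * s + s\<^sup>2 / 2) * G" for S S0 c c0 A B' C' Z G :: real
    proof -
      have "c = c0 + s * Z + (t * s + s\<^sup>2 / 2) * G" using that by simp
      then show ?thesis by (simp add: field_simps)
    qed
    ultimately show ?thesis
      using control_cost_shift[OF h, of k t s] by (simp only: compact_part_def)
  qed
  then show ?thesis
    using \<delta> by (intro exI[of _ \<delta>] conjI ballI allI impI) (simp_all only:)
qed

text \<open>The expansion for \<open>t = 0\<close> and \<open>t = s\<close>, divided by \<open>s\<^sup>2\<close>, shows that the quadratic terms inherit the
  weak continuity of the state cost.\<close>

lemma compact_part_tendsto:
  assumes h: "weakly_converges \<Omega> h h0"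
  shows "(\<lambda>n. compact_part k (h n)) \<longlonglongrightarrow> compact_part k h0"
proof (rule LIMSEQ_I)
  fix r :: real assume r: "r > 0"
  have h_L2m: "h n \<in> L2m_space \<Omega>" "h0 \<in> L2m_space \<Omega>" for n
    using h by (auto simp: weakly_converges_def)
  obtain C where C: "C > 0" "\<And>n. L2m_norm \<Omega> (h n) \<le> C" "L2m_norm \<Omega> h0 \<le> C"
    using weakly_converges_bounded[OF h] by blast
  \<comment> \<open>The final estimate is \<open>10 * \<epsilon> * C\<^sup>2\<close>, which is 10/16
    of r.\<close>
  define \<epsilon> where "\<epsilon> = r / (16 * C\<^sup>2)"
  have \<epsilon>: "\<epsilon> > 0" using r C(1) by (simp add: \<epsilon>_def)
  define l where "l h' = L2_inner \<Omega> (\<lambda>x. F ubar k x - \<zeta> k x * (ubar k x + e\<^sub>Y x)) (h' k)" for h'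
  define b where "b h' = L2_inner \<Omega> (F' (single k h') k) (h' k) - L2_inner \<Omega> (\<lambda>x. \<zeta> k x * h' k x) (h' k)" for h'
  define S where "S t s h' = state_cost k (shift k t s h') - state_cost k (shift k t 0 h')" for t s h'
  obtain \<delta> where \<delta>: "\<delta> > 0" "\<And>h' t s. h' \<in> L2m_space \<Omega> \<Longrightarrow> (\<bar>t\<bar> + \<bar>s\<bar>) * L2m_norm \<Omega> h' \<le> \<delta> \<Longrightarrow>
      \<bar>S t s h' - (s * l h' + t * s * compact_part k h' + s\<^sup>2 / 2 * b h')\<bar>
        \<le> \<epsilon> * (\<bar>t\<bar> + \<bar>s\<bar>) * \<bar>s\<bar> * (L2m_norm \<Omega> h')\<^sup>2"
    using state_cost_expansion[OF \<epsilon>, of k] unfolding l_def b_def S_def by blast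
  obtain \<tau> where \<tau>: "\<tau> > 0" "\<And>t s. \<bar>t\<bar> \<le> \<tau> \<Longrightarrow> \<bar>s\<bar> \<le> \<tau> \<Longrightarrow>
      (\<lambda>n. state_cost k (shift k t s (h n))) \<longlonglongrightarrow> state_cost k (shift k t s h0)"
    using state_cost_tendsto[OF h, of k] by blast
  \<comment> \<open>The first bound gives weak continuity of the state cost; the second keeps shifts
    with t \<le> s and norms up to C inside the range of the expansion.\<close>
  define s where "s = min \<tau> (\<delta> / (2 * C))"
  have s: "s > 0" "s \<le> \<tau>" "2 * s * C \<le> \<delta>"
    using \<tau>(1) \<delta>(1) C(1) by (auto simp: s_def min_def field_simps)
  have l_conv: "(\<lambda>n. l (h n)) \<longlonglongrightarrow> l h0"
    unfolding l_def L2_inner_commute[of _ _ "_ k"]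
    by (intro weakly_converges_component[OF h] L2_diff F_L2 zeta_mult_L2 L2_add L2m_component ubar e\<^sub>Y)
  have \<eta>: "\<epsilon> * s\<^sup>2 * C\<^sup>2 > 0" using \<epsilon> s(1) C(1) by simp
  \<comment> \<open>The constant 5 consists of 2 for the expansion error at \<open>h n\<close>, 2
    for that at \<open>h0\<close>, and 1 for the convergence of the costs and of the linear
    term.\<close>
  have bound: "\<forall>\<^sub>F n in sequentially.
      \<bar>t * s * (compact_part k (h n) - compact_part k h0) + s\<^sup>2 / 2 * (b (h n) - b h0)\<bar> \<le> 5 * (\<epsilon> * s\<^sup>2 * C\<^sup>2)"
    if t: "0 \<le> t" "t \<le> s" for t
  proof -
    have err: "\<bar>S t s h' - (s * l h' + t * s * compact_part k h' + s\<^sup>2 / 2 * b h')\<bar> \<le> 2 * (\<epsilon> * s\<^sup>2 * C\<^sup>2)"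
      if h': "h' \<in> L2m_space \<Omega>" "L2m_norm \<Omega> h' \<le> C" for h'
    proof -
      have "(\<bar>t\<bar> + \<bar>s\<bar>) * L2m_norm \<Omega> h' \<le> (2 * s) * C"
        using t s(1) h'(2) by (intro mult_mono) auto
      then have "\<bar>S t s h' - (s * l h' + t * s * compact_part k h' + s\<^sup>2 / 2 * b h')\<bar>
          \<le> \<epsilon> * (\<bar>t\<bar> + \<bar>s\<bar>) * \<bar>s\<bar> * (L2m_norm \<Omega> h')\<^sup>2"
        using s(3) by (intro \<delta>(2) h') simp
      also have "\<dots> \<le> \<epsilon> * (2 * s) * s * C\<^sup>2"
        using t s(1) h'(2) \<epsilon> by (intro mult_mono power_mono) auto
      finally show ?thesis by (simp add: power2_eq_square mult_ac)
    qed
    have "(\<lambda>n. (S t s (h n) - s * l (h n)) - (S t s h0 - s * l h0)) \<longlonglongrightarrow> (S t s h0 - s * l h0) - (S t s h0 - s * l h0)"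
      unfolding S_def using t s by (intro tendsto_intros \<tau>(2) l_conv) auto
    then have "(\<lambda>n. (S t s (h n) - s * l (h n)) - (S t s h0 - s * l h0)) \<longlonglongrightarrow> 0" by simp
    from tendsto_rabs_zero[OF this]
    have "\<forall>\<^sub>F n in sequentially. \<bar>(S t s (h n) - s * l (h n)) - (S t s h0 - s * l h0)\<bar> < \<epsilon> * s\<^sup>2 * C\<^sup>2"
      by (rule order_tendstoD(2)[OF _ \<eta>])
    then show ?thesis
    proof eventually_elim
      case (elim n)
      have "t * s * (compact_part k (h n) - compact_part k h0) + s\<^sup>2 / 2 * (b (h n) - b h0)
          = (t * s * compact_part k (h n) + s\<^sup>2 / 2 * b (h n)) - (t * s * compact_part k h0 + s\<^sup>2 / 2 * b h0)"
        by (simp add: field_simps)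
      then show ?case
        using elim err[OF h_L2m(1) C(2), of n] err[OF h_L2m(2) C(3)] by linarith
    qed
  qed
  have "\<forall>\<^sub>F n in sequentially. \<bar>compact_part k (h n) - compact_part k h0\<bar> < r"
    using bound[OF order_refl less_imp_le[OF s(1)]] bound[OF less_imp_le[OF s(1)] order_refl]
  proof eventually_elim
    case (elim n)
    let ?x = "compact_part k (h n) - compact_part k h0"
    \<comment> \<open>The estimate for t = s minus the one for t = 0: the terms with
      \<open>b\<close> cancel and the errors add up.\<close>
    have "\<bar>s * s * ?x\<bar> \<le> 10 * (\<epsilon> * s\<^sup>2 * C\<^sup>2)"
      using elim s(1) by linarith
    then have "s\<^sup>2 * \<bar>?x\<bar> \<le> s\<^sup>2 * (10 * \<epsilon> * C\<^sup>2)"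
      by (simp add: abs_mult power2_eq_square mult_ac)
    then have "\<bar>?x\<bar> \<le> 10 * \<epsilon> * C\<^sup>2" using s(1) by simp
    also have "\<dots> < r" using r C(1) by (simp add: \<epsilon>_def)
    finally show ?case .
  qed
  then show "\<exists>no. \<forall>n\<ge>no. norm (compact_part k (h n) - compact_part k h0) < r"
    by (simp add: eventually_sequentially)
qed

section \<open>The Legendre property\<close>

abbreviation Q :: "('m \<Rightarrow> real^'n \<Rightarrow> real) \<Rightarrow> real" where
  "Q h \<equiv> L2m_inner \<Omega> (F' h) h"

lemma Q_eq: "Q h = (\<Sum>k\<in>UNIV. compact_part k h) + (\<Sum>k\<in>UNIV. L2_inner \<Omega> (\<lambda>x. \<zeta> k x * h k x) (h k))"
  by (simp add: L2m_inner_def compact_part_def sum_subtractf)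

text \<open>Expansion about g', which will be the weak limit: the middle term is linear in g and
  vanishes in the limit, and the last one measures the distance.\<close>

lemma zeta_form_expand:
  assumes "g \<in> L2_space \<Omega>" "g' \<in> L2_space \<Omega>"
  shows "L2_inner \<Omega> (\<lambda>x. \<zeta> k x * g x) g = L2_inner \<Omega> (\<lambda>x. \<zeta> k x * g' x) g'
    + 2 * (L2_inner \<Omega> g (\<lambda>x. \<zeta> k x * g' x) - L2_inner \<Omega> g' (\<lambda>x. \<zeta> k x * g' x))
    + L2_inner \<Omega> (\<lambda>x. \<zeta> k x * (g x - g' x)) (\<lambda>x. g x - g' x)"
proof -
  have "L2_inner \<Omega> (\<lambda>x. \<zeta> k x * (g x - g' x)) (\<lambda>x. g x - g' x)
      = (LINT x|lebesgue_on \<Omega>. \<zeta> k x * g x * g x - 2 * (g x * (\<zeta> k x * g' x)) + \<zeta> k x * g' x * g' x)"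
    by (simp add: L2_inner_def algebra_simps)
  also have "\<dots> = L2_inner \<Omega> (\<lambda>x. \<zeta> k x * g x) g - 2 * L2_inner \<Omega> g (\<lambda>x. \<zeta> k x * g' x)
      + L2_inner \<Omega> (\<lambda>x. \<zeta> k x * g' x) g'"
    using L2_integrable_mult[OF zeta_mult_L2[OF assms(1), of k] assms(1)]
      L2_integrable_mult[OF zeta_mult_L2[OF assms(2), of k] assms(2)]
      L2_integrable_mult[OF assms(1) zeta_mult_L2[OF assms(2), of k]]
    by (simp add: L2_inner_def)
  finally show ?thesis by (simp add: L2_inner_commute[of _ g' "\<lambda>x. \<zeta> k x * g' x"])
qed

lemma zeta_form_coercive:
  assumes "g \<in> L2_space \<Omega>"
  shows "\<zeta>0 k * (L2_norm \<Omega> g)\<^sup>2 \<le> L2_inner \<Omega> (\<lambda>x. \<zeta> k x * g x) g"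
proof -
  have "\<zeta>0 k * (L2_norm \<Omega> g)\<^sup>2 = (LINT x|lebesgue_on \<Omega>. \<zeta>0 k * (g x)\<^sup>2)"
    by (simp add: L2_norm_sq L2_inner_self)
  also have "\<dots> \<le> L2_inner \<Omega> (\<lambda>x. \<zeta> k x * g x) g"
    unfolding L2_inner_def
  proof (rule integral_mono_AE)
    show "integrable (lebesgue_on \<Omega>) (\<lambda>x. \<zeta>0 k * (g x)\<^sup>2)" using L2_integrable_sq[OF assms] by simp
    show "integrable (lebesgue_on \<Omega>) (\<lambda>x. \<zeta> k x * g x * g x)"
      by (rule L2_integrable_mult[OF zeta_mult_L2[OF assms] assms])
    show "AE x in lebesgue_on \<Omega>. \<zeta>0 k * (g x)\<^sup>2 \<le> \<zeta> k x * g x * g x"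
      using zeta(3)[of k]
      by eventually_elim (simp add: power2_eq_square mult.assoc mult_right_mono)
  qed
  finally show ?thesis .
qed

text \<open>Apart from the weighted squared distance to the limit, every term of
  \<open>Q (h n)\<close> is weakly continuous. The subtracted sum is nonnegative and dominates a
  multiple of the squared distance, so this one limit yields both Legendre properties.\<close>

lemma Q_lower_bound_tendsto:
  assumes h: "weakly_converges \<Omega> h h0"
  shows "(\<lambda>n. Q (h n) - (\<Sum>k\<in>UNIV. L2_inner \<Omega> (\<lambda>x. \<zeta> k x * (h n k x - h0 k x)) (\<lambda>x. h n k x - h0 k x))) \<longlonglongrightarrow> Q h0"
proof -
  have h_L2: "h n k \<in> L2_space \<Omega>" "h0 k \<in> L2_space \<Omega>" for n k
    using h by (auto simp: weakly_converges_def L2m_space_def)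
  have eq: "Q (h n) - (\<Sum>k\<in>UNIV. L2_inner \<Omega> (\<lambda>x. \<zeta> k x * (h n k x - h0 k x)) (\<lambda>x. h n k x - h0 k x))
      = (\<Sum>k\<in>UNIV. compact_part k (h n)) + (\<Sum>k\<in>UNIV. L2_inner \<Omega> (\<lambda>x. \<zeta> k x * h0 k x) (h0 k)
        + 2 * (L2_inner \<Omega> (h n k) (\<lambda>x. \<zeta> k x * h0 k x) - L2_inner \<Omega> (h0 k) (\<lambda>x. \<zeta> k x * h0 k x)))" for n
  proof -
    have "(\<Sum>k\<in>UNIV. L2_inner \<Omega> (\<lambda>x. \<zeta> k x * h n k x) (h n k))
        = (\<Sum>k\<in>UNIV. L2_inner \<Omega> (\<lambda>x. \<zeta> k x * h0 k x) (h0 k)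
          + 2 * (L2_inner \<Omega> (h n k) (\<lambda>x. \<zeta> k x * h0 k x) - L2_inner \<Omega> (h0 k) (\<lambda>x. \<zeta> k x * h0 k x))
          + L2_inner \<Omega> (\<lambda>x. \<zeta> k x * (h n k x - h0 k x)) (\<lambda>x. h n k x - h0 k x))"
      by (rule sum.cong[OF refl], rule zeta_form_expand[OF h_L2])
    then show ?thesis unfolding Q_eq by (simp add: sum.distrib)
  qed
  have "(\<lambda>n. Q (h n) - (\<Sum>k\<in>UNIV. L2_inner \<Omega> (\<lambda>x. \<zeta> k x * (h n k x - h0 k x)) (\<lambda>x. h n k x - h0 k x)))
      \<longlonglongrightarrow> (\<Sum>k\<in>UNIV. compact_part k h0) + (\<Sum>k\<in>UNIV. L2_inner \<Omega> (\<lambda>x. \<zeta> k x * h0 k x) (h0 k)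
        + 2 * (L2_inner \<Omega> (h0 k) (\<lambda>x. \<zeta> k x * h0 k x) - L2_inner \<Omega> (h0 k) (\<lambda>x. \<zeta> k x * h0 k x)))"
    unfolding eq
    by (intro tendsto_intros compact_part_tendsto[OF h] weakly_converges_component[OF h] zeta_mult_L2 h_L2)
  then show ?thesis unfolding Q_eq[of h0] by simp
qed

lemma legendre_form_Q: "legendre_form \<Omega> Q"
  unfolding legendre_form_def
proof (intro conjI allI impI)
  show "quadratic_form \<Omega> Q"
    unfolding quadratic_form_def
  \<comment> \<open>The bilinear form need not be symmetric, since each component of
    \<open>F\<close> differentiates the cost of a different player.\<close>
  proof (intro exI[of _ "\<lambda>h g. L2m_inner \<Omega> (F' h) g"] conjI ballI allI)
    fix h h' g :: "'m \<Rightarrow> real^'n \<Rightarrow> real" and s t :: real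
    assume L2m: "h \<in> L2m_space \<Omega>" "h' \<in> L2m_space \<Omega>" "g \<in> L2m_space \<Omega>"
    show "L2m_inner \<Omega> (F' (\<lambda>k x. s * h k x + t * h' k x)) g = s * L2m_inner \<Omega> (F' h) g + t * L2m_inner \<Omega> (F' h') g"
    proof -
      have "L2_inner \<Omega> (F' (\<lambda>k x. s * h k x + t * h' k x) k) (g k)
          = s * L2_inner \<Omega> (F' h k) (g k) + t * L2_inner \<Omega> (F' h' k) (g k)" for k
      proof -
        have "AE x in lebesgue_on \<Omega>. F' (\<lambda>k x. s * h k x + t * h' k x) k x = s * F' h k x + t * F' h' k x"
          using F' L2m unfolding has_L2m_derivative_def by blast
        then have "L2_inner \<Omega> (F' (\<lambda>k x. s * h k x + t * h' k x) k) (g k)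
            = L2_inner \<Omega> (\<lambda>x. s * F' h k x + t * F' h' k x) (g k)"
          by (intro L2_inner_cong_AE_L2 F'_L2 L2_add L2_cmult L2m_combination L2m L2m_component)
        then show ?thesis
          by (simp add: L2_inner_add_left L2_inner_cmult_left L2_cmult F'_L2 L2m L2m_component)
      qed
      then show ?thesis by (simp add: L2m_inner_def sum.distrib sum_distrib_left)
    qed
    show "L2m_inner \<Omega> (F' g) (\<lambda>k x. s * h k x + t * h' k x) = s * L2m_inner \<Omega> (F' g) h + t * L2m_inner \<Omega> (F' g) h'"
      unfolding L2m_inner_def L2_inner_commute[of _ "F' g _"]
      by (simp add: L2_inner_add_left L2_inner_cmult_left L2_cmult F'_L2 L2m L2m_component sum.distrib sum_distrib_left)
  qed simp
next
  fix h :: "nat \<Rightarrow> 'm \<Rightarrow> real^'n \<Rightarrow> real" and h0 assume h: "weakly_converges \<Omega> h h0"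
  let ?R = "\<lambda>n. \<Sum>k\<in>UNIV. L2_inner \<Omega> (\<lambda>x. \<zeta> k x * (h n k x - h0 k x)) (\<lambda>x. h n k x - h0 k x)"
  have diff_L2: "(\<lambda>x. h n k x - h0 k x) \<in> L2_space \<Omega>" for n k
    using h by (auto simp: weakly_converges_def L2m_space_def intro!: L2_diff)
  have "0 \<le> ?R n" for n
    by (intro sum_nonneg order_trans[OF _ zeta_form_coercive[OF diff_L2]])
       (simp add: zeta(2) less_imp_le)
  then have "ereal (Q (h n) - ?R n) \<le> ereal (Q (h n))" for n by simp
  then have "liminf (\<lambda>n. ereal (Q (h n) - ?R n)) \<le> liminf (\<lambda>n. ereal (Q (h n)))"
    by (intro Liminf_mono always_eventually) auto
  moreover have "liminf (\<lambda>n. ereal (Q (h n) - ?R n)) = ereal (Q h0)"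
    using Q_lower_bound_tendsto[OF h] by (intro lim_imp_Liminf) (simp_all add: lim_ereal)
  ultimately show "ereal (Q h0) \<le> liminf (\<lambda>n. ereal (Q (h n)))" by simp
next
  fix h :: "nat \<Rightarrow> 'm \<Rightarrow> real^'n \<Rightarrow> real" and h0
  assume "weakly_converges \<Omega> h h0 \<and> (\<lambda>n. Q (h n)) \<longlonglongrightarrow> Q h0"
  then have h: "weakly_converges \<Omega> h h0" and Q: "(\<lambda>n. Q (h n)) \<longlonglongrightarrow> Q h0" by auto
  let ?R = "\<lambda>n. \<Sum>k\<in>UNIV. L2_inner \<Omega> (\<lambda>x. \<zeta> k x * (h n k x - h0 k x)) (\<lambda>x. h n k x - h0 k x)"
  have diff_L2: "(\<lambda>x. h n k x - h0 k x) \<in> L2_space \<Omega>" for n k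
    using h by (auto simp: weakly_converges_def L2m_space_def intro!: L2_diff)
  \<comment> \<open>Both \<open>Q (h n)\<close> and \<open>Q (h n) - ?R n\<close> tend to
    \<open>Q h0\<close>.\<close>
  have R: "?R \<longlonglongrightarrow> 0"
    using tendsto_diff[OF Q Q_lower_bound_tendsto[OF h]] by simp
  \<comment> \<open>Finitely many players, so the lower bounds \<open>\<zeta>0 k\<close> have a
    positive minimum.\<close>
  define c where "c = Min (range \<zeta>0)"
  have c: "c > 0" "\<And>k. c \<le> \<zeta>0 k" using zeta(2) by (auto simp: c_def)
  have le: "c * (L2m_norm \<Omega> (\<lambda>k x. h n k x - h0 k x))\<^sup>2 \<le> ?R n" for n
    unfolding L2m_norm_sq sum_distrib_left
  proof (rule sum_mono)
    fix k
    have "c * (L2_norm \<Omega> (\<lambda>x. h n k x - h0 k x))\<^sup>2 \<le> \<zeta>0 k * (L2_norm \<Omega> (\<lambda>x. h n k x - h0 k x))\<^sup>2"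
      by (intro mult_right_mono c) simp
    also have "\<dots> \<le> L2_inner \<Omega> (\<lambda>x. \<zeta> k x * (h n k x - h0 k x)) (\<lambda>x. h n k x - h0 k x)"
      by (rule zeta_form_coercive[OF diff_L2])
    finally show "c * (L2_norm \<Omega> (\<lambda>x. h n k x - h0 k x))\<^sup>2
        \<le> L2_inner \<Omega> (\<lambda>x. \<zeta> k x * (h n k x - h0 k x)) (\<lambda>x. h n k x - h0 k x)" .
  qed
  have "(\<lambda>n. (L2m_norm \<Omega> (\<lambda>k x. h n k x - h0 k x))\<^sup>2) \<longlonglongrightarrow> 0"
  proof (rule Lim_null_comparison)
    show "(\<lambda>n. ?R n / c) \<longlonglongrightarrow> 0" using tendsto_divide[OF R tendsto_const, of c] c(1) by simp
    show "\<forall>\<^sub>F n in sequentially. norm ((L2m_norm \<Omega> (\<lambda>k x. h n k x - h0 k x))\<^sup>2) \<le> ?R n / c"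
      using le c(1) by (intro always_eventually) (simp add: pos_le_divide_eq mult.commute)
  qed
  from tendsto_real_sqrt[OF this]
  have "(\<lambda>n. L2m_norm \<Omega> (\<lambda>k x. h n k x - h0 k x)) \<longlonglongrightarrow> 0" by simp
  then show "strongly_converges \<Omega> h h0"
    using h by (simp add: strongly_converges_def weakly_converges_def)
qed

end

theorem lemma4p7:
  fixes \<Omega> :: "(real^'n::finite) set"
    and a :: "'n \<Rightarrow> 'n \<Rightarrow> real^'n \<Rightarrow> real"
    and f :: "real^'n \<Rightarrow> real \<Rightarrow> real"
    and L :: "'m::finite \<Rightarrow> real^'n \<Rightarrow> real \<Rightarrow> real"
    and \<zeta> B :: "'m \<Rightarrow> real^'n \<Rightarrow> real"
    and \<zeta>0 :: "'m \<Rightarrow> real"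
    and y :: "(real^'n \<Rightarrow> real) \<Rightarrow> (real^'n \<Rightarrow> real)"
    and EY :: "(real^'n \<Rightarrow> real) metric"
    and EJ :: "'m \<Rightarrow> (real^'n \<Rightarrow> real) metric"
    and EB :: "'m \<Rightarrow> 'p metric"
    and U :: "'m \<Rightarrow> (real^'n \<Rightarrow> real) \<times> 'p \<Rightarrow> (real^'n \<Rightarrow> real) set"
    and F :: "('m \<Rightarrow> real^'n \<Rightarrow> real) \<Rightarrow> ('n, 'm, 'p) param \<Rightarrow> ('m \<Rightarrow> real^'n \<Rightarrow> real)"
    and F' :: "('m \<Rightarrow> real^'n \<Rightarrow> real) \<Rightarrow> ('m \<Rightarrow> real^'n \<Rightarrow> real)"
    and ubar :: "'m \<Rightarrow> real^'n \<Rightarrow> real"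
    and ebar :: "('n, 'm, 'p) param"
  assumes dim: "CARD('n) \<le> 3"
    and domain: "lipschitz_domain \<Omega>"
    and operator: "elliptic_coefficients \<Omega> a"
    and zeta: "\<forall>k. \<zeta> k \<in> Linf_space \<Omega> \<and> \<zeta>0 k > 0 \<and> (AE x in lebesgue_on \<Omega>. \<zeta> k x \<ge> \<zeta>0 k)"
    and B: "\<forall>k. B k \<in> Linf_space \<Omega>"
    and f: "state_nonlinearity \<Omega> f"
    and L: "\<forall>k. cost_integrand \<Omega> (L k)"
    and state: "\<forall>w\<in>L2_space \<Omega>. weak_solution \<Omega> a f w (y w)"
    and EY: "mspace EY \<subseteq> L2_space \<Omega>"
    and EJ: "\<forall>k. mspace (EJ k) \<subseteq> L2_space \<Omega>"
    and U: "\<forall>k. \<forall>ek\<in>mspace (EJ k) \<times> mspace (EB k).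
              U k ek \<subseteq> L2_space \<Omega> \<and> L2_convex (U k ek) \<and> L2_closed \<Omega> (U k ek) \<and>
              L2_bounded \<Omega> (U k ek)"
    and F: "\<forall>u\<in>L2m_space \<Omega>. \<forall>e\<in>mspace (param_metric EY EJ EB). \<forall>k.
              has_partial_gradient \<Omega> k (\<lambda>v. perturbed_cost \<Omega> L \<zeta> B y k v (fst e) (snd e k))
                u (F u e k)"
    and ubar: "ubar \<in> L2m_space \<Omega>"
    and ebar: "ebar \<in> mspace (param_metric EY EJ EB)"
    and F': "has_L2m_derivative \<Omega> (\<lambda>u. F u ebar) F' ubar"
    and nonempty: "\<exists>\<rho>>0. \<forall>e\<in>mcball_of (param_metric EY EJ EB) ebar \<rho>. admissible_set U e \<noteq> {}"
  shows "legendre_form \<Omega> (\<lambda>h. L2m_inner \<Omega> (F' h) h)"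
proof -
  have "fst ebar \<in> mspace EY" "\<And>k. fst (snd ebar k) \<in> mspace (EJ k)"
    using ebar by (auto simp: param_space_def mem_Times_iff)
  then have params: "fst ebar \<in> L2_space \<Omega>" "\<And>k. fst (snd ebar k) \<in> L2_space \<Omega>"
    using EY EJ by blast+
  interpret perturbed_game \<Omega> a f y L \<zeta> B \<zeta>0 "fst ebar" "snd ebar" "\<lambda>u. F u ebar" F' ubar
    by unfold_locales
       (use domain operator zeta B f L state F ubar ebar F' params in \<open>auto simp: lipschitz_domain_def\<close>)
  show ?thesis by (rule legendre_form_Q)
qed

end
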